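(* Let $X_1,\dots,X_r$ be uniformly nonsquare Banach spaces and let $\|\cdot\|_\psi$ be an absolute normalized norm on $\mathbb{R}^r$ which is strictly monotone. Then the direct sum $(X_1\oplus\dots\oplus X_r)_\psi$ has the fixed point property and the super fixed point property for asymptotically nonexpansive mappings in the intermediate sense. If $r=2$, the same conclusion holds for every absolute normalized norm $\|\cdot\|_\psi$ on $\mathbb{R}^2$ (without assuming strict monotonicity).
   Context: A Banach space $X$ is uniformly nonsquare if $\sup_{x,y\in S_X}\min\{\|x+y\|,\|x-y\|\}<2$. A norm on $\mathbb{R}^r$ is absolute if $\|(x_1,\dots,x_r)\|=\|(|x_1|,\dots,|x_r|)\|$, normalized if standard unit vectors have norm 1, strictly monotone if $\|(x_i)\|<\|(y_i)\|$ whenever $|x_i|\le|y_i|$ for all $i$ with strict inequality for some $i$. $(X_1\oplus\dots\oplus X_r)_\psi$ is $X_1\times\dots\times X_r$ with norm $\|(x_1,\dots,x_r)\|_\psi=\|(\|x_1\|,\dots,\|x_r\|)\|_\psi$. A mapping $T:C\to C$ is asymptotically nonexpansive in the intermediate sense if $T$ is continuous and $\limsup_{n\to\infty}\sup_{x,y\in C}(\|T^nx-T^ny\|-\|x-y\|)\le0$. A Banach space has the fixed point property for such mappings if every such $T:C\to C$ on a nonempty bounded closed convex subset $C$ has a fixed point; $X$ has the super fixed point property for such mappings if every Banach space finitely representable in $X$ has the fixed point property for such mappings. *)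

theory Defs
  imports "HOL-Analysis.Analysis"
begin

definition uniformly_nonsquare :: "'a::real_normed_vector set \<Rightarrow> bool" where
  "uniformly_nonsquare S \<longleftrightarrow>
     (\<exists>d<2. \<forall>x\<in>S. \<forall>y\<in>S. norm x = 1 \<and> norm y = 1 \<longrightarrow>
        min (norm (x + y)) (norm (x - y)) \<le> d)"

definition is_norm_on_Rn :: "(real^'n::finite \<Rightarrow> real) \<Rightarrow> bool" where
  "is_norm_on_Rn \<psi> \<longleftrightarrow>
     (\<forall>x. 0 \<le> \<psi> x) \<and> (\<forall>x. \<psi> x = 0 \<longleftrightarrow> x = 0) \<and>
     (\<forall>c x. \<psi> (c *\<^sub>R x) = \<bar>c\<bar> * \<psi> x) \<and>
     (\<forall>x y. \<psi> (x + y) \<le> \<psi> x + \<psi> y)"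

definition absolute_normalized_norm :: "(real^'n::finite \<Rightarrow> real) \<Rightarrow> bool" where
  "absolute_normalized_norm \<psi> \<longleftrightarrow>
     is_norm_on_Rn \<psi> \<and>
     (\<forall>x. \<psi> x = \<psi> (\<chi> i. \<bar>x $ i\<bar>)) \<and>
     (\<forall>i. \<psi> (axis i 1) = 1)"

definition strictly_monotone_norm :: "(real^'n::finite \<Rightarrow> real) \<Rightarrow> bool" where
  "strictly_monotone_norm \<psi> \<longleftrightarrow>
     (\<forall>x y. (\<forall>i. \<bar>x $ i\<bar> \<le> \<bar>y $ i\<bar>) \<and> (\<exists>i. \<bar>x $ i\<bar> < \<bar>y $ i\<bar>) \<longrightarrow> \<psi> x < \<psi> y)"

definition psi_sum :: "('n::finite \<Rightarrow> 'a::real_normed_vector set) \<Rightarrow> ('a^'n) set" where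
  "psi_sum X = {x. \<forall>i. x $ i \<in> X i}"

definition psi_norm :: "(real^'n::finite \<Rightarrow> real) \<Rightarrow> 'a::real_normed_vector^'n \<Rightarrow> real" where
  "psi_norm \<psi> x = \<psi> (\<chi> i. norm (x $ i))"

text \<open>Notions relative to a normed space given by a carrier V (a linear subspace of a real
  vector space) and a norm N on V.\<close>
definition n_bounded :: "('v \<Rightarrow> real) \<Rightarrow> 'v set \<Rightarrow> bool" where
  "n_bounded N C \<longleftrightarrow> (\<exists>M. \<forall>x\<in>C. N x \<le> M)"

definition n_closed_in :: "'v set \<Rightarrow> ('v::real_vector \<Rightarrow> real) \<Rightarrow> 'v set \<Rightarrow> bool" where
  "n_closed_in V N C \<longleftrightarrow>
     (\<forall>s x. (\<forall>k. s k \<in> C) \<and> x \<in> V \<and> (\<lambda>k. N (s k - x)) \<longlonglongrightarrow> 0 \<longrightarrow> x \<in> C)"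

definition n_continuous_on :: "('v::real_vector \<Rightarrow> real) \<Rightarrow> 'v set \<Rightarrow> ('v \<Rightarrow> 'v) \<Rightarrow> bool" where
  "n_continuous_on N C T \<longleftrightarrow>
     (\<forall>x\<in>C. \<forall>e>0. \<exists>d>0. \<forall>y\<in>C. N (y - x) < d \<longrightarrow> N (T y - T x) < e)"

definition asympt_nonexp_intermediate ::
  "('v::real_vector \<Rightarrow> real) \<Rightarrow> 'v set \<Rightarrow> ('v \<Rightarrow> 'v) \<Rightarrow> bool" where
  "asympt_nonexp_intermediate N C T \<longleftrightarrow>
     n_continuous_on N C T \<and>
     (\<forall>e>0. \<exists>n0. \<forall>n\<ge>n0. \<forall>x\<in>C. \<forall>y\<in>C. N ((T ^^ n) x - (T ^^ n) y) - N (x - y) \<le> e)"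

definition fpp_ani :: "'v::real_vector set \<Rightarrow> ('v \<Rightarrow> real) \<Rightarrow> bool" where
  "fpp_ani V N \<longleftrightarrow>
     (\<forall>C. C \<noteq> {} \<and> C \<subseteq> V \<and> n_bounded N C \<and> n_closed_in V N C \<and> convex C \<longrightarrow>
        (\<forall>T. T ` C \<subseteq> C \<and> asympt_nonexp_intermediate N C T \<longrightarrow> (\<exists>x\<in>C. T x = x)))"

text \<open>The Banach space 'b is finitely representable in (V, N): for every finite-dimensional
  subspace F of 'b and every e > 0 there is a linear isomorphism T of F onto a subspace
  of V with ||T|| ||T^-1|| <= 1 + e.\<close>
definition finitely_representable_in ::
  "'b::real_normed_vector itself \<Rightarrow> 'v::real_vector set \<Rightarrow> ('v \<Rightarrow> real) \<Rightarrow> bool" where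
  "finitely_representable_in _ V N \<longleftrightarrow>
     (\<forall>(F::'b set) e. subspace F \<and> (\<exists>B. finite B \<and> F = span B) \<and> e > 0 \<longrightarrow>
        (\<exists>T::'b \<Rightarrow> 'v. linear T \<and> T ` F \<subseteq> V \<and>
           (\<exists>a b. 0 < a \<and> b \<le> (1 + e) * a \<and>
              (\<forall>x\<in>F. a * norm x \<le> N (T x) \<and> N (T x) \<le> b * norm x))))"

end

theory Submission
  imports Defs "HOL-Analysis.Finite_Function_Topology"
begin

text \<open>
  By ultralimits of seminorms, both claims reduce to a complete space whose norm is
  \<open>\<psi>(p\<^sub>1, \<dots>, p\<^sub>r)\<close> for seminorms \<open>p\<^sub>l\<close> that are nonsquare with a common constant.

  For such seminorms James' argument shows that in every long enough bounded finite sequence some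
  convex combination of early terms almost coincides with one of late terms. This replaces weak
  compactness.

  Averages of squared distances along an orbit window are almost invariant convex functions.
  Let \<open>\<rho>\<^sup>2\<close> be the smallest level such that every almost invariant sublevel set contains
  a point to which, on average, late orbit windows come that close. If \<open>\<rho> = 0\<close>, nested sublevel sets
  shrink to a fixed point. If \<open>\<rho> > 0\<close>, choose successively later orbit points \<open>x\<^sub>n\<close> at mutual
  distance and at distance to a base point \<open>z\<^sub>0\<close> of about \<open>\<rho>\<close>, and apply a power of the
  map to \<open>(1 - t) z\<^sub>0 + t x\<^sub>n\<close>. This gives points \<open>W\<^sub>n\<close> with mutual distances at most
  \<open>t \<rho>\<close> and at distance at most \<open>(1 - t) \<rho>\<close> from the image of \<open>x\<^sub>n\<close>, whereas by extremality
  of \<open>\<rho>\<close> and James' argument they lie at distance about \<open>\<rho>\<close> from the mean of those images. The triangle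
  inequality is therefore almost an equality, so nonsquareness forces each coordinate to be carried by one of the two
  parts of the splitting. Hence \<open>t \<rho>\<close> is close to a mean distance of the \<open>x\<^sub>n\<close> restricted
  to a set of coordinates. There are only finitely many such values and they do not depend
  on \<open>t\<close>, so a suitable \<open>t\<close> gives a contradiction.
\<close>

text \<open>The obstacle is that only high powers of the map are nonexpansive, and these only up to
  a small error. Averaging over the times from \<open>M\<close> to \<open>2 * M\<close> repairs
  this: a shift by \<open>j\<close> changes an average by \<open>O(j / M)\<close>, and a lower bound
  for an average over a window yields one good exponent inside it. Squares are averaged because
  near-equality in Minkowski's inequality for the quadratic mean forces distances to be nearly
  constant. The lower bound at a point \<open>z\<close> holds on some window whose position depends
  on \<open>z\<close>, while the orbit windows placed later must be long compared with it. So
  \<open>z\<close> has to lie in the hull of finitely many points known before the later windows are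
  placed. This is why James' argument is needed in a finite form, with a length fixed in
  advance.\<close>

section \<open>Ultrafilters and ultralimits of bounded real families\<close>

definition ultra :: "'a filter \<Rightarrow> bool" where
  "ultra U \<longleftrightarrow> U \<noteq> bot \<and> (\<forall>P. eventually P U \<or> eventually (\<lambda>x. \<not> P x) U)"

text \<open>Zorn's lemma for the reversed order produces a minimal proper filter below
  \<open>F\<close>. It decides every \<open>P\<close>: if neither \<open>P\<close> nor its negation
  were eventual, intersecting with \<open>P\<close> would give a proper filter, which by minimality
  is the same one, so \<open>P\<close> would be eventual after all.\<close>

lemma ultra_exists:
  fixes F :: "'a filter"
  assumes F: "F \<noteq> bot"
  shows "\<exists>U\<le>F. ultra U"
proof -
  define A where "A = {G. G \<le> F \<and> G \<noteq> bot}"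
  have "\<exists>m\<in>A. \<forall>a\<in>A. a \<le> m \<longrightarrow> a = m"
  proof (rule predicate_Zorn[where P = "\<lambda>a b. b \<le> a"])
    show "partial_order_on A (relation_of (\<lambda>a b. b \<le> a) A)"
      by (auto simp: partial_order_on_def preorder_on_def refl_on_def trans_def antisym_def relation_of_def)
  next
    fix C assume C: "C \<in> Chains (relation_of (\<lambda>a b. b \<le> a) A)"
    show "\<exists>u\<in>A. \<forall>a\<in>C. u \<le> a"
    proof (cases "C = {}")
      case True
      then show ?thesis using F by (auto simp: A_def)
    next
      case False
      have CA: "C \<subseteq> A" using C by (auto simp: Chains_def relation_of_def)
      have tot: "\<And>G H. G \<in> C \<Longrightarrow> H \<in> C \<Longrightarrow> G \<le> H \<or> H \<le> G"
        using C by (auto simp: Chains_def relation_of_def)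
      \<comment> \<open>In a chain one member witnesses eventuality for the infimum, so the infimum
        of proper filters stays proper.\<close>
      have ev: "eventually P (Inf C) \<longleftrightarrow> (\<exists>b\<in>C. eventually P b)" for P
      proof (rule eventually_Inf_base[OF False])
        fix G H assume "G \<in> C" "H \<in> C"
        then show "\<exists>x\<in>C. x \<le> inf G H" using tot[of G H] by (metis inf.absorb1 inf.absorb2 order_refl)
      qed
      have "Inf C \<noteq> bot"
      proof
        assume "Inf C = bot"
        then obtain b where "b \<in> C" "eventually (\<lambda>x. False) b"
          using ev[of "\<lambda>x. False"] by auto
        then show False using CA by (auto simp: A_def eventually_False)
      qed
      moreover have "Inf C \<le> F" using False CA by (auto simp: A_def intro: Inf_lower2)
      ultimately show ?thesis by (auto simp: A_def intro: Inf_lower intro!: bexI[of _ "Inf C"])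
    qed
  qed
  then obtain m where m: "m \<le> F" "m \<noteq> bot" and mx: "\<And>a. a \<le> F \<Longrightarrow> a \<noteq> bot \<Longrightarrow> a \<le> m \<Longrightarrow> a = m"
    by (auto simp: A_def)
  have "eventually P m \<or> eventually (\<lambda>x. \<not> P x) m" for P
  proof (rule ccontr)
    assume c: "\<not> (eventually P m \<or> eventually (\<lambda>x. \<not> P x) m)"
    let ?G = "inf m (principal {x. P x})"
    have "?G \<noteq> bot"
    proof
      assume "?G = bot"
      then have "eventually (\<lambda>x. False) ?G" by (simp add: eventually_False)
      then show False using c by (simp add: eventually_inf_principal)
    qed
    moreover have "?G \<le> F" using m(1) by (simp add: le_infI1)
    ultimately have "?G = m" using mx by simp
    then have "eventually P m"
      by (metis (mono_tags, lifting) eventually_inf_principal eventually_mono mem_Collect_eq always_eventually)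
    then show False using c by simp
  qed
  then show ?thesis using m by (auto simp: ultra_def)
qed

lemma ultra_neq_bot: "ultra U \<Longrightarrow> U \<noteq> bot"
  by (simp add: ultra_def)

text \<open>Compactness of the interval gives a cluster point of the values, and an ultrafilter
  converges to each of its cluster points.\<close>

lemma ultra_tendsto_bounded:
  fixes f :: "'i \<Rightarrow> real"
  assumes U: "ultra U" and b: "eventually (\<lambda>i. \<bar>f i\<bar> \<le> B) U"
  shows "(f \<longlongrightarrow> Lim U f) U"
proof -
  let ?G = "filtermap f U"
  have "?G \<noteq> bot" using U by (simp add: ultra_def filtermap_bot_iff)
  moreover have "eventually (\<lambda>x. x \<in> {-B..B}) ?G"
    using b by (simp add: eventually_filtermap abs_le_iff) (smt (verit) eventually_mono)
  ultimately obtain x where x: "inf (nhds x) ?G \<noteq> bot"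
    using compact_Icc[of "-B" B] unfolding compact_filter by blast
  have "(f \<longlongrightarrow> x) U"
  proof (rule topological_tendstoI)
    fix T assume T: "open T" "x \<in> T"
    show "eventually (\<lambda>i. f i \<in> T) U"
    proof (rule ccontr)
      assume "\<not> ?thesis"
      then have "eventually (\<lambda>i. f i \<notin> T) U" using U unfolding ultra_def by blast
      then have "eventually (\<lambda>y. y \<notin> T) ?G" by (simp add: eventually_filtermap)
      moreover have "eventually (\<lambda>y. y \<in> T) (nhds x)" using T by (simp add: eventually_nhds_in_open)
      ultimately have "eventually (\<lambda>y. False) (inf (nhds x) ?G)"
        unfolding eventually_inf by (metis (mono_tags, lifting))
      then show False using x by (simp add: eventually_False)
    qed
  qed
  then show ?thesis using tendsto_Lim[OF ultra_neq_bot[OF U]] by metis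
qed

lemma seq_ultra_exists: "\<exists>U. ultra U \<and> U \<le> sequentially"
  using ultra_exists[of sequentially] by (auto simp: trivial_limit_sequentially)

section \<open>Uniform nonsquareness and spreading models\<close>


locale seminorm =
  fixes p :: "'v::real_vector \<Rightarrow> real"
  assumes add_le: "p (x + y) \<le> p x + p y"
    and scale: "p (c *\<^sub>R x) = \<bar>c\<bar> * p x"
begin

lemma zero [simp]: "p 0 = 0"
  using scale[of 0 0] by simp

lemma minus [simp]: "p (- x) = p x"
  using scale[of "-1" x] by simp

lemma nonneg [simp]: "0 \<le> p x"
  using add_le[of x "-x"] by simp

lemma minus_commute: "p (x - y) = p (y - x)"
  by (metis minus minus_diff_eq)

lemma diff_le: "p (x - y) \<le> p x + p y"
  using add_le[of x "-y"] by simp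

lemma triangle: "p (x - z) \<le> p (x - y) + p (y - z)"
  using add_le[of "x - y" "y - z"] by simp

lemma le_diff: "p x \<le> p y + p (x - y)"
  using add_le[of y "x - y"] by simp

lemma abs_diff_le: "\<bar>p x - p y\<bar> \<le> p (x - y)"
  using le_diff[of x y] le_diff[of y x] minus_commute[of x y] by linarith

lemma sum_le: "p (sum f A) \<le> (\<Sum>i\<in>A. p (f i))"
proof (induction A rule: infinite_finite_induct)
  case (insert a A)
  then show ?case using add_le[of "f a" "sum f A"] by simp
qed auto

lemma convex_on: "convex C \<Longrightarrow> convex_on C (\<lambda>y. p (x - y))"
proof (rule convex_onI)
  fix t u v assume t: "0 < (t::real)" "t < 1"
  have "x - ((1 - t) *\<^sub>R u + t *\<^sub>R v) = (1 - t) *\<^sub>R (x - u) + t *\<^sub>R (x - v)"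
    by (simp add: algebra_simps)
  then show "p (x - ((1 - t) *\<^sub>R u + t *\<^sub>R v)) \<le> (1 - t) * p (x - u) + t * p (x - v)"
    using add_le[of "(1 - t) *\<^sub>R (x - u)" "t *\<^sub>R (x - v)"] t by (simp add: scale)
qed

end

text \<open>A homogeneous form of uniform nonsquareness: on unit vectors it bounds the smaller norm
  by \<open>2 - \<kappa>\<close>. It makes sense for seminorms, and as a non-strict inequality
  between continuous expressions it survives ultralimits with the same constant.\<close>

definition nonsquare_on :: "'v::real_vector set \<Rightarrow> real \<Rightarrow> ('v \<Rightarrow> real) \<Rightarrow> bool" where
  "nonsquare_on V \<kappa> p \<longleftrightarrow> 0 < \<kappa> \<and> \<kappa> \<le> 1 \<and>
     (\<forall>x\<in>V. \<forall>y\<in>V. min (p (x + y)) (p (x - y)) \<le> p x + p y - \<kappa> * min (p x) (p y))"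

locale spreading = seminorm p for p :: "'v::real_vector \<Rightarrow> real" +
  fixes x :: "nat \<Rightarrow> 'v" and B :: real and U :: "nat filter"
  assumes bound: "p (x k) \<le> B" and ultra: "ultra U"
begin

text \<open>The spreading model of the sequence along the ultrafilter: the norm of
  \<open>y + c\<^sub>0 *\<^sub>R x k\<^sub>0 + c\<^sub>1 *\<^sub>R x k\<^sub>1\<close> and so on
  as first the last index, then the one before it, and finally the first one tends to infinity.\<close>

primrec nl :: "real list \<Rightarrow> 'v \<Rightarrow> real" where
  "nl [] y = p y"
| "nl (c # cs) y = Lim U (\<lambda>k. nl cs (y + c *\<^sub>R x k))"

lemma B_nonneg: "0 \<le> B"
  using bound[of 0] nonneg[of "x 0"] by linarith

lemma U_neq_bot: "U \<noteq> bot"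
  using ultra by (rule ultra_neq_bot)

lemma shift_le: "p (y + c *\<^sub>R x k) \<le> p y + B * \<bar>c\<bar>"
proof -
  have "p (y + c *\<^sub>R x k) \<le> p y + \<bar>c\<bar> * p (x k)" using add_le[of y "c *\<^sub>R x k"] by (simp add: scale)
  also have "\<bar>c\<bar> * p (x k) \<le> \<bar>c\<bar> * B" using bound by (simp add: mult_left_mono)
  finally show ?thesis by (simp add: mult.commute)
qed

lemma nl_bounds: "0 \<le> nl cs y \<and> nl cs y \<le> p y + B * sum_list (map abs cs)"
proof (induction cs arbitrary: y)
  case Nil
  then show ?case by simp
next
  case (Cons c cs)
  have b: "0 \<le> nl cs (y + c *\<^sub>R x k)" "nl cs (y + c *\<^sub>R x k) \<le> p y + B * sum_list (map abs (c # cs))" for k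
    using Cons[of "y + c *\<^sub>R x k"] shift_le[of y c k] by (auto simp: algebra_simps)
  have lim: "((\<lambda>k. nl cs (y + c *\<^sub>R x k)) \<longlongrightarrow> nl (c # cs) y) U"
    unfolding nl.simps
    by (rule ultra_tendsto_bounded[OF ultra, where B = "p y + B * sum_list (map abs (c # cs))"],
        rule always_eventually, rule allI) (metis abs_of_nonneg b)
  show ?case
    using tendsto_lowerbound[OF lim _ U_neq_bot, of 0] tendsto_upperbound[OF lim _ U_neq_bot] b
    by (auto simp del: nl.simps)
qed

lemma nl_tendsto: "((\<lambda>k. nl cs (y + c *\<^sub>R x k)) \<longlongrightarrow> nl (c # cs) y) U"
  unfolding nl.simps
proof (rule ultra_tendsto_bounded[OF ultra, where B = "p y + B * \<bar>c\<bar> + B * sum_list (map abs cs)"])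
  show "\<forall>\<^sub>F k in U. \<bar>nl cs (y + c *\<^sub>R x k)\<bar> \<le> p y + B * \<bar>c\<bar> + B * sum_list (map abs cs)"
    using nl_bounds[of cs] shift_le[of y c] by (intro always_eventually allI) (smt (verit))
qed

lemma nl_nonneg: "0 \<le> nl cs y" and nl_le: "nl cs y \<le> p y + B * sum_list (map abs cs)"
  using nl_bounds by auto

text \<open>A zero coefficient makes the limit over its index constant. So zeros may be inserted
  freely, which is how two combinations are written on common positions before they are added or
  subtracted.\<close>

lemma nl_filter: "nl (filter (\<lambda>c. c \<noteq> 0) cs) y = nl cs y"
proof (induction cs arbitrary: y)
  case (Cons c cs)
  have "Lim U (\<lambda>k. nl cs y) = nl cs y" by (rule tendsto_Lim[OF U_neq_bot tendsto_const])
  with Cons show ?case by (cases "c = 0") auto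
qed simp

lemma nl_add_le: "nl (map (\<lambda>t. fst t + snd t) ts) (y + z) \<le> nl (map fst ts) y + nl (map snd ts) z"
proof (induction ts arbitrary: y z)
  case Nil
  then show ?case by (simp add: add_le)
next
  case (Cons t ts)
  show ?case unfolding list.map
  proof (rule tendsto_le[OF U_neq_bot tendsto_add[OF nl_tendsto nl_tendsto] nl_tendsto])
    show "\<forall>\<^sub>F k in U. nl (map (\<lambda>t. fst t + snd t) ts) (y + z + (fst t + snd t) *\<^sub>R x k)
       \<le> nl (map fst ts) (y + fst t *\<^sub>R x k) + nl (map snd ts) (z + snd t *\<^sub>R x k)"
      using Cons[of "y + fst t *\<^sub>R x k" "z + snd t *\<^sub>R x k" for k]
      by (auto simp: algebra_simps)
  qed
qed

lemma nl_scale: "nl (map ((*) s) cs) (s *\<^sub>R y) = \<bar>s\<bar> * nl cs y"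
proof (induction cs arbitrary: y)
  case Nil
  then show ?case by (simp add: scale)
next
  case (Cons c cs)
  have "nl (map ((*) s) cs) (s *\<^sub>R y + (s * c) *\<^sub>R x k) = \<bar>s\<bar> * nl cs (y + c *\<^sub>R x k)" for k
    using Cons[of "y + c *\<^sub>R x k"] by (simp add: scaleR_add_right)
  then have "((\<lambda>k. nl (map ((*) s) cs) (s *\<^sub>R y + (s * c) *\<^sub>R x k)) \<longlongrightarrow> \<bar>s\<bar> * nl (c # cs) y) U"
    using tendsto_mult[OF tendsto_const[of "\<bar>s\<bar>"] nl_tendsto[of cs y c]] by simp
  then show ?case using tendsto_unique[OF U_neq_bot nl_tendsto[of "map ((*) s) cs" "s *\<^sub>R y" "s * c"]] by simp
qed

text \<open>The pairs keep both combinations on the same indices, so nonsquareness of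
  \<open>p\<close> at each choice of indices passes through every limit.\<close>

lemma nl_nonsquare:
  assumes V: "subspace V" and ns: "nonsquare_on V \<kappa> p" and x: "\<And>k. x k \<in> V"
  shows "y \<in> V \<Longrightarrow> z \<in> V \<Longrightarrow>
    min (nl (map (\<lambda>t. fst t + snd t) ts) (y + z)) (nl (map (\<lambda>t. fst t - snd t) ts) (y - z))
     \<le> nl (map fst ts) y + nl (map snd ts) z - \<kappa> * min (nl (map fst ts) y) (nl (map snd ts) z)"
proof (induction ts arbitrary: y z)
  case Nil
  then show ?case using ns by (simp add: nonsquare_on_def)
next
  case (Cons t ts)
  have e: "y + fst t *\<^sub>R x k \<in> V" "z + snd t *\<^sub>R x k \<in> V" for k
    using Cons.prems V x by (auto intro: subspace_add subspace_scale)
  show ?case unfolding list.map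
  proof (rule tendsto_le[OF U_neq_bot
        tendsto_diff[OF tendsto_add[OF nl_tendsto nl_tendsto] tendsto_mult[OF tendsto_const tendsto_min[OF nl_tendsto nl_tendsto]]]
        tendsto_min[OF nl_tendsto nl_tendsto]])
    show "\<forall>\<^sub>F k in U. min (nl (map (\<lambda>t. fst t + snd t) ts) (y + z + (fst t + snd t) *\<^sub>R x k))
            (nl (map (\<lambda>t. fst t - snd t) ts) (y - z + (fst t - snd t) *\<^sub>R x k))
       \<le> nl (map fst ts) (y + fst t *\<^sub>R x k) + nl (map snd ts) (z + snd t *\<^sub>R x k)
          - \<kappa> * min (nl (map fst ts) (y + fst t *\<^sub>R x k)) (nl (map snd ts) (z + snd t *\<^sub>R x k))"
      using Cons.IH[OF e] by (intro always_eventually allI) (simp add: algebra_simps)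
  qed
qed

text \<open>With room for three copies of \<open>b\<close>, the right-hand list is written twice:
  its two blocks occupy the first and second copy, or the second and third. Both versions have the
  same value, and in their average the middle block cancels while the outer ones are halved.\<close>

lemma nl_remove_step:
  "nl (a @ map ((*) (s / 2)) b @ map ((*) (- s / 2)) b @ c) 0 \<le> nl (a @ map ((*) s) b @ map ((*) (- s)) b @ c) 0"
proof -
  define ts where "ts = map (\<lambda>x. (x, x)) a @ map (\<lambda>x. (s * x, 0)) b @ map (\<lambda>x. (- s * x, s * x)) b
     @ map (\<lambda>x. (0, - s * x)) b @ map (\<lambda>x. (x, x)) c"
  have f: "filter P (map (\<lambda>x. 0::real) b) = (if P 0 then map (\<lambda>x. 0) b else [])" for P
    by (induction b) auto
  have m: "(*) (- s) = (\<lambda>x. - (s * x))" "(*) (s / 2) = (\<lambda>x. s * x / 2)" "(*) (- (s / 2)) = (\<lambda>x. - (s * x / 2))" by auto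
  let ?R = "nl (a @ map ((*) s) b @ map ((*) (- s)) b @ c) 0"
  have eq: "nl (map fst ts) 0 = ?R" "nl (map snd ts) 0 = ?R"
    by (subst (1 2) nl_filter[symmetric], simp add: ts_def comp_def f m)+
  have "nl (map (\<lambda>t. fst t + snd t) ts) (0 + 0) \<le> 2 * ?R"
    using nl_add_le[of ts 0 0] eq by simp
  moreover have "nl (map ((*) (1/2)) (map (\<lambda>t. fst t + snd t) ts)) ((1/2) *\<^sub>R 0) = (1/2) * nl (map (\<lambda>t. fst t + snd t) ts) (0 + 0)"
    using nl_scale[of "1/2" "map (\<lambda>t. fst t + snd t) ts" 0] by simp
  moreover have "nl (map ((*) (1/2)) (map (\<lambda>t. fst t + snd t) ts)) ((1/2) *\<^sub>R 0)
     = nl (a @ map ((*) (s / 2)) b @ map ((*) (- s / 2)) b @ c) 0"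
    by (subst (1 2) nl_filter[symmetric], simp add: ts_def comp_def f m)
  ultimately show ?thesis by simp
qed

lemma nl_remove_aux:
  "nl (a @ c) 0 \<le> nl (a @ map ((*) s) b @ map ((*) (- s)) b @ c) 0 + 2 * \<bar>s\<bar> * B * sum_list (map abs b)"
proof -
  define ts where "ts = map (\<lambda>x. (x, 0)) a @ map (\<lambda>x. (s * x, - s * x)) b @ map (\<lambda>x. (- s * x, s * x)) b
     @ map (\<lambda>x. (x, 0)) c"
  have f: "filter P (map (\<lambda>x. 0::real) d) = (if P 0 then map (\<lambda>x. 0) d else [])" for P and d :: "real list"
    by (induction d) auto
  have m: "(*) (- s) = (\<lambda>x. - (s * x))" by auto
  have "nl (map (\<lambda>t. fst t + snd t) ts) (0 + 0) = nl (a @ c) 0"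
    by (subst (1 2) nl_filter[symmetric], simp add: ts_def comp_def f m)
  moreover have "nl (map fst ts) 0 = nl (a @ map ((*) s) b @ map ((*) (- s)) b @ c) 0"
    by (subst (1 2) nl_filter[symmetric], simp add: ts_def comp_def f m)
  moreover have "sum_list (map abs (map snd ts)) = 2 * \<bar>s\<bar> * sum_list (map abs b)"
    by (simp add: ts_def comp_def abs_mult sum_list_const_mult)
  then have "nl (map snd ts) 0 \<le> 2 * \<bar>s\<bar> * B * sum_list (map abs b)"
    using nl_le[of "map snd ts" 0] by (simp add: mult_ac)
  ultimately show ?thesis using nl_add_le[of ts 0 0] by simp
qed

text \<open>Repeated halving does not increase the value and drives to zero the cost of deleting
  both blocks, which is proportional to the coefficient.\<close>

lemma nl_remove: "nl (a @ c) 0 \<le> nl (a @ map ((*) s) b @ map ((*) (- s)) b @ c) 0"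
proof -
  let ?R = "nl (a @ map ((*) s) b @ map ((*) (- s)) b @ c) 0"
  have le: "nl (a @ map ((*) (s / 2 ^ k)) b @ map ((*) (- (s / 2 ^ k))) b @ c) 0 \<le> ?R" for k
  proof (induction k)
    case (Suc k)
    have e: "s / 2 ^ k / 2 = s / 2 ^ Suc k" "- (s / 2 ^ k) / 2 = - (s / 2 ^ Suc k)" by simp_all
    show ?case using order_trans[OF nl_remove_step[of a "s / 2 ^ k" b c] Suc] unfolding e .
  qed simp
  have "nl (a @ c) 0 \<le> ?R + 2 * \<bar>s / 2 ^ k\<bar> * B * sum_list (map abs b)" for k
    using nl_remove_aux[of a c "s / 2 ^ k" b] le[of k] by linarith
  moreover have "(\<lambda>k. ?R + 2 * \<bar>s / 2 ^ k\<bar> * B * sum_list (map abs b)) \<longlonglongrightarrow> ?R + 2 * \<bar>0\<bar> * B * sum_list (map abs b)"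
    by (intro tendsto_intros LIMSEQ_divide_realpow_zero) auto
  ultimately show ?thesis
    using LIMSEQ_le_const[where a = "nl (a @ c) 0"] by fastforce
qed

end

text \<open>James' argument is run on blocks of coefficients: a list of coefficient lists stands for
  successive convex blocks of the sequence, and \<open>halfalt a as\<close> is the combination
  \<open>1/2 a - a\<^sub>1 + a\<^sub>2 - \<dots>\<close> of blocks, ending with a coefficient of modulus \<open>1/2\<close>.
  The lists of pairs \<open>altpr\<close> place each block twice in a row, once in either component, so that
  the sum of the two components is again alternating with doubled blocks while in the difference,
  up to its two outer blocks, neighbouring blocks of equal sign merge. Nonsquareness then makes
  the infimum of \<open>nl\<close> over these combinations grow geometrically in the number of
  blocks, although it grows at most linearly by the triangle inequality.\<close>

definition cvx_list :: "real list \<Rightarrow> bool" where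
  "cvx_list a \<longleftrightarrow> (\<forall>c\<in>set a. 0 \<le> c) \<and> sum_list a = 1"

fun altsum :: "real \<Rightarrow> real list list \<Rightarrow> real list" where
  "altsum s [] = []"
| "altsum s [a] = map ((*) (s / 2)) a"
| "altsum s (a # b # as) = map ((*) s) a @ altsum (- s) (b # as)"

definition halfalt :: "real list \<Rightarrow> real list list \<Rightarrow> real list" where
  "halfalt a as = map ((*) (1 / 2)) a @ altsum (- 1) as"

definition pr :: "real \<Rightarrow> real list \<Rightarrow> (real \<times> real) list" where
  "pr c a = map (\<lambda>x. (c * x, 0)) a @ map (\<lambda>x. (0, c * x)) a"

fun altpr :: "real \<Rightarrow> real list list \<Rightarrow> (real \<times> real) list" where
  "altpr s [] = []"
| "altpr s [a] = pr (s / 2) a"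
| "altpr s (a # b # as) = pr s a @ altpr (- s) (b # as)"

definition pm :: "real \<Rightarrow> real list \<Rightarrow> real list" where
  "pm c a = map ((*) c) a @ map ((*) (- c)) a"

fun altpm :: "real \<Rightarrow> real list list \<Rightarrow> real list" where
  "altpm s [] = []"
| "altpm s [a] = pm (s / 2) a"
| "altpm s (a # b # as) = pm s a @ altpm (- s) (b # as)"

primrec allpm :: "real \<Rightarrow> real list list \<Rightarrow> real list" where
  "allpm s [] = []"
| "allpm s (a # as) = pm s a @ allpm (- s) as"

definition dbl :: "real list \<Rightarrow> real list" where
  "dbl a = map ((*) (1 / 2)) (a @ a)"

primrec merge :: "real list \<Rightarrow> real list list \<Rightarrow> real list list" where
  "merge a [] = [a]"
| "merge a (b # bs) = map ((*) (1 / 2)) (a @ b) # merge b bs"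

lemma cvx_list_half: "cvx_list a \<Longrightarrow> cvx_list b \<Longrightarrow> cvx_list (map ((*) (1 / 2)) (a @ b))"
  by (auto simp: cvx_list_def sum_list_const_mult)

lemma cvx_list_dbl: "cvx_list a \<Longrightarrow> cvx_list (dbl a)"
  unfolding dbl_def by (rule cvx_list_half)

lemma cvx_list_merge: "cvx_list a \<Longrightarrow> list_all cvx_list as \<Longrightarrow> list_all cvx_list (merge a as)"
  by (induction as arbitrary: a) (auto simp: cvx_list_half simp del: map_append)

lemma length_merge: "length (merge a as) = Suc (length as)"
  by (induction as arbitrary: a) auto

lemma merge_neq_Nil: "merge a as \<noteq> []"
  by (cases as) auto

lemma filter_zeros: "filter (\<lambda>c. c \<noteq> 0) (map (\<lambda>x. 0::real) a) = []"
  by (induction a) auto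

lemma filter_fst_pr: "filter (\<lambda>c. c \<noteq> 0) (map fst (pr c a)) = filter (\<lambda>c. c \<noteq> 0) (map ((*) c) a)"
  and filter_snd_pr: "filter (\<lambda>c. c \<noteq> 0) (map snd (pr c a)) = filter (\<lambda>c. c \<noteq> 0) (map ((*) c) a)"
  by (simp_all add: pr_def comp_def filter_zeros)

lemma filter_fst_altpr: "filter (\<lambda>c. c \<noteq> 0) (map fst (altpr s as)) = filter (\<lambda>c. c \<noteq> 0) (altsum s as)"
  by (induction s as rule: altpr.induct) (simp_all add: filter_fst_pr)

lemma filter_snd_altpr: "filter (\<lambda>c. c \<noteq> 0) (map snd (altpr s as)) = filter (\<lambda>c. c \<noteq> 0) (altsum s as)"
  by (induction s as rule: altpr.induct) (simp_all add: filter_snd_pr)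

lemma add_pr: "map (\<lambda>t. fst t + snd t) (pr c a) = map ((*) 2) (map ((*) c) (dbl a))"
  by (simp add: pr_def dbl_def comp_def)

lemma add_altpr: "map (\<lambda>t. fst t + snd t) (altpr s as) = map ((*) 2) (altsum s (map dbl as))"
  by (induction s as rule: altpr.induct) (simp_all add: add_pr)

lemma diff_pr: "map (\<lambda>t. fst t - snd t) (pr c a) = pm c a"
  by (simp add: pr_def pm_def comp_def)

lemma diff_altpr: "map (\<lambda>t. fst t - snd t) (altpr s as) = altpm s as"
  by (induction s as rule: altpr.induct) (simp_all add: diff_pr)

lemma altsum_scale: "map ((*) c) (altsum s as) = altsum (c * s) as"
  by (induction s as rule: altsum.induct) (simp_all add: comp_def mult.assoc)

text \<open>In \<open>allpm\<close> the second half of a block and the first half of the next have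
  equal sign, so they merge into one block with doubled coefficient. The first half of the first
  block and the second half of the last stay single; the latter is the halved end coefficient that
  \<open>altsum\<close> prescribes.\<close>

lemma allpm_eq_altsum: "allpm s (a # as) = map ((*) s) a @ altsum (- 2 * s) (merge a as)"
proof (induction as arbitrary: s a)
  case Nil
  then show ?case by (simp add: pm_def)
next
  case (Cons b bs)
  obtain c cs where m: "merge b bs = c # cs" using merge_neq_Nil[of b bs] by (cases "merge b bs") auto
  show ?case using Cons[of "- s" b] by (simp add: m pm_def comp_def)
qed

lemma allpm_halfalt: "allpm (- 1) (a # as) = map ((*) (- 2)) (halfalt a (merge a as))"
  unfolding allpm_eq_altsum by (simp add: halfalt_def altsum_scale comp_def)

lemma sum_abs_altsum:
  "list_all cvx_list as \<Longrightarrow> sum_list (map abs (altsum s as)) \<le> \<bar>s\<bar> * length as"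
proof (induction s as rule: altsum.induct)
  case (2 s a)
  have "map abs (map ((*) (s / 2)) a) = map ((*) (\<bar>s\<bar> / 2)) a"
    using 2 by (auto simp: cvx_list_def abs_mult)
  then show ?case using 2 by (simp add: sum_list_const_mult cvx_list_def del: map_map)
next
  case (3 s a b as)
  have "map abs (map ((*) s) a) = map ((*) \<bar>s\<bar>) a"
    using 3 by (auto simp: cvx_list_def abs_mult)
  then show ?case using 3 by (simp add: sum_list_const_mult cvx_list_def algebra_simps del: map_map)
qed simp

context spreading
begin

lemma nl_cong_filter:
  "filter (\<lambda>c. c \<noteq> 0) cs = filter (\<lambda>c. c \<noteq> 0) ds \<Longrightarrow> nl cs y = nl ds y"
  by (metis nl_filter)

text \<open>The last block of \<open>altpm\<close> occurs as a cancelling pair with halved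
  coefficient, which does not fit the pattern of \<open>allpm\<close>; \<open>nl_remove\<close>
  drops it.\<close>

lemma nl_altpm_ge:
  "as \<noteq> [] \<Longrightarrow> nl (d @ allpm s (butlast as)) 0 \<le> nl (d @ altpm s as) 0"
proof (induction s as arbitrary: d rule: altpm.induct)
  case (2 s a)
  show ?case using nl_remove[of d "[]" "s / 2" a] by (simp add: pm_def)
next
  case (3 s a b as)
  show ?case using 3(1)[of "d @ pm s a"] by simp
qed simp

definition alt_ge :: "nat \<Rightarrow> real \<Rightarrow> bool" where
  "alt_ge n \<gamma> \<longleftrightarrow> (\<forall>a as. length as = n \<and> cvx_list a \<and> list_all cvx_list as \<longrightarrow> \<gamma> \<le> nl (halfalt a as) 0)"

text \<open>Both components of the pair list have the value \<open>?g\<close> of the original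
  combination. In the difference the first and the last block are dropped, and the remaining
  \<open>n + 1\<close> blocks form twice an alternating combination covered by \<open>L\<close>. The
  sum is twice an alternating combination of doubled blocks. Nonsquareness turns the bound
  \<open>2 * \<gamma>\<close> for both into
  \<open>2 * \<gamma> \<le> (2 - \<kappa>) * ?g\<close>.\<close>

lemma alt_ge_Suc:
  assumes V: "subspace V" and ns: "nonsquare_on V \<kappa> p" and x: "\<And>k. x k \<in> V"
    and L: "alt_ge (Suc n) \<gamma>" and \<gamma>: "0 \<le> \<gamma>"
  shows "alt_ge (Suc (Suc n)) (2 / (2 - \<kappa>) * \<gamma>)"
proof -
  have k: "0 < \<kappa>" "\<kappa> \<le> 1" using ns by (auto simp: nonsquare_on_def)
  let ?t = "\<lambda>a as. pr (1 / 2) a @ altpr (- 1) as"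
  have fs: "nl (map fst (?t a as)) 0 = nl (halfalt a as) 0" "nl (map snd (?t a as)) 0 = nl (halfalt a as) 0" for a as
    by (rule nl_cong_filter, simp add: filter_fst_pr filter_fst_altpr filter_snd_pr filter_snd_altpr halfalt_def
        del: filter.simps)+
  have sub: "nl (map (\<lambda>t. fst t - snd t) (?t a as)) 0 \<ge> 2 * \<gamma>"
    if "length as = Suc (Suc n)" "cvx_list a" "list_all cvx_list as" for a as
  proof -
    have "length (butlast as) = Suc n" using that(1) by simp
    then obtain b bs where b: "butlast as = b # bs" "length bs = n" unfolding length_Suc_conv by blast
    have "set (butlast as) \<subseteq> set as" by (auto dest: in_set_butlastD)
    then have cb: "cvx_list b" "list_all cvx_list bs" using that(3) b by (auto simp: list_all_iff)
    have "nl (map (\<lambda>t. fst t - snd t) (?t a as)) 0 = nl (pm (1/2) a @ altpm (- 1) as) 0"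
      by (simp add: diff_pr diff_altpr)
    also have "\<dots> \<ge> nl (pm (1/2) a @ allpm (- 1) (b # bs)) 0"
    proof -
      have "as \<noteq> []" using that(1) by auto
      from nl_altpm_ge[OF this, of "pm (1/2) a" "-1"] show ?thesis by (simp only: b)
    qed
    also have "nl (pm (1/2) a @ allpm (- 1) (b # bs)) 0 \<ge> nl (allpm (- 1) (b # bs)) 0"
      using nl_remove[of "[]" "allpm (- 1) (b # bs)" "1/2" a] by (simp add: pm_def)
    also have "nl (allpm (- 1) (b # bs)) 0 = 2 * nl (halfalt b (merge b bs)) 0"
      unfolding allpm_halfalt using nl_scale[of "-2" "halfalt b (merge b bs)" 0] by simp
    also have "\<dots> \<ge> 2 * \<gamma>"
      using L cb b cvx_list_merge[OF cb] by (simp add: alt_ge_def length_merge)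
    finally show ?thesis .
  qed
  \<comment> \<open>The sum keeps \<open>n + 2\<close> blocks, to which \<open>L\<close> does not
    apply; the plain triangle inequality first transfers the bound \<open>\<gamma>\<close> without
    gain.\<close>
  have L2: "alt_ge (Suc (Suc n)) \<gamma>" unfolding alt_ge_def
  proof (intro allI impI, elim conjE)
    fix a as assume *: "length as = Suc (Suc n)" "cvx_list a" "list_all cvx_list as"
    have "nl (map (\<lambda>t. fst t - snd t) (?t a as)) (0 - 0) \<le> nl (map fst (?t a as)) 0 + nl (map snd (?t a as)) 0"
    proof -
      let ?s = "map (\<lambda>t. (fst t, - snd t)) (?t a as)"
      have "nl (map ((*) (-1)) (map snd (?t a as))) ((-1) *\<^sub>R 0) = nl (map snd (?t a as)) 0"
        using nl_scale[of "-1" "map snd (?t a as)" 0] by simp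
      then show ?thesis using nl_add_le[of ?s 0 0] by (simp add: comp_def)
    qed
    then show "\<gamma> \<le> nl (halfalt a as) 0" using sub[OF *] fs by simp
  qed
  show ?thesis unfolding alt_ge_def
  proof (intro allI impI, elim conjE)
    fix a as assume *: "length as = Suc (Suc n)" "cvx_list a" "list_all cvx_list as"
    let ?g = "nl (halfalt a as) 0"
    have "nl (map (\<lambda>t. fst t + snd t) (?t a as)) 0 = 2 * nl (halfalt (dbl a) (map dbl as)) 0"
      using nl_scale[of 2 "halfalt (dbl a) (map dbl as)" 0] by (simp add: add_pr add_altpr halfalt_def)
    moreover have "\<gamma> \<le> nl (halfalt (dbl a) (map dbl as)) 0"
      using L2 * by (auto simp: alt_ge_def cvx_list_dbl list_all_iff)
    ultimately have "2 * \<gamma> \<le> min (nl (map (\<lambda>t. fst t + snd t) (?t a as)) (0 + 0)) (nl (map (\<lambda>t. fst t - snd t) (?t a as)) (0 - 0))"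
      using sub[OF *] by simp
    also have "\<dots> \<le> ?g + ?g - \<kappa> * min ?g ?g"
      using nl_nonsquare[OF V ns x, of 0 0 "?t a as"] subspace_0[OF V] fs by simp
    finally have "2 * \<gamma> \<le> (2 - \<kappa>) * ?g" by (simp add: algebra_simps)
    then show "2 / (2 - \<kappa>) * \<gamma> \<le> ?g" using k by (simp add: field_simps)
  qed
qed

lemma alt_ge_bounded:
  assumes V: "subspace V" and ns: "nonsquare_on V \<kappa> p" and x: "\<And>k. x k \<in> V"
    and L: "alt_ge 1 \<gamma>"
  shows "\<gamma> \<le> 0"
proof (rule ccontr)
  assume "\<not> \<gamma> \<le> 0"
  then have \<gamma>: "0 < \<gamma>" by simp
  define q where "q = 2 / (2 - \<kappa>)"
  have q: "1 < q" using ns by (simp add: nonsquare_on_def q_def)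
  have ge: "alt_ge (Suc n) (q ^ n * \<gamma>)" for n
  proof (induction n)
    case (Suc n)
    have "0 \<le> q ^ n * \<gamma>" using \<gamma> q by simp
    from alt_ge_Suc[OF V ns x Suc this] show ?case by (simp add: q_def mult_ac)
  qed (use L in simp)
  have up: "q ^ n * \<gamma> \<le> B * (real n + 2)" for n
  proof -
    have c: "list_all cvx_list (replicate (Suc n) [1])" "cvx_list [1]"
      by (auto simp: list_all_iff cvx_list_def)
    have "q ^ n * \<gamma> \<le> nl (halfalt [1] (replicate (Suc n) [1])) 0"
      using ge[of n] c unfolding alt_ge_def by (metis length_replicate)
    also have "\<dots> \<le> B * sum_list (map abs (halfalt [1] (replicate (Suc n) [1])))"
      using nl_le[of _ 0] by simp
    also have "\<dots> \<le> B * (real n + 2)"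
      using sum_abs_altsum[OF c(1), of "-1"] B_nonneg
      by (intro mult_left_mono) (auto simp: halfalt_def)
    finally show ?thesis .
  qed
  have "(\<lambda>n. B * (real n / q ^ n) + B * 2 * inverse (q ^ n)) \<longlonglongrightarrow> B * 0 + B * 2 * 0"
    using q by (intro tendsto_intros lim_n_over_pown LIMSEQ_inverse_realpow_zero) auto
  moreover have "\<gamma> \<le> B * (real n / q ^ n) + B * 2 * inverse (q ^ n)" for n
    using up[of n] q by (simp add: field_simps)
  ultimately have "\<gamma> \<le> 0" using LIMSEQ_le_const by fastforce
  with \<gamma> show False by simp
qed

text \<open>The bound \<open>m\<close> is general so that in the induction the remaining indices can
  be required to exceed the one just fixed.\<close>

lemma nl_ge:
  assumes "U \<le> sequentially"
  shows "(\<And>ks. length ks = length cs \<Longrightarrow> sorted_wrt (<) ks \<Longrightarrow> (\<forall>k\<in>set ks. m \<le> k) \<Longrightarrow>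
      \<gamma> \<le> p (y + sum_list (map2 (\<lambda>c k. c *\<^sub>R x k) cs ks))) \<Longrightarrow> \<gamma> \<le> nl cs y"
proof (induction cs arbitrary: y m)
  case Nil
  then show ?case using Nil[of "[]"] by simp
next
  case (Cons c cs)
  have ev: "\<forall>\<^sub>F k in U. m \<le> k" using assms eventually_ge_at_top by (rule filter_leD)
  have le: "\<gamma> \<le> nl cs (y + c *\<^sub>R x k)" if k: "m \<le> k" for k
  proof (rule Cons.IH[of "Suc k"])
    fix ks assume ks: "length ks = length cs" "sorted_wrt (<) ks" "\<forall>j\<in>set ks. Suc k \<le> j"
    then show "\<gamma> \<le> p (y + c *\<^sub>R x k + sum_list (map2 (\<lambda>c k. c *\<^sub>R x k) cs ks))"
      using Cons.prems[of "k # ks"] k by (force simp: add.assoc)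
  qed
  show ?case
    by (rule tendsto_lowerbound[OF nl_tendsto _ U_neq_bot]) (use ev le in \<open>auto elim: eventually_mono\<close>)
qed

lemma cvx_list_in_hull:
  assumes "cvx_list a" "length ks = length a"
  shows "sum_list (map2 (\<lambda>c k. c *\<^sub>R x k) a ks) \<in> convex hull (x ` set ks)"
proof -
  have "sum_list (map2 (\<lambda>c k. c *\<^sub>R x k) a ks) = (\<Sum>i<length a. a ! i *\<^sub>R x (ks ! i))"
    using assms by (simp add: sum_list_sum_nth atLeast0LessThan)
  also have "\<dots> \<in> convex hull (x ` set ks)"
  proof (rule convex_sum)
    show "(\<Sum>i<length a. a ! i) = 1"
      using assms by (simp add: cvx_list_def sum_list_sum_nth atLeast0LessThan)
  qed (use assms in \<open>auto simp: cvx_list_def intro: hull_inc\<close>)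
  finally show ?thesis .
qed

text \<open>If early and late hulls stayed \<open>\<delta>\<close> apart, half the difference of two
  successive convex blocks would have norm at least \<open>\<delta> / 2\<close>. This is
  \<open>alt_ge 1 (\<delta> / 2)\<close>, the start of the growth that \<open>alt_ge_bounded\<close>
  refutes.\<close>

lemma james:
  assumes V: "subspace V" and ns: "nonsquare_on V \<kappa> p" and x: "\<And>k. x k \<in> V"
    and U: "U \<le> sequentially" and \<delta>: "0 < \<delta>"
  shows "\<exists>k. \<exists>z\<in>convex hull (x ` {..<k}). \<exists>z'\<in>convex hull (x ` {k..}). p (z - z') < \<delta>"
proof (rule ccontr)
  assume "\<not> ?thesis"
  then have sep: "\<And>k z z'. z \<in> convex hull (x ` {..<k}) \<Longrightarrow> z' \<in> convex hull (x ` {k..}) \<Longrightarrow> \<delta> \<le> p (z - z')"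
    by force
  have "alt_ge 1 (\<delta> / 2)" unfolding alt_ge_def
  proof (intro allI impI, elim conjE)
    fix a as assume *: "length as = 1" "cvx_list a" "list_all cvx_list as"
    then obtain b where b: "as = [b]" "cvx_list b" by (auto simp: length_Suc_conv)
    have e: "halfalt a as = map ((*) (1/2)) a @ map ((*) (- (1/2))) b" by (simp add: b halfalt_def)
    show "\<delta> / 2 \<le> nl (halfalt a as) 0" unfolding e
    proof (rule nl_ge[OF U])
      fix ks assume ks: "length ks = length (map ((*) (1/2)) a @ map ((*) (- (1/2))) b)" "sorted_wrt (<) ks" "\<forall>k\<in>set ks. (0::nat) \<le> k"
      define k1 where "k1 = take (length a) ks"
      define k2 where "k2 = drop (length a) ks"
      have k12: "ks = k1 @ k2" "length k1 = length a" "length k2 = length b"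
        using ks by (auto simp: k1_def k2_def)
      \<comment> \<open>The weights of \<open>b\<close> have sum one, so the second index list has a
        first element, which serves as the split point.\<close>
      have "b \<noteq> []" using b by (auto simp: cvx_list_def)
      then obtain k k2' where k: "k2 = k # k2'" using k12 by (cases k2) auto
      let ?z = "sum_list (map2 (\<lambda>c k. c *\<^sub>R x k) a k1)"
      let ?z' = "sum_list (map2 (\<lambda>c k. c *\<^sub>R x k) b k2)"
      have "set k1 \<subseteq> {..<k}" "set k2 \<subseteq> {k..}" using ks(2) k unfolding k12(1)
        by (auto simp: sorted_wrt_append less_imp_le)
      then have "?z \<in> convex hull (x ` {..<k})" "?z' \<in> convex hull (x ` {k..})"
        using cvx_list_in_hull[of a k1] cvx_list_in_hull[of b k2] * b k12
        by (meson hull_mono image_mono subsetD)+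
      then have "\<delta> \<le> p (?z - ?z')" by (rule sep)
      moreover have "sum_list (map2 (\<lambda>c k. c *\<^sub>R x k) (map ((*) s) c) l) = s *\<^sub>R sum_list (map2 (\<lambda>c k. c *\<^sub>R x k) c l)"
        if "length c = length l" for c s l
        using that by (induction c l rule: list_induct2) (auto simp: scaleR_add_right)
      then have "sum_list (map2 (\<lambda>c k. c *\<^sub>R x k) (map ((*) (1/2)) a @ map ((*) (- (1/2))) b) ks) = (1/2) *\<^sub>R (?z - ?z')"
        using k12 by (simp add: scaleR_diff_right)
      ultimately show "\<delta> / 2 \<le> p (0 + sum_list (map2 (\<lambda>c k. c *\<^sub>R x k) (map ((*) (1/2)) a @ map ((*) (- (1/2))) b) ks))"
        by (simp add: scale)
    qed
  qed
  then show False using alt_ge_bounded[OF V ns x] \<delta> by fastforce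
qed

end

section \<open>Decreasing sequences of convex sets\<close>


text \<open>The weights sit on the index set, so \<open>b\<close> need not be injective.\<close>

lemma convex_hull_finite_image:
  assumes "finite I" "z \<in> convex hull (b ` I)"
  shows "\<exists>u. (\<forall>i\<in>I. 0 \<le> u i) \<and> sum u I = 1 \<and> z = (\<Sum>i\<in>I. u i *\<^sub>R b i)"
proof -
  let ?S = "{\<Sum>i\<in>I. u i *\<^sub>R b i |u. (\<forall>i\<in>I. (0::real) \<le> u i) \<and> sum u I = 1}"
  have "b ` I \<subseteq> ?S"
  proof (rule image_subsetI)
    fix i assume i: "i \<in> I"
    show "b i \<in> ?S" using assms(1) i
      by (intro CollectI exI[of _ "\<lambda>j. if j = i then 1 else 0"]) (auto simp: if_distrib[of "\<lambda>c. c *\<^sub>R _"] cong: if_cong)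
  qed
  moreover have "convex ?S"
  proof (rule convexI)
    fix x y and u v :: real
    assume xy: "x \<in> ?S" "y \<in> ?S" and uv: "0 \<le> u" "0 \<le> v" "u + v = 1"
    from xy obtain f g where f: "\<forall>i\<in>I. 0 \<le> f i" "sum f I = 1" "x = (\<Sum>i\<in>I. f i *\<^sub>R b i)"
      and g: "\<forall>i\<in>I. 0 \<le> g i" "sum g I = 1" "y = (\<Sum>i\<in>I. g i *\<^sub>R b i)" by blast
    show "u *\<^sub>R x + v *\<^sub>R y \<in> ?S"
      using f g uv
      by (intro CollectI exI[of _ "\<lambda>i. u * f i + v * g i"])
         (auto simp: sum.distrib scaleR_sum_right scaleR_add_left sum_distrib_left[symmetric])
  qed
  ultimately show ?thesis using assms(2) hull_minimal[of "b ` I" ?S convex] by blast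
qed

text \<open>Finite-dimensional compactness: one limit point serves all seminorms at once.\<close>

lemma convex_hull_ultralimit:
  fixes z :: "nat \<Rightarrow> 'v::real_vector"
  assumes U: "ultra U" and F: "finite F" and z: "\<And>k. z k \<in> convex hull F"
  shows "\<exists>y\<in>convex hull F. \<forall>p. seminorm p \<longrightarrow> ((\<lambda>k. p (y - z k)) \<longlongrightarrow> 0) U"
proof -
  have "\<forall>k. \<exists>u. (\<forall>i\<in>F. 0 \<le> u i) \<and> sum u F = 1 \<and> z k = (\<Sum>i\<in>F. u i *\<^sub>R i)"
    using convex_hull_finite_image[OF F, of _ "\<lambda>x. x"] z by simp
  then obtain u where u: "\<And>k i. i \<in> F \<Longrightarrow> 0 \<le> u k i" "\<And>k. sum (u k) F = (1::real)"
      "\<And>k. z k = (\<Sum>i\<in>F. u k i *\<^sub>R i)"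
    by metis
  have le1: "u k i \<le> 1" if "i \<in> F" for k i
    using member_le_sum[OF that, of "u k"] u F by auto
  define v where "v i = Lim U (\<lambda>k. u k i)" for i
  have lim: "((\<lambda>k. u k i) \<longlongrightarrow> v i) U" if "i \<in> F" for i unfolding v_def
    by (rule ultra_tendsto_bounded[OF U, where B = 1]) (use u(1) le1 that in \<open>auto intro!: always_eventually\<close>)
  have nb: "U \<noteq> bot" using U by (rule ultra_neq_bot)
  have v0: "0 \<le> v i" if "i \<in> F" for i
    using tendsto_lowerbound[OF lim[OF that] _ nb] u(1)[OF that] by auto
  have "((\<lambda>k. \<Sum>i\<in>F. u k i) \<longlongrightarrow> (\<Sum>i\<in>F. v i)) U" by (rule tendsto_sum) (rule lim)
  then have v1: "sum v F = 1" using tendsto_unique[OF nb _ tendsto_const[of 1]] u(2) by simp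
  let ?y = "\<Sum>i\<in>F. v i *\<^sub>R i"
  have "?y \<in> convex hull F"
    by (rule convex_sum) (use F v0 v1 in \<open>auto intro: hull_inc\<close>)
  moreover have "((\<lambda>k. p (?y - z k)) \<longlongrightarrow> 0) U" if "seminorm p" for p
  proof -
    interpret seminorm p by fact
    have "?y - z k = (\<Sum>i\<in>F. (v i - u k i) *\<^sub>R i)" for k
      by (simp add: u(3) scaleR_diff_left sum_subtractf)
    then have "p (?y - z k) \<le> (\<Sum>i\<in>F. \<bar>v i - u k i\<bar> * p i)" for k
      using sum_le[of "\<lambda>i. (v i - u k i) *\<^sub>R i" F] by (simp add: scale)
    then have le: "\<forall>\<^sub>F k in U. p (?y - z k) \<le> (\<Sum>i\<in>F. \<bar>v i - u k i\<bar> * p i)" by (rule always_eventually[OF allI])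
    have "((\<lambda>k. \<Sum>i\<in>F. \<bar>v i - u k i\<bar> * p i) \<longlongrightarrow> (\<Sum>i\<in>F. \<bar>v i - v i\<bar> * p i)) U"
      by (intro tendsto_sum tendsto_intros lim)
    then have "((\<lambda>k. \<Sum>i\<in>F. \<bar>v i - u k i\<bar> * p i) \<longlongrightarrow> 0) U" by simp
    from tendsto_sandwich[OF _ le tendsto_const this] show ?thesis by simp
  qed
  ultimately show ?thesis by blast
qed

lemma convex_on_sublevel:
  assumes "convex_on C f"
  shows "convex {c \<in> C. f c < (r::real)}"
proof (rule convexI)
  fix x y and u v :: real
  assume xy: "x \<in> {c \<in> C. f c < r}" "y \<in> {c \<in> C. f c < r}" and uv: "0 \<le> u" "0 \<le> v" "u + v = 1"
  have "f (u *\<^sub>R x + v *\<^sub>R y) \<le> u * f x + v * f y" "u *\<^sub>R x + v *\<^sub>R y \<in> C"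
    using assms xy uv by (auto simp: convex_on_def convex_def)
  moreover have "u * f x + v * f y < r" using xy uv by (intro convex_bound_lt) auto
  ultimately show "u *\<^sub>R x + v *\<^sub>R y \<in> {c \<in> C. f c < r}" by auto
qed

text \<open>A substitute for the nonempty intersection of decreasing weakly compact convex sets. If
  every point of \<open>C 0\<close> were far from some \<open>C k\<close>, points chosen one after
  another, each in a \<open>C k\<close> far from the hull of its predecessors, would contradict
  \<open>james\<close>.\<close>

lemma nested_convex_seminorm:
  assumes V: "subspace V" and p: "seminorm p" and ns: "nonsquare_on V \<kappa> p"
    and C: "\<And>k::nat. convex (C k)" "\<And>k. C k \<noteq> {}" "\<And>j k. j \<le> k \<Longrightarrow> C k \<subseteq> C j" "C 0 \<subseteq> V"
    and B: "\<And>c. c \<in> C 0 \<Longrightarrow> p c \<le> B" and \<delta>: "0 < \<delta>"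
  shows "\<exists>z\<in>C 0. \<forall>k. \<exists>c\<in>C k. p (z - c) < \<delta>"
proof (rule ccontr)
  assume "\<not> ?thesis"
  then have far: "\<And>z. z \<in> C 0 \<Longrightarrow> \<exists>k. \<forall>c\<in>C k. \<delta> \<le> p (z - c)" by force
  interpret seminorm p by fact
  obtain U where U: "ultra U" "U \<le> (sequentially :: nat filter)" using seq_ultra_exists by blast
  \<comment> \<open>Compactness of a finitely generated hull makes \<open>k\<close> uniform, at the
    price of half of \<open>\<delta>\<close>.\<close>
  have unif: "\<exists>k. \<forall>z\<in>convex hull F. \<forall>c\<in>C k. \<delta> / 2 \<le> p (z - c)" if F: "finite F" "F \<subseteq> C 0" for F
  proof (rule ccontr)
    assume "\<not> ?thesis"
    then have "\<forall>k. \<exists>z c. z \<in> convex hull F \<and> c \<in> C k \<and> p (z - c) < \<delta> / 2" by force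
    then obtain z c where zc: "\<And>k. z k \<in> convex hull F" "\<And>k. c k \<in> C k" "\<And>k. p (z k - c k) < \<delta> / 2"
      by metis
    from convex_hull_ultralimit[of U F z, OF U(1) F(1) zc(1)] p obtain y where y: "y \<in> convex hull F"
      "((\<lambda>k. p (y - z k)) \<longlongrightarrow> 0) U" by blast
    have "y \<in> C 0" using y(1) hull_minimal[of F "C 0" convex] F C(1) by blast
    then obtain K where K: "\<forall>c\<in>C K. \<delta> \<le> p (y - c)" using far by blast
    have "\<forall>\<^sub>F k in U. p (y - z k) < \<delta> / 2" using order_tendstoD(2)[OF y(2), of "\<delta> / 2"] \<delta> by simp
    moreover have "\<forall>\<^sub>F k in U. K \<le> k" using U(2) eventually_ge_at_top by (rule filter_leD)
    ultimately have "\<forall>\<^sub>F k in U. False"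
    proof eventually_elim
      case (elim k)
      then have "\<delta> \<le> p (y - c k)" using K zc(2)[of k] C(3)[of K k] by blast
      then show False using elim zc(3)[of k] triangle[of y "c k" "z k"] by linarith
    qed
    then show False using ultra_neq_bot[OF U(1)] by (simp add: eventually_False)
  qed
  define good where "good l k \<longleftrightarrow> (\<forall>z\<in>convex hull (set l). \<forall>c\<in>C k. \<delta> / 2 \<le> p (z - c))" for l k
  define K where "K l = (SOME k. good l k)" for l
  have K: "good l (K l)" if "set l \<subseteq> C 0" for l
    unfolding K_def by (rule someI_ex) (use unif[of "set l"] that in \<open>auto simp: good_def\<close>)
  \<comment> \<open>The maximum runs over all prefixes because a term must be far from the hull of
    every initial segment, and the chosen indices \<open>K\<close> need not increase with the
    list.\<close>
  define M where "M l = Max ((\<lambda>j. K (take j l)) ` {..length l})" for l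
  have MK: "K (take j l) \<le> M l" for j l
  proof (cases "j \<le> length l")
    case True
    then show ?thesis unfolding M_def by (intro Max_ge) auto
  next
    case False
    then have "take j l = take (length l) l" by simp
    then show ?thesis unfolding M_def by (metis Max_ge atMost_iff finite_atMost finite_imageI image_eqI order_refl)
  qed
  define s where "s = rec_nat [] (\<lambda>_ l. l @ [SOME c. c \<in> C (M l)])"
  have s0: "s 0 = []" and sS: "\<And>n. s (Suc n) = s n @ [SOME c. c \<in> C (M (s n))]" by (simp_all add: s_def)
  define x where "x n = (SOME c. c \<in> C (M (s n)))" for n
  have xC: "x n \<in> C (M (s n))" for n unfolding x_def using C(2) by (simp add: some_in_eq)
  have sx: "s n = map x [0..<n]" for n
    by (induction n) (simp_all add: s0 sS x_def)
  have x0: "x n \<in> C 0" for n using xC[of n] C(3)[of 0] by blast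
  interpret S: spreading p x B U
    by unfold_locales (use B x0 U in auto)
  have xV: "x n \<in> V" for n using x0 C(4) by blast
  have "0 < \<delta> / 2" using \<delta> by simp
  from S.james[OF V ns xV U(2) this] obtain k z z' where
    z: "z \<in> convex hull (x ` {..<k})" "z' \<in> convex hull (x ` {k..})" "p (z - z') < \<delta> / 2" by blast
  have "x ` {k..} \<subseteq> C (K (s k))"
  proof
    fix y assume "y \<in> x ` {k..}"
    then obtain n where n: "k \<le> n" "y = x n" by auto
    have "take k (s n) = s k" using n by (simp add: sx take_map)
    then show "y \<in> C (K (s k))" using xC[of n] MK[of k "s n"] C(3) n(2) by force
  qed
  then have "z' \<in> C (K (s k))" using z(2) hull_minimal[of "x ` {k..}" "C (K (s k))" convex] C(1) by blast
  moreover have "set (s k) = x ` {..<k}" by (auto simp: sx)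
  ultimately show False using K[of "s k"] z x0 by (force simp: good_def)
qed

text \<open>Induction over the seminorms: a point \<open>y\<close> good for the earlier ones cuts
  each \<open>C k\<close> down to the convex set \<open>D k\<close> of its points near
  \<open>y\<close>, and these stay decreasing and nonempty. A point of \<open>D 0\<close> good for
  the new seminorm is itself near \<open>y\<close>, hence good for all.\<close>

lemma nested_convex_seminorms:
  assumes I: "finite I" and V: "subspace V" and p: "\<And>l. l \<in> I \<Longrightarrow> seminorm (p l)"
    and ns: "\<And>l. l \<in> I \<Longrightarrow> nonsquare_on V \<kappa> (p l)"
    and B: "\<And>l c. l \<in> I \<Longrightarrow> c \<in> C 0 \<Longrightarrow> p l c \<le> B"
    and C: "\<And>k::nat. convex (C k)" "\<And>k. C k \<noteq> {}" "\<And>j k. j \<le> k \<Longrightarrow> C k \<subseteq> C j" "C 0 \<subseteq> V"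
  shows "0 < \<delta> \<Longrightarrow> \<exists>z\<in>C 0. \<forall>k. \<exists>c\<in>C k. \<forall>l\<in>I. p l (z - c) < \<delta>"
  using I p ns B
proof (induction I arbitrary: \<delta>)
  case empty
  show ?case using C(2) by (metis all_not_in_conv empty_iff)
next
  case (insert l I)
  have "\<exists>z\<in>C 0. \<forall>k. \<exists>c\<in>C k. \<forall>l\<in>I. p l (z - c) < \<delta> / 2"
  proof (rule insert.IH)
    show "seminorm (p j)" "nonsquare_on V \<kappa> (p j)" if "j \<in> I" for j
      using insert.prems(2,3) that by auto
    show "p j c \<le> B" if "j \<in> I" "c \<in> C 0" for j c using insert.prems(4) that by auto
    show "0 < \<delta> / 2" using insert.prems(1) by simp
  qed
  then obtain y where y: "y \<in> C 0" "\<And>k. \<exists>c\<in>C k. \<forall>l\<in>I. p l (y - c) < \<delta> / 2" by blast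
  define D where "D k = {c \<in> C k. \<forall>l\<in>I. p l (y - c) < \<delta> / 2}" for k
  have cD: "convex (D k)" for k
  proof -
    have "convex {c\<in>C k. p l (y - c) < \<delta> / 2}" if "l \<in> I" for l
      by (rule convex_on_sublevel) (use insert.prems(2) C(1) that in \<open>auto intro: seminorm.convex_on\<close>)
    then have "convex (C k \<inter> (\<Inter>l\<in>I. {c\<in>C k. p l (y - c) < \<delta> / 2}))"
      using C(1) by (intro convex_Int convex_INT) auto
    moreover have "D k = C k \<inter> (\<Inter>l\<in>I. {c\<in>C k. p l (y - c) < \<delta> / 2})" by (auto simp: D_def)
    ultimately show ?thesis by simp
  qed
  have "\<exists>z\<in>D 0. \<forall>k. \<exists>c\<in>D k. p l (z - c) < \<delta>"
  proof (rule nested_convex_seminorm[OF V, where B = B])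
    show "seminorm (p l)" "nonsquare_on V \<kappa> (p l)" using insert.prems(2,3) by auto
    show "D k \<noteq> {}" for k using y by (fastforce simp: D_def)
    show "D k \<subseteq> D j" if "j \<le> k" for j k using C(3)[OF that] by (auto simp: D_def)
    show "p l c \<le> B" if "c \<in> D 0" for c using insert.prems(4)[of l c] that by (auto simp: D_def)
    show "convex (D k)" for k by (rule cD)
    show "D 0 \<subseteq> V" using C(4) by (auto simp: D_def)
    show "0 < \<delta>" by (rule insert.prems(1))
  qed
  then obtain z where z: "z \<in> D 0" "\<And>k. \<exists>c\<in>D k. p l (z - c) < \<delta>" by blast
  show ?case
  proof (rule bexI[of _ z], rule allI)
    fix k
    obtain c where c: "c \<in> D k" "p l (z - c) < \<delta>" using z(2) by blast
    have "p j (z - c) < \<delta>" if j: "j \<in> I" for j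
    proof -
      interpret seminorm "p j" using insert.prems(2) j by simp
      have "p j (y - z) < \<delta> / 2" "p j (y - c) < \<delta> / 2" using z(1) c(1) j by (auto simp: D_def)
      then show ?thesis using triangle[of z c y] minus_commute[of y z] by linarith
    qed
    then show "\<exists>c\<in>C k. \<forall>l\<in>insert l I. p l (z - c) < \<delta>" using c by (auto simp: D_def)
  qed (use z(1) in \<open>simp add: D_def\<close>)
qed

section \<open>A finite form of James' argument\<close>

lemma lookup_scaleR_real: "Poly_Mapping.lookup (r *\<^sub>R c) i = r * Poly_Mapping.lookup c i"
  for c :: "('i, real) poly_mapping"
proof -
  have "finite {i. r *\<^sub>R Poly_Mapping.lookup c i \<noteq> 0}"
    by (rule finite_subset[OF _ finite_keys[of c]]) (auto simp: in_keys_iff)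
  then show ?thesis by (simp add: scaleR_poly_mapping_def lookup_Abs_poly_mapping)
qed

text \<open>The finite version follows from the infinite one by passing to an ultraproduct, realised
  as a family of seminorms on the free vector space over the indices.\<close>

lemma finite_james:
  fixes p :: "'n::finite \<Rightarrow> 'v::real_vector \<Rightarrow> real"
  assumes V: "subspace V" and p: "\<And>l. seminorm (p l)"
    and ns: "\<And>l. nonsquare_on V \<kappa> (p l)" and \<delta>: "0 < \<delta>" and B: "0 \<le> B"
  shows "\<exists>L. \<forall>b::nat \<Rightarrow> 'v. (\<forall>i<L. b i \<in> V \<and> (\<forall>l. p l (b i) \<le> B)) \<longrightarrow>
    (\<exists>k\<le>L. \<exists>z\<in>convex hull (b ` {..<k}). \<exists>z'\<in>convex hull (b ` {k..<L}). \<forall>l. p l (z - z') < \<delta>)"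
proof (rule ccontr)
  assume "\<not> ?thesis"
  then have "\<forall>L. \<exists>b::nat \<Rightarrow> 'v. (\<forall>i<L. b i \<in> V \<and> (\<forall>l. p l (b i) \<le> B)) \<and>
    \<not> (\<exists>k\<le>L. \<exists>z\<in>convex hull (b ` {..<k}). \<exists>z'\<in>convex hull (b ` {k..<L}). \<forall>l. p l (z - z') < \<delta>)"
    by blast
  from choice[OF this] obtain b :: "nat \<Rightarrow> nat \<Rightarrow> 'v" where bb:
    "\<forall>L. (\<forall>i<L. b L i \<in> V \<and> (\<forall>l. p l (b L i) \<le> B)) \<and>
    \<not> (\<exists>k\<le>L. \<exists>z\<in>convex hull (b L ` {..<k}). \<exists>z'\<in>convex hull (b L ` {k..<L}). \<forall>l. p l (z - z') < \<delta>)"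
    ..
  have b: "\<And>L i. i < L \<Longrightarrow> b L i \<in> V" "\<And>L i l. i < L \<Longrightarrow> p l (b L i) \<le> B"
    using bb by blast+
  have bad: "\<And>L k z z'. k \<le> L \<Longrightarrow> z \<in> convex hull (b L ` {..<k}) \<Longrightarrow> z' \<in> convex hull (b L ` {k..<L})
        \<Longrightarrow> \<not> (\<forall>l. p l (z - z') < \<delta>)"
    using bb by blast
  obtain U where U: "ultra U" "U \<le> (sequentially :: nat filter)" using seq_ultra_exists by blast
  have nb: "U \<noteq> bot" using U(1) by (rule ultra_neq_bot)
  \<comment> \<open>A formal combination is evaluated on the \<open>L\<close>-th counterexample.
    Terms of index at least \<open>L\<close>, where nothing is known about \<open>b L\<close>, are
    cut off; for a fixed combination this has no effect once \<open>L\<close> is large.\<close>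
  define ev where "ev L c = (\<Sum>i<L. Poly_Mapping.lookup c i *\<^sub>R b L i)" for L and c :: "(nat, real) poly_mapping"
  define P where "P l c = Lim U (\<lambda>L. p l (ev L c))" for l c
  define e where "e k = (Poly_Mapping.single k 1 :: (nat, real) poly_mapping)" for k
  have lin: "linear (ev L)" for L
    by (rule linearI)
       (simp_all add: ev_def lookup_add scaleR_add_left sum.distrib lookup_scaleR_real scaleR_sum_right)
  have evV: "ev L c \<in> V" for L c
    unfolding ev_def by (intro subspace_sum[OF V] subspace_scale[OF V]) (use b in auto)
  have ev_e: "ev L (e k) = b L k" if "k < L" for L k
    using that by (simp add: ev_def e_def lookup_single when_def if_distrib[of "\<lambda>c. c *\<^sub>R _"] cong: if_cong)
  have bnd: "p l (ev L c) \<le> (\<Sum>i\<in>Poly_Mapping.keys c. \<bar>Poly_Mapping.lookup c i\<bar> * B)" for l L c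
  proof -
    interpret seminorm "p l" by (rule p)
    have "p l (ev L c) \<le> (\<Sum>i<L. p l (Poly_Mapping.lookup c i *\<^sub>R b L i))"
      unfolding ev_def by (rule sum_le)
    also have "\<dots> \<le> (\<Sum>i<L. \<bar>Poly_Mapping.lookup c i\<bar> * B)"
      by (intro sum_mono) (use b in \<open>auto simp: scale intro: mult_left_mono\<close>)
    also have "\<dots> = (\<Sum>i\<in>{..<L} \<inter> Poly_Mapping.keys c. \<bar>Poly_Mapping.lookup c i\<bar> * B)"
      by (rule sum.mono_neutral_right) (auto simp: in_keys_iff)
    also have "\<dots> \<le> (\<Sum>i\<in>Poly_Mapping.keys c. \<bar>Poly_Mapping.lookup c i\<bar> * B)"
      by (rule sum_mono2) (use B in auto)
    finally show ?thesis .
  qed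
  have lim: "((\<lambda>L. p l (ev L c)) \<longlongrightarrow> P l c) U" for l c
  proof -
    interpret seminorm "p l" by (rule p)
    show ?thesis unfolding P_def
      by (rule ultra_tendsto_bounded[OF U(1)]) (rule always_eventually, use bnd in \<open>auto simp del: abs_le_iff\<close>)
  qed
  have sP: "seminorm (P l)" for l
  proof
    interpret seminorm "p l" by (rule p)
    fix x y :: "(nat, real) poly_mapping" and c :: real
    show "P l (x + y) \<le> P l x + P l y"
      by (rule tendsto_le[OF nb tendsto_add[OF lim lim] lim])
         (simp add: linear_add[OF lin] add_le)
    have "((\<lambda>L. p l (ev L (c *\<^sub>R x))) \<longlongrightarrow> \<bar>c\<bar> * P l x) U"
      using tendsto_mult[OF tendsto_const lim[of l x]] by (simp add: linear_scale[OF lin] scale)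
    then show "P l (c *\<^sub>R x) = \<bar>c\<bar> * P l x" by (rule tendsto_unique[OF nb lim])
  qed
  have nP: "nonsquare_on UNIV \<kappa> (P l)" for l
    unfolding nonsquare_on_def
  proof (intro conjI ballI)
    show "0 < \<kappa>" "\<kappa> \<le> 1" using ns[of l] by (auto simp: nonsquare_on_def)
    fix x y :: "(nat, real) poly_mapping"
    show "min (P l (x + y)) (P l (x - y)) \<le> P l x + P l y - \<kappa> * min (P l x) (P l y)"
      by (rule tendsto_le[OF nb tendsto_diff[OF tendsto_add[OF lim lim] tendsto_mult[OF tendsto_const tendsto_min[OF lim lim]]]
          tendsto_min[OF lim lim]], rule always_eventually)
         (use ns[of l] evV in \<open>simp add: nonsquare_on_def linear_add[OF lin] linear_diff[OF lin]\<close>)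
  qed
  define C where "C k = convex hull (e ` {k..})" for k
  have PB: "P l c \<le> B" if "c \<in> C 0" for l c
  proof -
    have eB: "P l (e k) \<le> B" for k
      by (rule tendsto_upperbound[OF lim _ nb])
         (use filter_leD[OF U(2) eventually_gt_at_top[of k]] in \<open>auto simp: ev_e b elim: eventually_mono\<close>)
    have cv: "convex {c \<in> UNIV. P l c < B + \<epsilon>}" for \<epsilon>
      using convex_on_sublevel[OF seminorm.convex_on[OF sP, of UNIV l 0]]
      by (simp add: seminorm.minus[OF sP])
    have "C 0 \<subseteq> {c. P l c < B + \<epsilon>}" if "0 < \<epsilon>" for \<epsilon>
      unfolding C_def
    proof (rule hull_minimal)
      have "P l (e k) < B + \<epsilon>" for k using eB[of k] that by linarith
      then show "e ` {0..} \<subseteq> {c. P l c < B + \<epsilon>}" by blast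
    qed (use cv in simp)
    then have "P l c < B + \<epsilon>" if "0 < \<epsilon>" for \<epsilon> using that \<open>c \<in> C 0\<close> by blast
    then show ?thesis by (meson field_le_epsilon less_imp_le)
  qed
  have "\<exists>z\<in>C 0. \<forall>k. \<exists>c\<in>C k. \<forall>l\<in>UNIV. P l (z - c) < \<delta>"
  proof (rule nested_convex_seminorms[where V = UNIV and B = B])
    show "C k \<subseteq> C j" if "j \<le> k" for j k unfolding C_def using that by (intro hull_mono) auto
  qed (use sP nP PB \<delta> in \<open>auto simp: C_def\<close>)
  then obtain z where z: "z \<in> C 0" "\<And>k. \<exists>c\<in>C k. \<forall>l\<in>UNIV. P l (z - c) < \<delta>" by blast
  \<comment> \<open>The hulls of tails involve infinitely many basis vectors, but a single point
    uses finitely many, so both points descend to one large \<open>L\<close>.\<close>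
  have fin: "\<exists>m. c \<in> convex hull (e ` {k..<m})" if "c \<in> C k" for c k
  proof -
    from that obtain S where S: "finite S" "S \<subseteq> e ` {k..}" "c \<in> convex hull S"
      unfolding C_def convex_hull_explicit[of "e ` {k..}"] by (auto simp: convex_hull_finite)
    then obtain J where J: "finite J" "J \<subseteq> {k..}" "S = e ` J" by (meson finite_subset_image)
    then have "J \<subseteq> {k..<Suc (Max (insert 0 J))}" by (auto simp: less_Suc_eq_le intro!: Max_ge)
    then show ?thesis using S J hull_mono by (metis image_mono subsetD)
  qed
  obtain k where k: "z \<in> convex hull (e ` {0..<k})" using fin[OF z(1)] by blast
  obtain c where c: "c \<in> C k" "\<And>l. P l (z - c) < \<delta>" using z(2) by blast
  obtain m where m: "c \<in> convex hull (e ` {k..<m})" using fin[OF c(1)] by blast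
  have "\<forall>\<^sub>F L in U. \<forall>l. p l (ev L (z - c)) < \<delta>"
    by (rule eventually_all_finite) (rule order_tendstoD(2)[OF lim c(2)])
  moreover have "\<forall>\<^sub>F L in U. max k m \<le> L" using U(2) eventually_ge_at_top by (rule filter_leD)
  ultimately have "\<forall>\<^sub>F L in U. (\<forall>l. p l (ev L (z - c)) < \<delta>) \<and> max k m \<le> L" by (rule eventually_conj)
  then obtain L where L: "\<And>l. p l (ev L z - ev L c) < \<delta>" "k \<le> L" "m \<le> L"
    using eventually_happens'[OF nb] by (force simp: linear_diff[OF lin])
  have "ev L z \<in> convex hull (ev L ` e ` {0..<k})"
    using k convex_hull_linear_image[OF lin, of L "e ` {0..<k}"] by blast
  also have "ev L ` e ` {0..<k} = b L ` {..<k}" using L(2) by (force simp: ev_e image_image)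
  finally have 1: "ev L z \<in> convex hull (b L ` {..<k})" .
  have "ev L c \<in> convex hull (ev L ` e ` {k..<m})"
    using m convex_hull_linear_image[OF lin, of L "e ` {k..<m}"] by blast
  also have "ev L ` e ` {k..<m} = b L ` {k..<m}" using L(3) by (force simp: ev_e image_image)
  also have "convex hull \<dots> \<subseteq> convex hull (b L ` {k..<L})" using L(3) by (intro hull_mono image_mono) auto
  finally show False using bad[OF L(2) 1] L(1) by blast
qed

text \<open>Applying \<open>finite_james\<close> to means of \<open>Q\<close> consecutive terms
  spreads every late weight over \<open>Q\<close> terms. Later this prevents a single orbit window
  from carrying much weight.\<close>

lemma finite_james_spread:
  fixes p :: "'n::finite \<Rightarrow> 'v::real_vector \<Rightarrow> real"
  assumes V: "subspace V" and p: "\<And>l. seminorm (p l)"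
    and ns: "\<And>l. nonsquare_on V \<kappa> (p l)" and \<delta>: "0 < \<delta>" and B: "0 \<le> B" and Q: "0 < (Q::nat)"
  shows "\<exists>L. \<forall>b::nat \<Rightarrow> 'v. (\<forall>i<L. b i \<in> V \<and> (\<forall>l. p l (b i) \<le> B)) \<longrightarrow>
    (\<exists>k\<le>L. \<exists>z\<in>convex hull (b ` {..<k}). \<exists>w. (\<forall>i. 0 \<le> w i \<and> w i \<le> 1 / real Q) \<and> (\<forall>i<k. w i = 0) \<and>
       sum w {..<L} = 1 \<and> (\<forall>l. p l (z - (\<Sum>i<L. w i *\<^sub>R b i)) < \<delta>))"
proof -
  from finite_james[OF V p ns \<delta> B] obtain L where L: "\<forall>b::nat \<Rightarrow> 'v. (\<forall>i<L. b i \<in> V \<and> (\<forall>l. p l (b i) \<le> B)) \<longrightarrow>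
    (\<exists>k\<le>L. \<exists>z\<in>convex hull (b ` {..<k}). \<exists>z'\<in>convex hull (b ` {k..<L}). \<forall>l. p l (z - z') < \<delta>)" ..
  show ?thesis
  proof (rule exI[of _ "L * Q"], intro allI impI)
    fix b :: "nat \<Rightarrow> 'v"
    assume b: "\<forall>i<L * Q. b i \<in> V \<and> (\<forall>l. p l (b i) \<le> B)"
    define a where "a g = (\<Sum>i\<in>{g*Q..<g*Q+Q}. (1 / real Q) *\<^sub>R b i)" for g
    have lt: "i < L * Q" if "g < L" "i < g * Q + Q" for g i
    proof -
      have "Suc g * Q \<le> L * Q" using that(1) by (intro mult_le_mono1) simp
      then show ?thesis using that(2) by simp
    qed
    have "a g \<in> V \<and> (\<forall>l. p l (a g) \<le> B)" if g: "g < L" for g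
    proof
      show "a g \<in> V" unfolding a_def
        by (intro subspace_sum[OF V] subspace_scale[OF V]) (use b lt[OF g] in auto)
      show "\<forall>l. p l (a g) \<le> B"
      proof
        fix l
        interpret seminorm "p l" by (rule p)
        have "p l (a g) \<le> (\<Sum>i\<in>{g*Q..<g*Q+Q}. p l ((1 / real Q) *\<^sub>R b i))" unfolding a_def by (rule sum_le)
        also have "\<dots> \<le> (\<Sum>i\<in>{g*Q..<g*Q+Q}. (1 / real Q) * B)"
          using b lt[OF g] Q by (intro sum_mono) (simp add: scale divide_right_mono)
        also have "\<dots> = B" using Q by simp
        finally show "p l (a g) \<le> B" .
      qed
    qed
    with L[rule_format, of a] obtain k z z' where k: "k \<le> L" "z \<in> convex hull (a ` {..<k})" "z' \<in> convex hull (a ` {k..<L})"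
      "\<And>l. p l (z - z') < \<delta>" by blast
    have hull: "a g \<in> convex hull (b ` {..<k * Q})" if g: "g < k" for g unfolding a_def
    proof (rule convex_sum)
      fix i assume "i \<in> {g*Q..<g*Q+Q}"
      moreover have "Suc g * Q \<le> k * Q" using g by (intro mult_le_mono1) simp
      ultimately show "b i \<in> convex hull (b ` {..<k * Q})" by (intro hull_inc) auto
    qed (use Q in auto)
    then have z: "z \<in> convex hull (b ` {..<k * Q})"
      using k(2) hull_minimal[of "a ` {..<k}" "convex hull (b ` {..<k * Q})" convex] by blast
    obtain u where u: "\<forall>i\<in>{k..<L}. 0 \<le> u i" "sum u {k..<L} = 1" "z' = (\<Sum>i\<in>{k..<L}. u i *\<^sub>R a i)"
      using convex_hull_finite_image[OF _ k(3)] by auto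
    have u1: "u i \<le> 1" if "i \<in> {k..<L}" for i
      using member_le_sum[OF that, of u] u by auto
    define u' where "u' g = (if g \<in> {k..<L} then u g else 0)" for g
    define w where "w i = u' (i div Q) / real Q" for i
    have w0: "0 \<le> w i \<and> w i \<le> 1 / real Q" for i
      using u(1) u1[of "i div Q"] Q by (auto simp: w_def u'_def divide_right_mono)
    have wk: "w i = 0" if "i < k * Q" for i
      using less_mult_imp_div_less[OF that] by (simp add: w_def u'_def)
    have s1: "sum u' {..<L} = 1"
    proof -
      have "sum u' {..<L} = sum u' {k..<L}" by (rule sum.mono_neutral_right) (auto simp: u'_def)
      also have "\<dots> = sum u {k..<L}" by (rule sum.cong) (auto simp: u'_def)
      finally show ?thesis using u(2) by simp
    qed
    have dv: "i div Q = g" if "i \<in> {g*Q..<g*Q+Q}" for i g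
      using that by (intro div_nat_eqI) (auto simp: mult.commute)
    have "sum w {..<L * Q} = (\<Sum>g<L. sum w {g*Q..<g*Q+Q})" by (rule sum.nat_group[symmetric])
    also have "\<dots> = (\<Sum>g<L. \<Sum>i\<in>{g*Q..<g*Q+Q}. u' g / real Q)"
      by (intro sum.cong refl) (simp add: w_def dv)
    also have "\<dots> = 1" using Q s1 by simp
    finally have w1: "sum w {..<L * Q} = 1" .
    have "(\<Sum>i<L * Q. w i *\<^sub>R b i) = (\<Sum>g<L. \<Sum>i\<in>{g*Q..<g*Q+Q}. w i *\<^sub>R b i)" by (rule sum.nat_group[symmetric])
    also have "\<dots> = (\<Sum>g<L. \<Sum>i\<in>{g*Q..<g*Q+Q}. (u' g / real Q) *\<^sub>R b i)"
      by (intro sum.cong refl) (simp add: w_def dv)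
    also have "\<dots> = (\<Sum>g<L. u' g *\<^sub>R a g)" by (simp add: a_def scaleR_sum_right)
    also have "\<dots> = (\<Sum>g\<in>{k..<L}. u' g *\<^sub>R a g)"
      by (rule sum.mono_neutral_right) (auto simp: u'_def)
    also have "\<dots> = z'" unfolding u(3) by (intro sum.cong refl) (simp add: u'_def)
    finally have wz: "(\<Sum>i<L * Q. w i *\<^sub>R b i) = z'" .
    show "\<exists>k\<le>L * Q. \<exists>z\<in>convex hull (b ` {..<k}). \<exists>w. (\<forall>i. 0 \<le> w i \<and> w i \<le> 1 / real Q) \<and> (\<forall>i<k. w i = 0) \<and>
       sum w {..<L * Q} = 1 \<and> (\<forall>l. p l (z - (\<Sum>i<L * Q. w i *\<^sub>R b i)) < \<delta>)"
      using k(1,4) z w0 wk w1 wz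
      by (intro exI[of _ "k * Q"] conjI bexI[OF _ z] exI[of _ w]) auto
  qed
qed

section \<open>Absolute norms and weighted means\<close>


locale absnorm =
  fixes \<psi> :: "real^'n::finite \<Rightarrow> real"
  assumes absnorm: "absolute_normalized_norm \<psi>"
begin

lemma psi_nonneg [simp]: "0 \<le> \<psi> x"
  and psi_eq_0: "\<psi> x = 0 \<longleftrightarrow> x = 0"
  and psi_scale: "\<psi> (c *\<^sub>R x) = \<bar>c\<bar> * \<psi> x"
  and psi_triangle: "\<psi> (x + y) \<le> \<psi> x + \<psi> y"
  and psi_abs: "\<psi> x = \<psi> (\<chi> i. \<bar>x $ i\<bar>)"
  and psi_axis: "\<psi> (axis i 1) = 1"
  using absnorm unfolding absolute_normalized_norm_def is_norm_on_Rn_def by blast+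

lemma psi_zero [simp]: "\<psi> 0 = 0"
  by (simp add: psi_eq_0)

text \<open>Coordinates are changed one at a time. Since \<open>u $ i = c * v $ i\<close> with
  \<open>c\<close> between 0 and 1, the new vector is a convex combination of the old one and its
  reflection in coordinate \<open>i\<close>, which has the same norm.\<close>

lemma psi_mono:
  assumes uv: "\<And>l. 0 \<le> u $ l" "\<And>l. u $ l \<le> v $ l"
  shows "\<psi> u \<le> \<psi> v"
proof -
  define mix where "mix S = (\<chi> l. if l \<in> S then u $ l else v $ l)" for S
  have "\<psi> (mix S) \<le> \<psi> v" if "finite S" for S
    using that
  proof (induction S)
    case empty
    then show ?case by (simp add: mix_def)
  next
    case (insert i S)
    define fl where "fl = (\<chi> l. if l = i then - (mix S $ l) else mix S $ l)"
    have v0: "0 \<le> v $ i" using uv[of i] by linarith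
    \<comment> \<open>If \<open>v $ i = 0\<close> then \<open>u $ i = 0\<close> as well, so the
      default factor 1 is correct.\<close>
    define c where "c = (if v $ i = 0 then 1 else u $ i / v $ i)"
    have c: "0 \<le> c" "c \<le> 1" "u $ i = c * v $ i"
      using uv[of i] v0 by (auto simp: c_def divide_le_eq_1)
    have "mix (insert i S) = ((1 + c) / 2) *\<^sub>R mix S + ((1 - c) / 2) *\<^sub>R fl"
      using insert.hyps by (vector vec_eq_iff mix_def fl_def c(3)) (auto simp: vec_eq_iff mix_def fl_def c(3) field_simps)
    then have "\<psi> (mix (insert i S)) \<le> (1 + c) / 2 * \<psi> (mix S) + (1 - c) / 2 * \<psi> fl"
      using psi_triangle[of "((1 + c) / 2) *\<^sub>R mix S" "((1 - c) / 2) *\<^sub>R fl"] c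
      by (simp add: psi_scale abs_of_nonneg)
    also have "\<psi> fl = \<psi> (mix S)"
      by (subst (1 2) psi_abs) (auto simp: fl_def intro!: arg_cong[of _ _ \<psi>] simp: vec_eq_iff)
    also have "(1 + c) / 2 * \<psi> (mix S) + (1 - c) / 2 * \<psi> (mix S) = \<psi> (mix S)" by (simp add: field_simps)
    finally show ?case using insert.IH by simp
  qed
  from this[of UNIV] show ?thesis by (simp add: mix_def)
qed

lemma psi_ge_component: "\<bar>v $ l\<bar> \<le> \<psi> v"
proof -
  have "\<psi> (\<bar>v $ l\<bar> *\<^sub>R axis l 1) \<le> \<psi> (\<chi> i. \<bar>v $ i\<bar>)"
    by (rule psi_mono) (auto simp: axis_def)
  then show ?thesis by (simp add: psi_scale psi_axis psi_abs[symmetric])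
qed

lemma psi_le_sum: "\<psi> v \<le> (\<Sum>l\<in>UNIV. \<bar>v $ l\<bar>)"
proof -
  have le: "\<psi> (sum f A) \<le> (\<Sum>i\<in>A. \<psi> (f i))" if "finite A" for A and f :: "'n \<Rightarrow> real^'n"
    using that by (induction A) (auto intro: order_trans[OF psi_triangle])
  have "v = (\<Sum>l\<in>UNIV. (v $ l) *\<^sub>R axis l 1)"
    by (simp add: vec_eq_iff axis_def if_distrib[of "\<lambda>c. _ * c"] cong: if_cong)
  then show ?thesis using le[of UNIV "\<lambda>l. (v $ l) *\<^sub>R axis l 1"] by (simp add: psi_scale psi_axis)
qed

lemma psi_diff_le: "\<bar>\<psi> u - \<psi> v\<bar> \<le> (\<Sum>l\<in>UNIV. \<bar>u $ l - v $ l\<bar>)"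
proof -
  have m: "\<psi> (- x) = \<psi> x" for x using psi_scale[of "-1" x] by simp
  have "\<psi> u \<le> \<psi> v + \<psi> (u - v)" "\<psi> v \<le> \<psi> u + \<psi> (u - v)"
    using psi_triangle[of v "u - v"] psi_triangle[of u "v - u"] m[of "u - v"] by auto
  then show ?thesis using psi_le_sum[of "u - v"] by auto
qed

lemma psi_continuous: "continuous_on S \<psi>"
proof -
  have "isCont \<psi> x" for x
  proof -
    have "(\<lambda>y. \<Sum>l\<in>UNIV. \<bar>y $ l - x $ l\<bar>) \<midarrow>x\<rightarrow> (\<Sum>l\<in>UNIV. \<bar>x $ l - x $ l\<bar>)"
      by (intro tendsto_intros)
    then have "(\<lambda>y. \<Sum>l\<in>UNIV. \<bar>y $ l - x $ l\<bar>) \<midarrow>x\<rightarrow> 0" by simp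
    then have "(\<lambda>y. \<psi> y - \<psi> x) \<midarrow>x\<rightarrow> 0"
      by (rule Lim_null_comparison[rotated]) (auto intro!: always_eventually psi_diff_le)
    then show ?thesis by (simp add: isCont_def LIM_zero_iff)
  qed
  then show ?thesis by (simp add: continuous_at_imp_continuous_on)
qed

end

section \<open>Weighted means and near-equality in quadratic mean\<close>

locale weights =
  fixes I :: "'i set" and w :: "'i \<Rightarrow> real"
  assumes fin: "finite I" and w_nonneg: "i \<in> I \<Longrightarrow> 0 \<le> w i" and w_sum: "sum w I = 1"
begin

definition E :: "('i \<Rightarrow> real) \<Rightarrow> real" where "E f = (\<Sum>i\<in>I. w i * f i)"

lemma E_add: "E (\<lambda>i. f i + g i) = E f + E g"
  by (simp add: E_def algebra_simps sum.distrib)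

lemma E_diff: "E (\<lambda>i. f i - g i) = E f - E g"
  by (simp add: E_def algebra_simps sum_subtractf)

lemma E_cmult: "E (\<lambda>i. c * f i) = c * E f"
  by (simp add: E_def sum_distrib_left mult.left_commute)

lemma E_mult_right: "E (\<lambda>i. f i * c) = E f * c"
  by (simp add: E_def sum_distrib_right mult.assoc)

lemma E_const: "E (\<lambda>i. c) = c"
  using w_sum by (simp add: E_def flip: sum_distrib_right)

lemma E_sum: "E (\<lambda>i. \<Sum>l\<in>A. f l i) = (\<Sum>l\<in>A. E (f l))"
  by (simp add: E_def sum_distrib_left) (rule sum.swap)

lemma E_mono: "(\<And>i. i \<in> I \<Longrightarrow> f i \<le> g i) \<Longrightarrow> E f \<le> E g"
  unfolding E_def by (intro sum_mono mult_left_mono w_nonneg) auto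

lemma E_le: "(\<And>i. i \<in> I \<Longrightarrow> f i \<le> c) \<Longrightarrow> E f \<le> c"
  using E_mono[of f "\<lambda>_. c"] by (simp add: E_const)

lemma E_nonneg: "(\<And>i. i \<in> I \<Longrightarrow> 0 \<le> f i) \<Longrightarrow> 0 \<le> E f"
  using E_mono[of "\<lambda>_. 0" f] by (simp add: E_const)

lemma E_swap: "E (\<lambda>i. E (\<lambda>j. f i j)) = E (\<lambda>j. E (\<lambda>i. f i j))"
  unfolding E_def sum_distrib_left by (subst sum.swap) (simp add: mult_ac)

lemma E_abs: "\<bar>E f\<bar> \<le> E (\<lambda>i. \<bar>f i\<bar>)"
proof -
  have "E f \<le> E (\<lambda>i. \<bar>f i\<bar>)" by (rule E_mono) auto
  moreover have "E (\<lambda>i. - 1 * f i) \<le> E (\<lambda>i. \<bar>f i\<bar>)" by (rule E_mono) auto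
  ultimately show ?thesis unfolding E_cmult by linarith
qed

lemma E_square: "(E f)\<^sup>2 \<le> E (\<lambda>i. (f i)\<^sup>2)"
proof -
  have "0 \<le> E (\<lambda>i. (f i - E f)\<^sup>2)" by (rule E_nonneg) simp
  also have "\<dots> = E (\<lambda>i. (f i)\<^sup>2 - 2 * E f * f i + (E f)\<^sup>2)" by (simp add: power2_diff algebra_simps)
  also have "\<dots> = E (\<lambda>i. (f i)\<^sup>2) - (E f)\<^sup>2"
    by (simp add: E_add E_diff E_cmult E_const) (simp add: power2_eq_square)
  finally show ?thesis by simp
qed

lemma E_seminorm:
  assumes "seminorm p"
  shows "p (\<Sum>i\<in>I. w i *\<^sub>R x i) \<le> E (\<lambda>i. p (x i))"
proof -
  interpret seminorm p by fact
  have "p (\<Sum>i\<in>I. w i *\<^sub>R x i) \<le> (\<Sum>i\<in>I. p (w i *\<^sub>R x i))" by (rule sum_le)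
  also have "\<dots> = E (\<lambda>i. p (x i))" unfolding E_def
    by (intro sum.cong) (auto simp: scale w_nonneg)
  finally show ?thesis .
qed

lemma E_le_bound:
  assumes "E (\<lambda>i. (f i)\<^sup>2) \<le> c\<^sup>2" "0 \<le> c"
  shows "E f \<le> c"
  using order_trans[OF E_square assms(1)] assms(2) by (simp add: power2_le_iff_abs_le)

text \<open>From near-equality in the triangle inequality in quadratic mean, the pairwise
  distances are nearly constant.\<close>

lemma quadratic_rigidity:
  assumes a0: "\<And>n m. n \<in> I \<Longrightarrow> m \<in> I \<Longrightarrow> 0 \<le> a n m" and sym: "\<And>n m. a n m = a m n"
    and b0: "\<And>n. n \<in> I \<Longrightarrow> 0 \<le> b n" and G0: "\<And>n. n \<in> I \<Longrightarrow> 0 \<le> G n"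
    and GF: "\<And>n. n \<in> I \<Longrightarrow> G n \<le> E (a n) + E b" and GD: "\<And>n. n \<in> I \<Longrightarrow> G n \<le> 2 * D"
    and t: "0 \<le> t" "t \<le> 1" and \<eta>: "0 \<le> \<eta>" "2 * \<eta> \<le> t * \<rho>" "4 * \<eta> \<le> \<rho>" and \<rho>: "0 < \<rho>"
    and Ea: "E (\<lambda>n. E (\<lambda>m. (a n m)\<^sup>2)) \<le> (t * \<rho> + \<eta>)\<^sup>2"
    and Eb: "E (\<lambda>n. (b n)\<^sup>2) \<le> ((1 - t) * \<rho> + \<eta>)\<^sup>2"
    and EG: "(\<rho> - \<eta>)\<^sup>2 \<le> E (\<lambda>n. (G n)\<^sup>2)"
    and e: "e = sqrt (6 * \<rho> * \<eta>)" and \<zeta>: "\<zeta> = 3 * e + 5 * \<eta> + 4 * D * e / \<rho>" and D: "0 \<le> D"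
  shows "E (\<lambda>n. E (\<lambda>m. \<bar>a n m - t * \<rho>\<bar>)) \<le> \<zeta>" "E b \<le> (1 - t) * \<rho> + \<zeta>" "\<rho> - \<zeta> \<le> E G"
proof -
  define F where "F n = E (a n)" for n
  define s where "s = E b"
  define \<alpha> where "\<alpha> = E F"
  have e0: "0 \<le> e" "e\<^sup>2 = 6 * \<rho> * \<eta>" using e \<rho> \<eta> by auto
  have F0: "0 \<le> F n" if "n \<in> I" for n unfolding F_def using a0 that by (intro E_nonneg)
  have s: "s \<le> (1 - t) * \<rho> + \<eta>" "0 \<le> s"
    unfolding s_def using E_le_bound[OF Eb] t \<rho> \<eta> b0 by (auto intro: E_nonneg)
  define x where "x = sqrt (E (\<lambda>n. (F n)\<^sup>2))"
  have x2: "x\<^sup>2 = E (\<lambda>n. (F n)\<^sup>2)" and x0: "0 \<le> x"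
    unfolding x_def by (auto intro!: E_nonneg)
  have \<alpha>x: "\<alpha> \<le> x" "0 \<le> \<alpha>"
    unfolding \<alpha>_def using E_le_bound[of F x] x2 x0 F0 by (auto intro: E_nonneg)
  \<comment> \<open>Minkowski with the constant \<open>s\<close>: the lower bound on
    \<open>G\<close> forces the quadratic mean \<open>x\<close> of the row means \<open>F\<close> to
    be at least \<open>t * \<rho> - 2 * \<eta>\<close>.\<close>
  have "E (\<lambda>n. (G n)\<^sup>2) \<le> E (\<lambda>n. (F n + s)\<^sup>2)"
    by (rule E_mono) (use GF G0 F_def s_def in \<open>auto intro!: power_mono\<close>)
  also have "\<dots> = x\<^sup>2 + 2 * s * \<alpha> + s\<^sup>2"
    by (simp add: x2 \<alpha>_def power2_sum E_add E_cmult E_const E_mult_right)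
  also have "\<dots> \<le> (x + s)\<^sup>2" using \<alpha>x s mult_left_mono[of \<alpha> x "2 * s"] by (simp add: power2_sum mult_ac)
  finally have "(\<rho> - \<eta>)\<^sup>2 \<le> (x + s)\<^sup>2" using EG by linarith
  then have "\<rho> - \<eta> \<le> x + s" by (rule power2_le_imp_le) (use x0 s in auto)
  then have xl: "t * \<rho> - 2 * \<eta> \<le> x" using s by (simp add: algebra_simps)
  have "(t * \<rho> - 2 * \<eta>)\<^sup>2 \<le> x\<^sup>2" using xl \<eta> by (intro power_mono) auto
  \<comment> \<open>The spread of \<open>a\<close> around its row means is the gap between the
    second moments of \<open>a\<close> and \<open>F\<close>. The available bounds leave at most
    \<open>6 * \<rho> * \<eta>\<close>, which is the origin of \<open>e\<close>.\<close>
  moreover have "E (\<lambda>n. E (\<lambda>m. (a n m - F n)\<^sup>2)) = E (\<lambda>n. E (\<lambda>m. (a n m)\<^sup>2)) - x\<^sup>2"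
  proof -
    have "E (\<lambda>m. (a n m - F n)\<^sup>2) = E (\<lambda>m. (a n m)\<^sup>2) - (F n)\<^sup>2" for n
    proof -
      have "E (\<lambda>m. (a n m - F n)\<^sup>2) = E (\<lambda>m. (a n m)\<^sup>2 - 2 * F n * a n m + (F n)\<^sup>2)"
        by (simp add: power2_diff algebra_simps)
      also have "\<dots> = E (\<lambda>m. (a n m)\<^sup>2) - 2 * F n * F n + (F n)\<^sup>2"
        by (simp add: E_add E_diff E_cmult E_const) (simp add: F_def)
      finally show ?thesis by (simp add: power2_eq_square)
    qed
    then show ?thesis by (simp add: E_diff x2)
  qed
  moreover have "(t * \<rho> + \<eta>)\<^sup>2 - (t * \<rho> - 2 * \<eta>)\<^sup>2 \<le> 6 * \<rho> * \<eta>"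
  proof -
    have "(t * \<rho> + \<eta>)\<^sup>2 - (t * \<rho> - 2 * \<eta>)\<^sup>2 = t * (6 * \<rho> * \<eta>) - 3 * \<eta>\<^sup>2"
      by (simp add: power2_eq_square algebra_simps)
    moreover have "t * (6 * \<rho> * \<eta>) \<le> 1 * (6 * \<rho> * \<eta>)" by (rule mult_right_mono) (use t \<rho> \<eta> in auto)
    moreover have "0 \<le> \<eta>\<^sup>2" by simp
    ultimately show ?thesis by linarith
  qed
  ultimately have var: "E (\<lambda>n. E (\<lambda>m. (a n m - F n)\<^sup>2)) \<le> e\<^sup>2" using Ea e0 by linarith
  have "E (\<lambda>n. (E (\<lambda>m. \<bar>a n m - F n\<bar>))\<^sup>2) \<le> E (\<lambda>n. E (\<lambda>m. \<bar>a n m - F n\<bar>\<^sup>2))"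
    by (intro E_mono E_square)
  then have "E (\<lambda>n. (E (\<lambda>m. \<bar>a n m - F n\<bar>))\<^sup>2) \<le> e\<^sup>2" using var by simp
  then have d1: "E (\<lambda>n. E (\<lambda>m. \<bar>a n m - F n\<bar>)) \<le> e" by (rule E_le_bound) (rule e0)
  \<comment> \<open>By symmetry \<open>a n m\<close> is close to \<open>F m\<close> as well as to
    \<open>F n\<close>, so the row means agree with each other up to a small mean error.\<close>
  have d2: "E (\<lambda>n. E (\<lambda>m. \<bar>a n m - F m\<bar>)) \<le> e"
    using d1 by (subst E_swap) (simp add: sym)
  have "E (\<lambda>n. E (\<lambda>m. \<bar>F n - F m\<bar>)) \<le> E (\<lambda>n. E (\<lambda>m. \<bar>a n m - F n\<bar> + \<bar>a n m - F m\<bar>))"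
    by (intro E_mono) linarith
  then have d3: "E (\<lambda>n. E (\<lambda>m. \<bar>F n - F m\<bar>)) \<le> 2 * e" using d1 d2 by (simp add: E_add)
  have "\<bar>F n - \<alpha>\<bar> \<le> E (\<lambda>m. \<bar>F n - F m\<bar>)" for n
    using E_abs[of "\<lambda>m. F n - F m"] by (simp add: E_diff E_const \<alpha>_def)
  then have "E (\<lambda>n. \<bar>F n - \<alpha>\<bar>) \<le> E (\<lambda>n. E (\<lambda>m. \<bar>F n - F m\<bar>))" by (intro E_mono) auto
  then have d4: "E (\<lambda>n. \<bar>F n - \<alpha>\<bar>) \<le> 2 * e" using d3 by linarith
  have "E (\<lambda>n. E (\<lambda>m. \<bar>a n m - t * \<rho>\<bar>)) \<le> E (\<lambda>n. E (\<lambda>m. \<bar>a n m - F n\<bar> + (\<bar>F n - \<alpha>\<bar> + \<bar>\<alpha> - t * \<rho>\<bar>)))"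
    by (intro E_mono) linarith
  then have d5: "E (\<lambda>n. E (\<lambda>m. \<bar>a n m - t * \<rho>\<bar>)) \<le> 3 * e + \<bar>\<alpha> - t * \<rho>\<bar>"
    using d1 d4 by (simp add: E_add E_const)
  have "x\<^sup>2 \<le> (t * \<rho> + \<eta>)\<^sup>2"
  proof -
    have "x\<^sup>2 \<le> E (\<lambda>n. E (\<lambda>m. (a n m)\<^sup>2))" unfolding x2 F_def by (intro E_mono E_square)
    then show ?thesis using Ea by linarith
  qed
  then have xu: "x \<le> t * \<rho> + \<eta>" by (rule power2_le_imp_le) (use t \<rho> \<eta> in auto)
  have \<alpha>s: "\<alpha> + s \<le> \<rho> + 2 * \<eta>" "0 \<le> \<alpha> + s" using xu \<alpha>x s by (auto simp: algebra_simps)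
  have EG0: "0 \<le> E G" by (intro E_nonneg G0)
  \<comment> \<open>The second moment bounds the first from below: one factor \<open>G n\<close> is
    replaced by its nearly constant bound \<open>\<alpha> + s\<close>, and the deviation is paid for
    with the crude bound \<open>2 * D\<close> on the other.\<close>
  have "(G n)\<^sup>2 \<le> G n * (\<alpha> + s) + 2 * D * \<bar>F n - \<alpha>\<bar>" if n: "n \<in> I" for n
  proof -
    have "(G n)\<^sup>2 \<le> G n * ((\<alpha> + s) + \<bar>F n - \<alpha>\<bar>)"
      unfolding power2_eq_square using GF[OF n] G0[OF n] by (intro mult_left_mono) (auto simp: F_def s_def)
    moreover have "G n * \<bar>F n - \<alpha>\<bar> \<le> 2 * D * \<bar>F n - \<alpha>\<bar>" by (intro mult_right_mono GD n) auto
    ultimately show ?thesis by (simp add: distrib_left)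
  qed
  then have "E (\<lambda>n. (G n)\<^sup>2) \<le> E (\<lambda>n. G n * (\<alpha> + s) + 2 * D * \<bar>F n - \<alpha>\<bar>)" by (rule E_mono)
  also have "\<dots> = E G * (\<alpha> + s) + 2 * D * E (\<lambda>n. \<bar>F n - \<alpha>\<bar>)" by (simp add: E_add E_mult_right E_cmult)
  also have "\<dots> \<le> E G * (\<rho> + 2 * \<eta>) + 2 * D * (2 * e)"
    by (rule add_mono[OF mult_left_mono[OF \<alpha>s(1) EG0] mult_left_mono[OF d4]]) (use D in simp)
  finally have "(\<rho> - \<eta>)\<^sup>2 - 4 * D * e \<le> E G * (\<rho> + 2 * \<eta>)" using EG by linarith
  moreover have "(\<rho> - 4 * \<eta>) * (\<rho> + 2 * \<eta>) \<le> (\<rho> - \<eta>)\<^sup>2"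
    by (simp add: power2_eq_square algebra_simps)
  moreover have "4 * D * e \<le> 4 * D * e / \<rho> * (\<rho> + 2 * \<eta>)"
    using \<rho> \<eta> D e0 by (simp add: field_simps)
  ultimately have "(\<rho> - 4 * \<eta> - 4 * D * e / \<rho>) * (\<rho> + 2 * \<eta>) \<le> E G * (\<rho> + 2 * \<eta>)"
    by (simp add: left_diff_distrib)
  then have EGl: "\<rho> - 4 * \<eta> - 4 * D * e / \<rho> \<le> E G" using \<rho> \<eta> by (simp add: mult_le_cancel_right)
  have De: "0 \<le> 4 * D * e / \<rho>" using D e0 \<rho> by auto
  have "E G \<le> \<alpha> + s"
  proof -
    have "E G \<le> E (\<lambda>n. F n + s)" by (rule E_mono) (use GF in \<open>auto simp: F_def s_def\<close>)
    then show ?thesis by (simp add: E_add E_const \<alpha>_def)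
  qed
  then have "t * \<rho> - 5 * \<eta> - 4 * D * e / \<rho> \<le> \<alpha>" using EGl s(1) by (simp add: algebra_simps)
  then have "\<bar>\<alpha> - t * \<rho>\<bar> \<le> 5 * \<eta> + 4 * D * e / \<rho>" using \<alpha>x xu \<eta> De by linarith
  then show "E (\<lambda>n. E (\<lambda>m. \<bar>a n m - t * \<rho>\<bar>)) \<le> \<zeta>" using d5 \<zeta> by linarith
  show "E b \<le> (1 - t) * \<rho> + \<zeta>" using s(1) De e0 \<eta> by (simp add: \<zeta> s_def)
  show "\<rho> - \<zeta> \<le> E G" using EGl e0 \<eta> \<zeta> by linarith
qed

end

locale sum_space = absnorm \<psi> for \<psi> :: "real^'n::finite \<Rightarrow> real" +
  fixes V :: "'v::real_vector set" and p :: "'n \<Rightarrow> 'v \<Rightarrow> real" and \<kappa> :: real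
  assumes V: "subspace V" and sp: "seminorm (p l)" and ns: "nonsquare_on V \<kappa> (p l)"
begin

definition pv :: "'v \<Rightarrow> real^'n" where "pv x = (\<chi> l. p l x)"

definition N :: "'v \<Rightarrow> real" where "N x = \<psi> (pv x)"

lemma pv_nth [simp]: "pv x $ l = p l x"
  by (simp add: pv_def)

lemma p_nonneg [simp]: "0 \<le> p l x"
  by (rule seminorm.nonneg[OF sp])

lemma p_le_N: "p l x \<le> N x"
  using psi_ge_component[of "pv x" l] by (simp add: N_def)

lemma seminorm_psi: "seminorm \<psi>"
  by unfold_locales (rule psi_triangle, rule psi_scale)

lemma seminorm_N: "seminorm N"
proof
  fix x y :: 'v and c :: real
  have "N (x + y) \<le> \<psi> (pv x + pv y)"
    unfolding N_def by (rule psi_mono) (simp_all add: seminorm.add_le[OF sp])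
  also have "\<dots> \<le> N x + N y" unfolding N_def by (rule psi_triangle)
  finally show "N (x + y) \<le> N x + N y" .
  have "pv (c *\<^sub>R x) = \<bar>c\<bar> *\<^sub>R pv x" by (simp add: vec_eq_iff seminorm.scale[OF sp])
  then show "N (c *\<^sub>R x) = \<bar>c\<bar> * N x" by (simp add: N_def psi_scale)
qed

lemma kappa: "0 < \<kappa>" "\<kappa> \<le> 1"
  using ns by (auto simp: nonsquare_on_def)

end

section \<open>The two-part splitting and its defect in the triangle inequality\<close>

locale config = sum_space \<psi> V p \<kappa> + weights I w
  for \<psi> :: "real^'n::finite \<Rightarrow> real" and V :: "'v::real_vector set" and p \<kappa>
    and I :: "'i set" and w +
  fixes W X :: "'i \<Rightarrow> 'v" and D :: real
  assumes WV: "n \<in> I \<Longrightarrow> W n \<in> V" and XV: "n \<in> I \<Longrightarrow> X n \<in> V"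
    and WW: "n \<in> I \<Longrightarrow> m \<in> I \<Longrightarrow> N (W n - W m) \<le> D"
    and WX: "n \<in> I \<Longrightarrow> m \<in> I \<Longrightarrow> N (W n - X m) \<le> D"
begin

definition Xbar :: 'v where "Xbar = (\<Sum>i\<in>I. w i *\<^sub>R X i)"
definition Fl :: "'n \<Rightarrow> 'i \<Rightarrow> real" where "Fl l n = E (\<lambda>m. p l (W n - W m))"
definition \<beta> :: "'n \<Rightarrow> real" where "\<beta> l = E (\<lambda>i. p l (W i - X i))"
definition \<tau> :: "'n \<Rightarrow> 'i \<Rightarrow> 'i \<Rightarrow> 'i \<Rightarrow> real" where
  "\<tau> l n m i = p l (W n - W m) + p l (W i - X i) - p l ((W n - W m) + (W i - X i))"

lemma tau_nonneg: "0 \<le> \<tau> l n m i"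
  unfolding \<tau>_def using seminorm.add_le[OF sp, of l] by (simp add: add.commute)

lemma wsum_add_const: "(\<Sum>i\<in>I. w i *\<^sub>R (c + y i)) = c + (\<Sum>i\<in>I. w i *\<^sub>R (y i :: 'z::real_vector))"
  by (simp add: scaleR_add_right sum.distrib w_sum flip: scaleR_sum_left)

text \<open>The means of \<open>W m\<close> and of \<open>W i\<close> cancel. The indices
  \<open>m\<close> and \<open>i\<close> are kept separate so that means of products of the two parts
  factor later.\<close>

lemma W_Xbar: "W n - Xbar = (\<Sum>m\<in>I. w m *\<^sub>R (\<Sum>i\<in>I. w i *\<^sub>R ((W n - W m) + (W i - X i))))"
proof -
  let ?s = "\<Sum>i\<in>I. w i *\<^sub>R W i"
  have b: "(\<Sum>i\<in>I. w i *\<^sub>R (W i - X i)) = ?s - Xbar"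
    by (simp add: Xbar_def scaleR_diff_right sum_subtractf)
  have "(\<Sum>m\<in>I. w m *\<^sub>R (\<Sum>i\<in>I. w i *\<^sub>R ((W n - W m) + (W i - X i))))
     = (\<Sum>m\<in>I. w m *\<^sub>R ((W n + (?s - Xbar)) + - W m))"
  proof -
    have e: "W n - W m + (?s - Xbar) = (W n + (?s - Xbar)) + - W m" for m by simp
    show ?thesis unfolding wsum_add_const b e ..
  qed
  also have "\<dots> = W n + (?s - Xbar) + (\<Sum>m\<in>I. w m *\<^sub>R (- W m))" by (rule wsum_add_const)
  also have "\<dots> = W n - Xbar" by (simp add: sum_negf)
  finally show ?thesis by simp
qed

lemma p_W_Xbar: "p l (W n - Xbar) \<le> E (\<lambda>m. E (\<lambda>i. p l ((W n - W m) + (W i - X i))))"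
  unfolding W_Xbar
  by (rule order_trans[OF E_seminorm[OF sp]]) (intro E_mono E_seminorm sp)

lemma E_tau: "E (\<lambda>m. E (\<lambda>i. \<tau> l n m i)) \<le> Fl l n + \<beta> l - p l (W n - Xbar)"
  using p_W_Xbar[of l n] by (simp add: \<tau>_def E_add E_diff E_const Fl_def \<beta>_def)

text \<open>Exchanging \<open>n\<close> and \<open>m\<close> reverses the first part, and by
  nonsquareness one of the two signs has a defect of at least \<open>\<kappa>\<close> times the
  smaller part.\<close>

lemma min_le_tau:
  assumes "n \<in> I" "m \<in> I" "i \<in> I"
  shows "\<kappa> * min (p l (W n - W m)) (p l (W i - X i)) \<le> \<tau> l n m i + \<tau> l m n i"
proof -
  interpret P: seminorm "p l" by (rule sp)
  let ?a = "W n - W m" and ?b = "W i - X i"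
  have "?a \<in> V" "?b \<in> V" using assms WV XV V by (auto intro: subspace_diff)
  then have "min (p l (?b + ?a)) (p l (?b - ?a)) \<le> p l ?b + p l ?a - \<kappa> * min (p l ?b) (p l ?a)"
    using ns[of l] by (simp add: nonsquare_on_def)
  moreover have "?b - ?a = (W m - W n) + ?b" "?b + ?a = ?a + ?b" by simp_all
  ultimately have "min (p l (?a + ?b)) (p l ((W m - W n) + ?b)) \<le> p l ?b + p l ?a - \<kappa> * min (p l ?b) (p l ?a)"
    by metis
  then show ?thesis
    using tau_nonneg[of l n m i] tau_nonneg[of l m n i] P.minus_commute[of "W n" "W m"]
    unfolding \<tau>_def by (simp add: min.commute)
qed

text \<open>Unlike the minimum, the product factors when it is averaged over independent
  indices.\<close>

lemma prod_le_tau: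
  assumes "n \<in> I" "m \<in> I" "i \<in> I"
  shows "p l (W n - W m) * p l (W i - X i) \<le> D / \<kappa> * (\<tau> l n m i + \<tau> l m n i)"
proof -
  let ?a = "p l (W n - W m)" and ?b = "p l (W i - X i)"
  have le: "?a \<le> D" "?b \<le> D" using assms WW WX p_le_N order_trans by blast+
  have D0: "0 \<le> D" using le(1) p_nonneg[of l "W n - W m"] by linarith
  have "?a * ?b = max ?a ?b * min ?a ?b" by (auto simp: max_def min_def)
  also have "\<dots> \<le> D * min ?a ?b" using le by (intro mult_right_mono) auto
  also have "\<dots> = D / \<kappa> * (\<kappa> * min ?a ?b)" using kappa by simp
  also have "\<dots> \<le> D / \<kappa> * (\<tau> l n m i + \<tau> l m n i)"
    using D0 kappa min_le_tau[OF assms] by (intro mult_left_mono) auto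
  finally show ?thesis .
qed

lemma D_nonneg: "0 \<le> D"
proof -
  have "I \<noteq> {}" using w_sum by auto
  then obtain n where "n \<in> I" by blast
  then show ?thesis using WW[of n n] p_le_N[of undefined "W n - W n"] p_nonneg[of undefined "W n - W n"] by linarith
qed

lemma beta_nonneg: "0 \<le> \<beta> l"
  unfolding \<beta>_def by (intro E_nonneg) simp

lemma N_W_Xbar: "N (W n - Xbar) \<le> E (\<lambda>m. N (W n - W m)) + E (\<lambda>i. N (W i - X i))"
  unfolding W_Xbar
proof (rule order_trans[OF E_seminorm[OF seminorm_N]])
  have "E (\<lambda>m. N (\<Sum>i\<in>I. w i *\<^sub>R ((W n - W m) + (W i - X i)))) \<le> E (\<lambda>m. E (\<lambda>i. N (W n - W m) + N (W i - X i)))"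
    by (intro E_mono order_trans[OF E_seminorm[OF seminorm_N]] seminorm.add_le[OF seminorm_N])
  then show "E (\<lambda>m. N (\<Sum>i\<in>I. w i *\<^sub>R ((W n - W m) + (W i - X i)))) \<le> E (\<lambda>m. N (W n - W m)) + E (\<lambda>n. N (W n - X n))"
    by (simp add: E_add E_const)
qed

text \<open>If coordinate \<open>l\<close> alone carried the norm on a substantial set of indices, then
  nonsquareness would fail there: both parts of the splitting would be large while the triangle
  inequality is almost an equality.\<close>

lemma tight_small:
  assumes h: "\<And>n. h n = 0 \<or> h n = (1::real)"
    and tight: "\<And>n. n \<in> I \<Longrightarrow> h n = 1 \<Longrightarrow> Fl l n + \<beta> l - p l (W n - Xbar) \<le> \<epsilon>1"
      "\<And>n. n \<in> I \<Longrightarrow> h n = 1 \<Longrightarrow> N (W n - Xbar) \<le> p l (W n - Xbar) + \<epsilon>1"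
    and H1: "E (\<lambda>n. E (\<lambda>m. \<bar>N (W n - W m) - t * \<rho>\<bar>)) \<le> \<zeta>"
    and H2: "E (\<lambda>n. N (W n - X n)) \<le> (1 - t) * \<rho> + \<zeta>"
    and H3: "\<rho> - \<zeta> \<le> E (\<lambda>n. N (W n - Xbar))"
    and t: "1 / 4 \<le> t" "t \<le> 3 / 4" and \<rho>: "0 < \<rho>" and \<zeta>: "0 \<le> \<zeta>" "\<zeta> \<le> \<epsilon>1"
    and \<epsilon>3: "0 < \<epsilon>3" "\<epsilon>3 \<le> 1" "48 * \<epsilon>1 \<le> \<epsilon>3\<^sup>2 * \<rho>" "128 * D * \<epsilon>1 < \<kappa> * (\<epsilon>3 ^ 3 * \<rho>\<^sup>2)"
  shows "E h \<le> \<epsilon>3"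
proof (rule ccontr)
  assume "\<not> E h \<le> \<epsilon>3"
  define q where "q = E h"
  define s where "s = E (\<lambda>n. N (W n - X n))"
  define F where "F n = E (\<lambda>m. N (W n - W m))" for n
  define G where "G n = N (W n - Xbar)" for n
  note [simp] = seminorm.nonneg[OF seminorm_N]
  have h01: "0 \<le> h n" "h n \<le> 1" for n using h[of n] by auto
  have q: "\<epsilon>3 < q" "q \<le> 1" using \<open>\<not> E h \<le> \<epsilon>3\<close> h01 by (auto simp: q_def intro: E_le)
  have \<epsilon>1: "0 \<le> \<epsilon>1" using \<zeta> by linarith
  have FN: "\<bar>F n - t * \<rho>\<bar> \<le> E (\<lambda>m. \<bar>N (W n - W m) - t * \<rho>\<bar>)" for n
    using E_abs[of "\<lambda>m. N (W n - W m) - t * \<rho>"] by (simp add: E_diff E_const F_def)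
  have GF: "G n \<le> F n + s" for n unfolding G_def F_def s_def by (rule N_W_Xbar)
  have F1: "E (\<lambda>n. \<bar>F n - t * \<rho>\<bar>) \<le> \<zeta>"
    by (rule order_trans[OF E_mono H1]) (rule FN)
  \<comment> \<open>Where \<open>h\<close> vanishes, the values \<open>G n\<close> hardly exceed
    \<open>\<rho>\<close> on average, so the support of \<open>h\<close> must contribute its full
    share of the total.\<close>
  have T1: "q * \<rho> - 3 * \<zeta> \<le> E (\<lambda>n. h n * G n)"
  proof -
    have "(1 - h n) * G n \<le> (1 - h n) * (\<rho> + \<zeta>) + \<bar>F n - t * \<rho>\<bar>" for n
    proof -
      have "(1 - h n) * G n \<le> (1 - h n) * ((\<rho> + \<zeta>) + \<bar>F n - t * \<rho>\<bar>)"
        using GF[of n] H2 h01[of n] by (intro mult_left_mono) (auto simp: s_def algebra_simps)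
      moreover have "(1 - h n) * \<bar>F n - t * \<rho>\<bar> \<le> 1 * \<bar>F n - t * \<rho>\<bar>"
        using h01[of n] by (intro mult_right_mono) auto
      ultimately show ?thesis by (simp add: distrib_left)
    qed
    then have "E (\<lambda>n. (1 - h n) * G n) \<le> E (\<lambda>n. (1 - h n) * (\<rho> + \<zeta>) + \<bar>F n - t * \<rho>\<bar>)" by (rule E_mono)
    also have "\<dots> \<le> (1 - q) * (\<rho> + \<zeta>) + \<zeta>" using F1 by (simp add: E_add E_mult_right E_diff E_const q_def)
    also have "\<dots> \<le> (1 - q) * \<rho> + 2 * \<zeta>"
      using q \<epsilon>3 \<zeta> mult_right_mono[of "1 - q" 1 \<zeta>] by (simp add: algebra_simps)
    finally have "E G - E (\<lambda>n. h n * G n) \<le> (1 - q) * \<rho> + 2 * \<zeta>" by (simp add: left_diff_distrib E_diff)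
    then show ?thesis using H3 unfolding G_def[abs_def] by (simp add: algebra_simps)
  qed
  have T2: "E (\<lambda>n. h n * G n) \<le> E (\<lambda>n. h n * Fl l n) + q * \<beta> l + \<epsilon>1"
  proof -
    have "p l (W n - Xbar) \<le> Fl l n + \<beta> l" for n
    proof -
      have "0 \<le> E (\<lambda>m. E (\<lambda>i. \<tau> l n m i))" by (intro E_nonneg tau_nonneg)
      then show ?thesis using E_tau[of l n] by linarith
    qed
    then have "h n * G n \<le> h n * Fl l n + h n * \<beta> l + \<epsilon>1" if "n \<in> I" for n
      using h[of n] tight(2)[OF that] \<epsilon>1 by (auto simp: G_def intro: order_trans add_right_mono)
    then have "E (\<lambda>n. h n * G n) \<le> E (\<lambda>n. h n * Fl l n + h n * \<beta> l + \<epsilon>1)" by (rule E_mono)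
    then show ?thesis by (simp add: E_add E_const E_mult_right q_def)
  qed
  \<comment> \<open>Pairwise distances equal \<open>t * \<rho>\<close> up to \<open>\<zeta>\<close>
    in the mean, so this value is an upper bound under any weights \<open>k\<close> between 0 and 1.
    Below, \<open>k\<close> is constant or selects the pairs leaving the support.\<close>
  have hN: "E (\<lambda>n. h n * E (\<lambda>m. k n m * p l (W n - W m))) \<le> E (\<lambda>n. h n * E (\<lambda>m. k n m * (t * \<rho>))) + \<zeta>"
    if k: "\<And>n m. 0 \<le> k n m \<and> k n m \<le> (1::real)" for k :: "'i \<Rightarrow> 'i \<Rightarrow> real"
  proof -
    have "h n * E (\<lambda>m. k n m * p l (W n - W m)) \<le> h n * E (\<lambda>m. k n m * (t * \<rho>)) + E (\<lambda>m. \<bar>N (W n - W m) - t * \<rho>\<bar>)" for n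
    proof -
      have "k n m * p l (W n - W m) \<le> k n m * (t * \<rho>) + \<bar>N (W n - W m) - t * \<rho>\<bar>" for m
      proof -
        have "k n m * p l (W n - W m) \<le> k n m * (t * \<rho> + \<bar>N (W n - W m) - t * \<rho>\<bar>)"
          using p_le_N[of l "W n - W m"] k[of n m] by (intro mult_left_mono) auto
        moreover have "k n m * \<bar>N (W n - W m) - t * \<rho>\<bar> \<le> 1 * \<bar>N (W n - W m) - t * \<rho>\<bar>"
          using k[of n m] by (intro mult_right_mono) auto
        ultimately show ?thesis by (simp add: distrib_left)
      qed
      then have le: "E (\<lambda>m. k n m * p l (W n - W m)) \<le> E (\<lambda>m. k n m * (t * \<rho>)) + E (\<lambda>m. \<bar>N (W n - W m) - t * \<rho>\<bar>)"
        unfolding E_add[symmetric] by (rule E_mono)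
      moreover have "0 \<le> E (\<lambda>m. \<bar>N (W n - W m) - t * \<rho>\<bar>)" by (intro E_nonneg) simp
      ultimately show ?thesis using h[of n] by auto
    qed
    then have "E (\<lambda>n. h n * E (\<lambda>m. k n m * p l (W n - W m)))
      \<le> E (\<lambda>n. h n * E (\<lambda>m. k n m * (t * \<rho>)) + E (\<lambda>m. \<bar>N (W n - W m) - t * \<rho>\<bar>))" by (rule E_mono)
    then show ?thesis using H1 by (simp add: E_add)
  qed
  have T3: "E (\<lambda>n. h n * Fl l n) \<le> q * (t * \<rho>) + \<zeta>"
    using hN[of "\<lambda>_ _. 1"] by (simp add: Fl_def E_const E_mult_right q_def)
  have \<beta>s: "\<beta> l \<le> (1 - t) * \<rho> + \<zeta>"
    using H2 E_mono[of "\<lambda>i. p l (W i - X i)" "\<lambda>i. N (W i - X i)"] p_le_N by (force simp: \<beta>_def)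
  have T4: "q * ((1 - t) * \<rho>) - 4 * \<zeta> - \<epsilon>1 \<le> q * \<beta> l"
    using T1 T2 T3 by (simp add: algebra_simps)
  have T5: "q * (t * \<rho>) - 4 * \<zeta> - \<epsilon>1 \<le> E (\<lambda>n. h n * Fl l n)"
  proof -
    have "q * \<beta> l \<le> q * ((1 - t) * \<rho>) + \<zeta>"
      using mult_left_mono[OF \<beta>s, of q] q \<epsilon>3 \<zeta> mult_right_mono[of q 1 \<zeta>] by (simp add: algebra_simps)
    then show ?thesis using T1 T2 by (simp add: algebra_simps)
  qed
  define P where "P = E (\<lambda>n. h n * E (\<lambda>m. h m * p l (W n - W m)))"
  \<comment> \<open>Pairs with \<open>m\<close> outside the support carry at most their share
    \<open>q * (1 - q)\<close> of \<open>t * \<rho>\<close>, so the pairs inside it carry a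
    substantial amount.\<close>
  have T6: "q * q * (t * \<rho>) - 5 * \<zeta> - \<epsilon>1 \<le> P"
  proof -
    have "E (\<lambda>n. h n * E (\<lambda>m. (1 - h m) * p l (W n - W m))) \<le> q * ((1 - q) * (t * \<rho>)) + \<zeta>"
      using hN[of "\<lambda>n m. 1 - h m"] h01 by (simp add: E_mult_right E_diff E_const q_def)
    moreover have "E (\<lambda>n. h n * Fl l n) = P + E (\<lambda>n. h n * E (\<lambda>m. (1 - h m) * p l (W n - W m)))"
      unfolding P_def Fl_def by (simp add: left_diff_distrib E_diff right_diff_distrib)
    ultimately show ?thesis using T5 by (simp add: algebra_simps)
  qed
  \<comment> \<open>Both indices are restricted to the support so that the mirrored defect can be
    swapped back into one that tightness bounds.\<close>
  have T7: "P * \<beta> l \<le> D / \<kappa> * (2 * \<epsilon>1)"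
  proof -
    let ?Z = "E (\<lambda>n. h n * E (\<lambda>m. h m * E (\<lambda>i. \<tau> l n m i)))"
    have "P * \<beta> l = E (\<lambda>n. h n * E (\<lambda>m. h m * E (\<lambda>i. p l (W n - W m) * p l (W i - X i))))"
      unfolding P_def \<beta>_def by (simp add: E_cmult mult.assoc flip: E_mult_right)
    also have "\<dots> \<le> E (\<lambda>n. h n * E (\<lambda>m. h m * E (\<lambda>i. D / \<kappa> * (\<tau> l n m i + \<tau> l m n i))))"
      by (intro E_mono mult_left_mono prod_le_tau h01)
    also have "\<dots> = D / \<kappa> * (?Z + E (\<lambda>n. h n * E (\<lambda>m. h m * E (\<lambda>i. \<tau> l m n i))))"
    proof -
      have e: "h n * E (\<lambda>m. h m * E (\<lambda>i. c * (\<tau> l n m i + \<tau> l m n i)))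
        = c * (h n * E (\<lambda>m. h m * E (\<lambda>i. \<tau> l n m i)) + h n * E (\<lambda>m. h m * E (\<lambda>i. \<tau> l m n i)))" for n and c :: real
      proof -
        have "h m * E (\<lambda>i. c * (\<tau> l n m i + \<tau> l m n i)) = c * (h m * E (\<lambda>i. \<tau> l n m i) + h m * E (\<lambda>i. \<tau> l m n i))" for m
          unfolding E_cmult E_add by (simp add: distrib_left mult.left_commute)
        then show ?thesis unfolding E_cmult E_add by (simp add: E_cmult E_add distrib_left mult.left_commute)
      qed
      show ?thesis by (subst e) (simp only: E_cmult E_add)
    qed
    also have "E (\<lambda>n. h n * E (\<lambda>m. h m * E (\<lambda>i. \<tau> l m n i))) = ?Z"
    proof -
      have "E (\<lambda>n. h n * E (\<lambda>m. h m * E (\<lambda>i. \<tau> l m n i))) = E (\<lambda>n. E (\<lambda>m. h n * (h m * E (\<lambda>i. \<tau> l m n i))))"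
        by (simp add: E_cmult)
      also have "\<dots> = E (\<lambda>m. E (\<lambda>n. h n * (h m * E (\<lambda>i. \<tau> l m n i))))" by (rule E_swap)
      also have "\<dots> = ?Z" by (simp add: E_cmult mult.left_commute)
      finally show ?thesis .
    qed
    also have "D / \<kappa> * (?Z + ?Z) \<le> D / \<kappa> * (2 * \<epsilon>1)"
    proof (rule mult_left_mono)
      have "h n * E (\<lambda>m. h m * E (\<lambda>i. \<tau> l n m i)) \<le> \<epsilon>1" if n: "n \<in> I" for n
      proof (cases "h n = 1")
        case True
        have "h m * E (\<lambda>i. \<tau> l n m i) \<le> 1 * E (\<lambda>i. \<tau> l n m i)" for m
          by (intro mult_right_mono h01 E_nonneg tau_nonneg)
        then have "E (\<lambda>m. h m * E (\<lambda>i. \<tau> l n m i)) \<le> E (\<lambda>m. E (\<lambda>i. \<tau> l n m i))"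
          by (intro E_mono) simp
        then show ?thesis using E_tau[of l n] tight(1)[OF n True] True by simp
      qed (use h[of n] \<epsilon>1 in auto)
      then have "?Z \<le> \<epsilon>1" by (rule E_le)
      then show "?Z + ?Z \<le> 2 * \<epsilon>1" by simp
    qed (use D_nonneg kappa in auto)
    finally show ?thesis .
  qed
  \<comment> \<open>The factor 48 absorbs up to six errors of size \<open>\<epsilon>1\<close> into
    half of a main term. The lower bounds \<open>\<epsilon>3\<^sup>2 * \<rho> / 8\<close> and
    \<open>\<epsilon>3 * \<rho> / 8\<close> then multiply to
    \<open>\<epsilon>3 ^ 3 * \<rho>\<^sup>2 / 64\<close>, against the upper bound
    \<open>2 * D * \<epsilon>1 / \<kappa>\<close>; this is the origin of 128.\<close>
  have q2: "\<epsilon>3\<^sup>2 \<le> q * q" using q \<epsilon>3 by (simp add: power2_eq_square mult_mono)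
  have "q * q * (t * \<rho>) \<ge> \<epsilon>3\<^sup>2 * (1 / 4 * \<rho>)" using q2 t \<rho> by (intro mult_mono) auto
  then have P1: "\<epsilon>3\<^sup>2 * \<rho> / 8 \<le> P" using T6 \<zeta> \<epsilon>3 by linarith
  have "q * ((1 - t) * \<rho>) \<ge> \<epsilon>3 * (1 / 4 * \<rho>)" using q t \<rho> \<epsilon>3 by (intro mult_mono) auto
  moreover have "\<epsilon>3\<^sup>2 * \<rho> \<le> \<epsilon>3 * \<rho>" using \<epsilon>3 \<rho> by (simp add: power2_eq_square)
  ultimately have P2: "\<epsilon>3 * \<rho> / 8 \<le> q * \<beta> l" using T4 \<zeta> \<epsilon>3 by linarith
  have "q * \<beta> l \<le> \<beta> l" using mult_right_mono[OF q(2) beta_nonneg[of l]] by simp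
  then have "\<epsilon>3\<^sup>2 * \<rho> / 8 * (\<epsilon>3 * \<rho> / 8) \<le> P * \<beta> l"
    using P1 P2 \<epsilon>3 \<rho> by (intro mult_mono) (auto intro: order_trans[OF _ P1])
  then have "\<epsilon>3\<^sup>2 * \<rho> / 8 * (\<epsilon>3 * \<rho> / 8) \<le> D / \<kappa> * (2 * \<epsilon>1)" using T7 by linarith
  then have "\<kappa> * (\<epsilon>3 ^ 3 * \<rho>\<^sup>2) \<le> 128 * D * \<epsilon>1"
    using kappa by (simp add: field_simps power2_eq_square power3_eq_cube)
  then show False using \<epsilon>3 by linarith
qed

lemma pairwise_defect:
  assumes \<epsilon>: "\<And>l. E (\<lambda>n. E (\<lambda>m. E (\<lambda>i. \<tau> l n m i))) \<le> \<epsilon>2"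
  shows "E (\<lambda>n. Fl l n) * \<beta> l \<le> D / \<kappa> * (2 * \<epsilon>2)"
proof -
  let ?Z = "E (\<lambda>n. E (\<lambda>m. E (\<lambda>i. \<tau> l n m i)))"
  have "E (\<lambda>n. Fl l n) * \<beta> l = E (\<lambda>n. E (\<lambda>m. E (\<lambda>i. p l (W n - W m) * p l (W i - X i))))"
    unfolding Fl_def \<beta>_def by (simp add: E_cmult flip: E_mult_right)
  also have "\<dots> \<le> E (\<lambda>n. E (\<lambda>m. E (\<lambda>i. D / \<kappa> * (\<tau> l n m i + \<tau> l m n i))))"
    by (intro E_mono prod_le_tau)
  also have "\<dots> = D / \<kappa> * (?Z + E (\<lambda>n. E (\<lambda>m. E (\<lambda>i. \<tau> l m n i))))"
    by (simp only: E_cmult E_add)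
  also have "E (\<lambda>n. E (\<lambda>m. E (\<lambda>i. \<tau> l m n i))) = ?Z" by (rule E_swap)
  also have "D / \<kappa> * (?Z + ?Z) \<le> D / \<kappa> * (2 * \<epsilon>2)"
    using \<epsilon>[of l] D_nonneg kappa by (intro mult_left_mono) auto
  finally show ?thesis .
qed

text \<open>A small defect forces each coordinate to be almost entirely carried by one of the
  two parts of the splitting; \<open>A\<close> collects the coordinates carried by the differences.\<close>

lemma spectrum:
  assumes \<epsilon>: "\<And>l. E (\<lambda>n. E (\<lambda>m. E (\<lambda>i. \<tau> l n m i))) \<le> \<epsilon>2"
    and H1: "E (\<lambda>n. E (\<lambda>m. \<bar>N (W n - W m) - t * \<rho>\<bar>)) \<le> \<zeta>"
  shows "\<exists>A. \<bar>t * \<rho> - E (\<lambda>n. E (\<lambda>m. \<psi> (\<chi> l. if l \<in> A then p l (X n - X m) else 0)))\<bar>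
    \<le> \<zeta> + 2 * CARD('n) * sqrt (D / \<kappa> * (2 * \<epsilon>2))"
proof -
  define \<alpha> where "\<alpha> l = E (\<lambda>n. Fl l n)" for l
  define e where "e = sqrt (D / \<kappa> * (2 * \<epsilon>2))"
  have \<alpha>0: "0 \<le> \<alpha> l" for l unfolding \<alpha>_def Fl_def by (intro E_nonneg) simp
  define A where "A = {l. \<beta> l \<le> \<alpha> l}"
  have small: "min (\<alpha> l) (\<beta> l) \<le> e" for l
  proof -
    have "(min (\<alpha> l) (\<beta> l))\<^sup>2 \<le> \<alpha> l * \<beta> l"
      unfolding power2_eq_square using \<alpha>0[of l] beta_nonneg[of l] by (intro mult_mono) auto
    also have "\<dots> \<le> D / \<kappa> * (2 * \<epsilon>2)" unfolding \<alpha>_def by (rule pairwise_defect[OF \<epsilon>])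
    finally show ?thesis unfolding e_def by (rule real_le_rsqrt)
  qed
  let ?pA = "\<lambda>n m. \<chi> l. if l \<in> A then p l (X n - X m) else 0"
  \<comment> \<open>On \<open>A\<close> the differences of \<open>W\<close> are compared with those
    of \<open>X\<close>, at the cost of two terms of mean \<open>\<beta> l\<close>; off
    \<open>A\<close> they are compared with zero.\<close>
  define d where "d n m l = (if l \<in> A then p l (W n - X n) + p l (W m - X m) else p l (W n - W m))" for n m l
  have "\<bar>N (W n - W m) - \<psi> (?pA n m)\<bar> \<le> (\<Sum>l\<in>UNIV. d n m l)" for n m
  proof -
    have "\<bar>N (W n - W m) - \<psi> (?pA n m)\<bar> \<le> (\<Sum>l\<in>UNIV. \<bar>p l (W n - W m) - (if l \<in> A then p l (X n - X m) else 0)\<bar>)"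
      using psi_diff_le[of "pv (W n - W m)" "?pA n m"] by (simp add: N_def)
    also have "\<dots> \<le> (\<Sum>l\<in>UNIV. d n m l)"
    proof (rule sum_mono)
      fix l
      interpret P: seminorm "p l" by (rule sp)
      have "p l ((W n - W m) - (X n - X m)) = p l ((W n - X n) - (W m - X m))"
        by (rule arg_cong[of _ _ "p l"]) simp
      then have "\<bar>p l (W n - W m) - p l (X n - X m)\<bar> \<le> p l (W n - X n) + p l (W m - X m)"
        using P.abs_diff_le[of "W n - W m" "X n - X m"] P.diff_le[of "W n - X n" "W m - X m"] by linarith
      then show "\<bar>p l (W n - W m) - (if l \<in> A then p l (X n - X m) else 0)\<bar> \<le> d n m l"
        by (simp add: d_def)
    qed
    finally show ?thesis .
  qed
  then have "E (\<lambda>n. E (\<lambda>m. \<bar>N (W n - W m) - \<psi> (?pA n m)\<bar>)) \<le> E (\<lambda>n. E (\<lambda>m. \<Sum>l\<in>UNIV. d n m l))"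
    by (intro E_mono)
  also have "\<dots> = (\<Sum>l\<in>UNIV. E (\<lambda>n. E (\<lambda>m. d n m l)))" by (simp add: E_sum)
  also have "\<dots> \<le> (\<Sum>l\<in>(UNIV :: 'n set). 2 * e)"
  proof (rule sum_mono)
    fix l
    show "E (\<lambda>n. E (\<lambda>m. d n m l)) \<le> 2 * e"
    proof (cases "l \<in> A")
      case True
      then have "E (\<lambda>n. E (\<lambda>m. d n m l)) = \<beta> l + \<beta> l" by (simp add: d_def E_add E_const \<beta>_def)
      then show ?thesis using True small[of l] by (simp add: A_def)
    next
      case False
      then have "E (\<lambda>n. E (\<lambda>m. d n m l)) = \<alpha> l" by (simp add: d_def \<alpha>_def Fl_def)
      then show ?thesis using False small[of l] \<alpha>0[of l] by (simp add: A_def)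
    qed
  qed
  finally have 1: "E (\<lambda>n. E (\<lambda>m. \<bar>N (W n - W m) - \<psi> (?pA n m)\<bar>)) \<le> 2 * CARD('n) * e" by simp
  have "\<bar>t * \<rho> - E (\<lambda>n. E (\<lambda>m. \<psi> (?pA n m)))\<bar> = \<bar>E (\<lambda>n. E (\<lambda>m. t * \<rho> - \<psi> (?pA n m)))\<bar>"
    by (simp add: E_diff E_const)
  also have "\<dots> \<le> E (\<lambda>n. E (\<lambda>m. \<bar>t * \<rho> - \<psi> (?pA n m)\<bar>))"
    by (rule order_trans[OF E_abs]) (intro E_mono E_abs)
  also have "\<dots> \<le> E (\<lambda>n. E (\<lambda>m. \<bar>N (W n - W m) - t * \<rho>\<bar> + \<bar>N (W n - W m) - \<psi> (?pA n m)\<bar>))"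
    by (intro E_mono) linarith
  also have "\<dots> \<le> \<zeta> + 2 * CARD('n) * e" using H1 1 by (simp add: E_add)
  finally show ?thesis unfolding e_def by blast
qed

text \<open>The vector \<open>v n\<close> of summed means dominates the vector \<open>u n\<close> of
  seminorms of \<open>W n - Xbar\<close>, and on average their norms differ by at most
  \<open>3 * \<zeta>\<close>. Outside a set that is small by Markov's inequality,
  \<open>flat\<close> applies: either all coordinate defects are small, or one coordinate carries
  the norm, which \<open>tight_small\<close> makes rare.\<close>

lemma defect_small:
  assumes flat: "\<And>u v :: real^'n. (\<And>l. 0 \<le> u $ l) \<Longrightarrow> (\<And>l. u $ l \<le> v $ l) \<Longrightarrow> \<psi> v \<le> 2 * D \<Longrightarrow>
      \<psi> v - \<psi> u \<le> \<eta>1 \<Longrightarrow> (\<forall>l. v $ l - u $ l \<le> \<epsilon>1) \<or> (\<exists>l. v $ l - u $ l \<le> \<epsilon>1 \<and> \<psi> v - \<epsilon>1 \<le> u $ l)"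
    and \<eta>1: "0 < \<eta>1"
    and H1: "E (\<lambda>n. E (\<lambda>m. \<bar>N (W n - W m) - t * \<rho>\<bar>)) \<le> \<zeta>"
    and H2: "E (\<lambda>n. N (W n - X n)) \<le> (1 - t) * \<rho> + \<zeta>"
    and H3: "\<rho> - \<zeta> \<le> E (\<lambda>n. N (W n - Xbar))"
    and t: "1 / 4 \<le> t" "t \<le> 3 / 4" and \<rho>: "0 < \<rho>" and \<zeta>: "0 \<le> \<zeta>" "\<zeta> \<le> \<epsilon>1"
    and \<epsilon>3: "0 < \<epsilon>3" "\<epsilon>3 \<le> 1" "48 * \<epsilon>1 \<le> \<epsilon>3\<^sup>2 * \<rho>" "128 * D * \<epsilon>1 < \<kappa> * (\<epsilon>3 ^ 3 * \<rho>\<^sup>2)"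
  shows "E (\<lambda>n. E (\<lambda>m. E (\<lambda>i. \<tau> l n m i))) \<le> \<epsilon>1 + 2 * D * (3 * \<zeta> / \<eta>1 + real CARD('n) * \<epsilon>3)"
proof -
  define s where "s = E (\<lambda>n. N (W n - X n))"
  define F where "F n = E (\<lambda>m. N (W n - W m))" for n
  define u where "u n = pv (W n - Xbar)" for n
  define v where "v n = (\<chi> l. Fl l n + \<beta> l)" for n
  have u0: "0 \<le> u n $ l" for n l by (simp add: u_def)
  have uv: "u n $ l \<le> v n $ l" for n l
  proof -
    have "0 \<le> E (\<lambda>m. E (\<lambda>i. \<tau> l n m i))" by (intro E_nonneg tau_nonneg)
    then show ?thesis using E_tau[of l n] by (simp add: u_def v_def)
  qed
  have FD: "F n \<le> D" if "n \<in> I" for n unfolding F_def using WW that by (intro E_le)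
  have sD: "s \<le> D" unfolding s_def using WX by (intro E_le)
  have vF: "\<psi> (v n) \<le> F n + s" for n
  proof -
    have "v n = (\<Sum>m\<in>I. w m *\<^sub>R pv (W n - W m)) + (\<Sum>i\<in>I. w i *\<^sub>R pv (W i - X i))"
      by (simp add: vec_eq_iff v_def Fl_def \<beta>_def E_def)
    then have "\<psi> (v n) \<le> \<psi> (\<Sum>m\<in>I. w m *\<^sub>R pv (W n - W m)) + \<psi> (\<Sum>i\<in>I. w i *\<^sub>R pv (W i - X i))"
      by (simp add: psi_triangle)
    also have "\<dots> \<le> F n + s" unfolding F_def s_def N_def
      by (intro add_mono E_seminorm seminorm_psi)
    finally show ?thesis .
  qed
  have v2D: "\<psi> (v n) \<le> 2 * D" if "n \<in> I" for n using vF[of n] FD[OF that] sD by linarith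
  have Nu: "N (W n - Xbar) = \<psi> (u n)" for n by (simp add: N_def u_def)
  have EF: "E F \<le> t * \<rho> + \<zeta>"
  proof -
    have "E F - t * \<rho> = E (\<lambda>n. E (\<lambda>m. N (W n - W m) - t * \<rho>))"
      unfolding F_def[abs_def] by (simp add: E_diff E_const)
    also have "\<dots> \<le> E (\<lambda>n. E (\<lambda>m. \<bar>N (W n - W m) - t * \<rho>\<bar>))" by (intro E_mono) simp
    finally show ?thesis using H1 by linarith
  qed
  have gap0: "0 \<le> \<psi> (v n) - \<psi> (u n)" for n using psi_mono[OF u0 uv] by simp
  have gap: "E (\<lambda>n. \<psi> (v n) - \<psi> (u n)) \<le> 3 * \<zeta>"
  proof -
    have "E (\<lambda>n. \<psi> (v n)) \<le> E (\<lambda>n. F n + s)" by (intro E_mono vF)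
    also have "\<dots> \<le> \<rho> + 2 * \<zeta>" using EF H2 by (simp add: E_add E_const s_def algebra_simps)
    finally show ?thesis using H3 by (simp add: E_diff Nu)
  qed
  define bad where "bad n = (if \<psi> (v n) - \<psi> (u n) \<le> \<eta>1 then 0 else 1 :: real)" for n
  have "E (\<lambda>n. \<eta>1 * bad n) \<le> E (\<lambda>n. \<psi> (v n) - \<psi> (u n))"
    by (intro E_mono) (use gap0 in \<open>auto simp: bad_def\<close>)
  then have bad: "E bad \<le> 3 * \<zeta> / \<eta>1" using gap \<eta>1 by (simp add: E_cmult field_simps)
  define h where "h l n = (if v n $ l - u n $ l \<le> \<epsilon>1 \<and> \<psi> (v n) - \<epsilon>1 \<le> u n $ l then 1 else 0 :: real)" for l n
  have hs: "E (h l) \<le> \<epsilon>3" for l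
  proof (rule tight_small[OF _ _ _ H1 H2 H3 t \<rho> \<zeta> \<epsilon>3])
    show "h l n = 0 \<or> h l n = 1" for n by (simp add: h_def)
    fix n assume "h l n = 1"
    then have *: "v n $ l - u n $ l \<le> \<epsilon>1" "\<psi> (v n) - \<epsilon>1 \<le> u n $ l" by (auto simp: h_def split: if_splits)
    show "Fl l n + \<beta> l - p l (W n - Xbar) \<le> \<epsilon>1" using *(1) by (simp add: u_def v_def)
    show "N (W n - Xbar) \<le> p l (W n - Xbar) + \<epsilon>1" using *(2) gap0[of n] unfolding Nu by (simp add: u_def)
  qed
  have key: "v n $ l - u n $ l \<le> \<epsilon>1 + 2 * D * (bad n + (\<Sum>j\<in>UNIV. h j n))" if n: "n \<in> I" for n l
  proof -
    have h0: "0 \<le> h j n" for j by (simp add: h_def)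
    have sum0: "0 \<le> (\<Sum>j\<in>UNIV. h j n)" by (intro sum_nonneg h0)
    have D0: "0 \<le> 2 * D" using D_nonneg by simp
    have vl: "v n $ l - u n $ l \<le> 2 * D"
      using psi_ge_component[of "v n" l] v2D[OF n] u0[of n l] by linarith
    have e0: "0 \<le> \<epsilon>1" using \<zeta> by linarith
    have big: "v n $ l - u n $ l \<le> \<epsilon>1 + 2 * D * (bad n + (\<Sum>j\<in>UNIV. h j n))"
      if "1 \<le> bad n + (\<Sum>j\<in>UNIV. h j n)"
      using mult_left_mono[OF that D0] vl e0 by linarith
    consider "bad n = 1" | j where "h j n = 1" | "v n $ l - u n $ l \<le> \<epsilon>1"
    proof (cases "\<psi> (v n) - \<psi> (u n) \<le> \<eta>1")
      case True
      from flat[OF u0 uv v2D[OF n] True] show ?thesis using that(2,3) unfolding h_def by metis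
    next
      case False
      then show ?thesis using that(1) by (simp add: bad_def)
    qed
    then show ?thesis
    proof cases
      case 1
      then show ?thesis using big sum0 by simp
    next
      case (2 j)
      then have "1 \<le> (\<Sum>j\<in>UNIV. h j n)" using member_le_sum[of j UNIV "\<lambda>j. h j n"] h0 by simp
      then show ?thesis using big by (auto simp: bad_def)
    next
      case 3
      have "0 \<le> 2 * D * (bad n + (\<Sum>j\<in>UNIV. h j n))" using D0 sum0 by (auto simp: bad_def)
      then show ?thesis using 3 by linarith
    qed
  qed
  have "E (\<lambda>n. E (\<lambda>m. E (\<lambda>i. \<tau> l n m i))) \<le> E (\<lambda>n. \<epsilon>1 + 2 * D * (bad n + (\<Sum>j\<in>UNIV. h j n)))"
  proof (rule E_mono)
    fix n assume n: "n \<in> I"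
    show "E (\<lambda>m. E (\<lambda>i. \<tau> l n m i)) \<le> \<epsilon>1 + 2 * D * (bad n + (\<Sum>j\<in>UNIV. h j n))"
      using E_tau[of l n] key[OF n, of l] by (simp add: u_def v_def)
  qed
  also have "\<dots> = \<epsilon>1 + 2 * D * (E bad + (\<Sum>j\<in>UNIV. E (h j)))"
    by (simp add: E_add E_const E_cmult E_sum)
  also have "\<dots> \<le> \<epsilon>1 + 2 * D * (3 * \<zeta> / \<eta>1 + real CARD('n) * \<epsilon>3)"
  proof -
    have "(\<Sum>j\<in>(UNIV :: 'n set). E (h j)) \<le> real CARD('n) * \<epsilon>3"
      using sum_mono[of UNIV "\<lambda>j. E (h j)" "\<lambda>_. \<epsilon>3"] hs by simp
    then have "2 * D * (E bad + (\<Sum>j\<in>UNIV. E (h j))) \<le> 2 * D * (3 * \<zeta> / \<eta>1 + real CARD('n) * \<epsilon>3)"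
      using bad D_nonneg by (intro mult_left_mono) auto
    then show ?thesis by simp
  qed
  finally show ?thesis .
qed

end

text \<open>For a strictly monotone norm the first alternative always holds; the second one covers the
  axis-parallel segments of the unit sphere in the plane.\<close>

locale flat_space = sum_space \<psi> V p \<kappa>
  for \<psi> :: "real^'n::finite \<Rightarrow> real" and V :: "'v::real_vector set" and p \<kappa> +
  assumes flat: "0 < \<epsilon> \<Longrightarrow> \<exists>\<eta>>0. \<forall>u v. (\<forall>l. 0 \<le> u $ l \<and> u $ l \<le> v $ l) \<and> \<psi> v \<le> B \<and> \<psi> v - \<psi> u \<le> \<eta> \<longrightarrow>
    (\<forall>l. v $ l - u $ l \<le> \<epsilon>) \<or> (\<exists>l. v $ l - u $ l \<le> \<epsilon> \<and> \<psi> v - \<epsilon> \<le> u $ l)"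
begin

text \<open>The number \<open>\<eta>\<close> must not depend on the points, the weights or
  \<open>t\<close>, since all of these are constructed only after it is fixed. The indices are pairs
  of an orbit window and a time.\<close>

lemma spectral_gap:
  assumes \<epsilon>: "0 < \<epsilon>" and \<rho>: "0 < \<rho>" and D: "0 < D"
  shows "\<exists>\<eta>>0. \<eta> < \<rho> \<and> (\<forall>(I :: (nat \<times> nat) set) w W X t. config \<psi> V p \<kappa> I w W X D \<and> 1 / 4 \<le> t \<and> t \<le> 3 / 4 \<and>
    weights.E I w (\<lambda>n. weights.E I w (\<lambda>m. (N (W n - W m))\<^sup>2)) \<le> (t * \<rho> + \<eta>)\<^sup>2 \<and>
    weights.E I w (\<lambda>n. (N (W n - X n))\<^sup>2) \<le> ((1 - t) * \<rho> + \<eta>)\<^sup>2 \<and>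
    (\<rho> - \<eta>)\<^sup>2 \<le> weights.E I w (\<lambda>n. (N (W n - (\<Sum>i\<in>I. w i *\<^sub>R X i)))\<^sup>2) \<longrightarrow>
    (\<exists>A. \<bar>t * \<rho> - weights.E I w (\<lambda>n. weights.E I w (\<lambda>m. \<psi> (\<chi> l. if l \<in> A then p l (X n - X m) else 0)))\<bar> \<le> \<epsilon>))"
proof -
  define r where "r = real CARD('n)"
  have r: "0 < r" by (simp add: r_def)
  \<comment> \<open>The constants are fixed backwards: \<open>\<epsilon>2\<close> turns the last
    error term of \<open>spectrum\<close> into \<open>\<epsilon> / 2\<close>, and then
    \<open>\<epsilon>3\<close>, \<open>\<epsilon>1\<close> and \<open>\<zeta>\<close> each
    contribute at most a third of \<open>\<epsilon>2\<close> to the bound of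
    \<open>defect_small\<close>.\<close>
  define \<epsilon>2 where "\<epsilon>2 = \<kappa> * (\<epsilon> / (4 * r))\<^sup>2 / (2 * D)"
  have \<epsilon>2: "0 < \<epsilon>2" using \<epsilon> r D kappa by (simp add: \<epsilon>2_def)
  have sq: "sqrt (D / \<kappa> * (2 * \<epsilon>2)) = \<epsilon> / (4 * r)"
  proof -
    have "D / \<kappa> * (2 * \<epsilon>2) = (\<epsilon> / (4 * r))\<^sup>2" using D kappa by (simp add: \<epsilon>2_def)
    then show ?thesis using \<epsilon> r by simp
  qed
  define \<epsilon>3 where "\<epsilon>3 = min 1 (\<epsilon>2 / (6 * r * D))"
  have \<epsilon>3: "0 < \<epsilon>3" "\<epsilon>3 \<le> 1" "6 * r * D * \<epsilon>3 \<le> \<epsilon>2"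
    using \<epsilon>2 r D by (auto simp: \<epsilon>3_def min_def field_simps)
  define \<epsilon>1 where "\<epsilon>1 = min (\<epsilon>2 / 3) (min (\<epsilon>3\<^sup>2 * \<rho> / 48) (\<kappa> * (\<epsilon>3 ^ 3 * \<rho>\<^sup>2) / (256 * D)))"
  have \<epsilon>1: "0 < \<epsilon>1" "\<epsilon>1 \<le> \<epsilon>2 / 3" "48 * \<epsilon>1 \<le> \<epsilon>3\<^sup>2 * \<rho>"
    using \<epsilon>2 \<epsilon>3 \<rho> kappa D by (auto simp: \<epsilon>1_def)
  have \<epsilon>1': "128 * D * \<epsilon>1 < \<kappa> * (\<epsilon>3 ^ 3 * \<rho>\<^sup>2)"
  proof -
    have "\<epsilon>1 \<le> \<kappa> * (\<epsilon>3 ^ 3 * \<rho>\<^sup>2) / (256 * D)" by (simp add: \<epsilon>1_def)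
    then have "256 * D * \<epsilon>1 \<le> \<kappa> * (\<epsilon>3 ^ 3 * \<rho>\<^sup>2)" using D by (simp add: field_simps)
    moreover have "0 < D * \<epsilon>1" using D \<epsilon>1 by simp
    ultimately show ?thesis by linarith
  qed
  from flat[OF \<epsilon>1(1), of "2 * D"] obtain \<eta>1 where \<eta>1: "0 < \<eta>1" "\<And>u v. (\<forall>l. 0 \<le> u $ l \<and> u $ l \<le> v $ l) \<and> \<psi> v \<le> 2 * D \<and> \<psi> v - \<psi> u \<le> \<eta>1 \<Longrightarrow>
    (\<forall>l. v $ l - u $ l \<le> \<epsilon>1) \<or> (\<exists>l. v $ l - u $ l \<le> \<epsilon>1 \<and> \<psi> v - \<epsilon>1 \<le> u $ l)" by blast
  define \<zeta> where "\<zeta> = min (\<epsilon> / 2) (min \<epsilon>1 (\<eta>1 * \<epsilon>2 / (18 * D)))"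
  have \<zeta>: "0 < \<zeta>" "\<zeta> \<le> \<epsilon> / 2" "\<zeta> \<le> \<epsilon>1" using \<epsilon> \<epsilon>1 \<eta>1 \<epsilon>2 D by (auto simp: \<zeta>_def)
  have \<zeta>': "6 * D * \<zeta> / \<eta>1 \<le> \<epsilon>2 / 3"
  proof -
    have "\<zeta> \<le> \<eta>1 * \<epsilon>2 / (18 * D)" by (simp add: \<zeta>_def)
    then show ?thesis using D \<eta>1 by (simp add: field_simps)
  qed
  have "((\<lambda>\<eta>. 3 * sqrt (6 * \<rho> * \<eta>) + 5 * \<eta> + 4 * D * sqrt (6 * \<rho> * \<eta>) / \<rho>) \<longlongrightarrow>
      3 * sqrt (6 * \<rho> * 0) + 5 * 0 + 4 * D * sqrt (6 * \<rho> * 0) / \<rho>) (at_right 0)"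
    by (intro tendsto_intros) (use \<rho> in auto)
  then have "\<forall>\<^sub>F \<eta> in at_right 0. 3 * sqrt (6 * \<rho> * \<eta>) + 5 * \<eta> + 4 * D * sqrt (6 * \<rho> * \<eta>) / \<rho> < \<zeta>"
    by (rule order_tendstoD(2)) (use \<zeta> in simp)
  moreover have "\<forall>\<^sub>F \<eta> in at_right 0. \<eta> < \<rho> / 8"
    by (rule order_tendstoD(2)[OF tendsto_ident_at]) (use \<rho> in simp)
  moreover have "\<forall>\<^sub>F \<eta> in at_right 0. (0::real) < \<eta>" by (rule eventually_at_right_less)
  ultimately have "\<forall>\<^sub>F \<eta> in at_right 0. 3 * sqrt (6 * \<rho> * \<eta>) + 5 * \<eta> + 4 * D * sqrt (6 * \<rho> * \<eta>) / \<rho> < \<zeta> \<and> \<eta> < \<rho> / 8 \<and> 0 < \<eta>"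
    by eventually_elim simp
  then obtain \<eta> where \<eta>: "3 * sqrt (6 * \<rho> * \<eta>) + 5 * \<eta> + 4 * D * sqrt (6 * \<rho> * \<eta>) / \<rho> < \<zeta>" "\<eta> < \<rho> / 8" "0 < \<eta>"
    using eventually_happens'[OF trivial_limit_at_right_real] by blast
  show ?thesis
  proof (intro exI[of _ \<eta>] conjI \<eta>(3) allI impI, use \<eta> in simp, elim conjE)
    fix I :: "(nat \<times> nat) set" and w W X and t :: real
    assume cfg: "config \<psi> V p \<kappa> I w W X D" and t: "1 / 4 \<le> t" "t \<le> 3 / 4"
    interpret config \<psi> V p \<kappa> I w W X D by (rule cfg)
    assume a: "E (\<lambda>n. E (\<lambda>m. (N (W n - W m))\<^sup>2)) \<le> (t * \<rho> + \<eta>)\<^sup>2"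
      "E (\<lambda>n. (N (W n - X n))\<^sup>2) \<le> ((1 - t) * \<rho> + \<eta>)\<^sup>2"
      "(\<rho> - \<eta>)\<^sup>2 \<le> E (\<lambda>n. (N (W n - (\<Sum>i\<in>I. w i *\<^sub>R X i)))\<^sup>2)"
    have "1 / 4 * \<rho> \<le> t * \<rho>" using t(1) \<rho> by (intro mult_right_mono) auto
    then have tr: "2 * \<eta> \<le> t * \<rho>" using \<eta>(2) by linarith
    have N0: "0 \<le> N x" for x by (rule seminorm.nonneg[OF seminorm_N])
    have sym: "N (W n - W m) = N (W m - W n)" for n m by (rule seminorm.minus_commute[OF seminorm_N])
    have "E (\<lambda>m. N (W n - W m)) \<le> D" if "n \<in> I" for n by (rule E_le) (rule WW[OF that])
    moreover have "E (\<lambda>i. N (W i - X i)) \<le> D" by (rule E_le) (rule WX)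
    ultimately have GD: "N (W n - Xbar) \<le> 2 * D" if "n \<in> I" for n
      using N_W_Xbar[of n] that by fastforce
    have le: "0 \<le> t" "t \<le> 1" "0 \<le> \<eta>" "4 * \<eta> \<le> \<rho>" "0 \<le> D" using t \<eta> \<rho> D by auto
    let ?z = "3 * sqrt (6 * \<rho> * \<eta>) + 5 * \<eta> + 4 * D * sqrt (6 * \<rho> * \<eta>) / \<rho>"
    note q = quadratic_rigidity[of "\<lambda>n m. N (W n - W m)" "\<lambda>n. N (W n - X n)" "\<lambda>n. N (W n - Xbar)",
        OF N0 sym N0 N0 N_W_Xbar GD le(1-3) tr le(4) \<rho> a(1) a(2) a(3)[folded Xbar_def] refl refl le(5)]
    have H1: "E (\<lambda>n. E (\<lambda>m. \<bar>N (W n - W m) - t * \<rho>\<bar>)) \<le> \<zeta>"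
      and H2: "E (\<lambda>n. N (W n - X n)) \<le> (1 - t) * \<rho> + \<zeta>" and H3: "\<rho> - \<zeta> \<le> E (\<lambda>n. N (W n - Xbar))"
      using q \<eta>(1) by linarith+
    have "E (\<lambda>n. E (\<lambda>m. E (\<lambda>i. \<tau> l n m i))) \<le> \<epsilon>2" for l
    proof -
      have "E (\<lambda>n. E (\<lambda>m. E (\<lambda>i. \<tau> l n m i))) \<le> \<epsilon>1 + 2 * D * (3 * \<zeta> / \<eta>1 + real CARD('n) * \<epsilon>3)"
        by (rule defect_small[OF _ \<eta>1(1) H1 H2 H3 t \<rho> _ \<zeta>(3) \<epsilon>3(1,2) \<epsilon>1(3) \<epsilon>1'])
           (use \<eta>1(2) \<zeta>(1) in auto)
      also have "\<dots> = \<epsilon>1 + 6 * D * \<zeta> / \<eta>1 + 6 * r * D * \<epsilon>3 / 3" by (simp add: r_def algebra_simps)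
      also have "\<dots> \<le> \<epsilon>2" using \<zeta>' \<epsilon>1(2) \<epsilon>3(3) by linarith
      finally show ?thesis .
    qed
    from spectrum[OF this H1] obtain A where
      "\<bar>t * \<rho> - E (\<lambda>n. E (\<lambda>m. \<psi> (\<chi> l. if l \<in> A then p l (X n - X m) else 0)))\<bar> \<le> \<zeta> + 2 * real CARD('n) * (\<epsilon> / (4 * r))"
      unfolding sq by auto
    moreover have "2 * real CARD('n) * (\<epsilon> / (4 * r)) = \<epsilon> / 2" using r by (simp add: r_def)
    ultimately show "\<exists>A. \<bar>t * \<rho> - E (\<lambda>n. E (\<lambda>m. \<psi> (\<chi> l. if l \<in> A then p l (X n - X m) else 0)))\<bar> \<le> \<epsilon>"
      using \<zeta>(2) by (intro exI[of _ A]) linarith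
  qed
qed

end

section \<open>Orbits of asymptotically nonexpansive maps\<close>


locale asymp_map = sum_space \<psi> V p \<kappa>
  for \<psi> :: "real^'n::finite \<Rightarrow> real" and V :: "'v::real_vector set" and p \<kappa> +
  fixes C :: "'v set" and T :: "'v \<Rightarrow> 'v" and B :: real
  assumes C_ne: "C \<noteq> {}" and C_sub: "C \<subseteq> V" and C_bound: "x \<in> C \<Longrightarrow> N x \<le> B" and C_convex: "convex C"
    and TC: "T ` C \<subseteq> C"
    and asymp: "0 < e \<Longrightarrow> \<exists>n0. \<forall>n\<ge>n0. \<forall>x\<in>C. \<forall>y\<in>C. N ((T ^^ n) x - (T ^^ n) y) \<le> N (x - y) + e"
begin

sublocale N: seminorm N by (rule seminorm_N)

definition Q :: "nat \<Rightarrow> 'v \<Rightarrow> 'v \<Rightarrow> real" where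
  "Q M w y = (\<Sum>m\<in>{M..<2 * M}. (N ((T ^^ m) w - y))\<^sup>2) / M"

text \<open>Almost invariant convex sublevel sets replace the minimal invariant sets of the classical
  argument, and \<open>att h r\<close> says that some orbits in the sublevel set stay close
  to one of its points, at squared distance below \<open>r\<close> on average over the window from
  \<open>M\<close> to \<open>2 M\<close>.\<close>

definition inv_fun :: "('v \<Rightarrow> real) \<Rightarrow> bool" where
  "inv_fun h \<longleftrightarrow> convex_on C h \<and> (\<forall>e>0. \<exists>n0. \<forall>n\<ge>n0. \<forall>y\<in>C. h ((T ^^ n) y) \<le> h y + e) \<and> (\<exists>y\<in>C. h y < 0)"

definition S :: "('v \<Rightarrow> real) \<Rightarrow> 'v set" where "S h = {y \<in> C. h y < 0}"

definition att :: "('v \<Rightarrow> real) \<Rightarrow> real \<Rightarrow> bool" where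
  "att h r \<longleftrightarrow> (\<exists>z\<in>S h. \<exists>M0. \<forall>M\<ge>M0. \<exists>w\<in>S h. Q M w z < r)"

lemma iter_in: "x \<in> C \<Longrightarrow> (T ^^ n) x \<in> C"
  using TC by (induction n) auto

lemma N_diff: "x \<in> C \<Longrightarrow> y \<in> C \<Longrightarrow> N (x - y) \<le> 2 * B"
  using N.diff_le[of x y] C_bound[of x] C_bound[of y] by linarith

lemma B_nonneg: "0 \<le> B"
  using C_ne C_bound N.nonneg order_trans by blast

lemma Q_nonneg: "0 \<le> Q M w y"
  unfolding Q_def by (intro divide_nonneg_nonneg sum_nonneg) auto

lemma N2_le: "x \<in> C \<Longrightarrow> y \<in> C \<Longrightarrow> (N (x - y))\<^sup>2 \<le> (2 * B)\<^sup>2"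
  by (intro power_mono N_diff) auto

lemma Q_le: assumes "w \<in> C" "y \<in> C" shows "Q M w y \<le> (2 * B)\<^sup>2"
proof (cases "M = 0")
  case False
  have "(\<Sum>m\<in>{M..<2 * M}. (N ((T ^^ m) w - y))\<^sup>2) \<le> (\<Sum>m\<in>{M..<2 * M}. (2 * B)\<^sup>2)"
    by (intro sum_mono N2_le iter_in assms)
  then show ?thesis using False by (simp add: Q_def field_simps)
qed (simp add: Q_def)

lemma S_sub: "S h \<subseteq> C" by (auto simp: S_def)

lemma convex_S: "inv_fun h \<Longrightarrow> convex (S h)"
  unfolding S_def inv_fun_def by (intro convex_on_sublevel) auto

lemma square_convex: "convex_on C (\<lambda>y. (N (x - y))\<^sup>2)"
proof (rule convex_onI)
  fix t u v assume t: "0 < (t::real)" "t < 1" and uv: "u \<in> C" "v \<in> C"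
  let ?a = "N (x - u)" and ?b = "N (x - v)"
  have "N (x - ((1 - t) *\<^sub>R u + t *\<^sub>R v)) \<le> (1 - t) * ?a + t * ?b"
    using convex_onD[OF N.convex_on[OF C_convex, of x], of t u v] t uv by simp
  then have "(N (x - ((1 - t) *\<^sub>R u + t *\<^sub>R v)))\<^sup>2 \<le> ((1 - t) * ?a + t * ?b)\<^sup>2"
    by (intro power_mono) auto
  also have "\<dots> = (1 - t) * ?a\<^sup>2 + t * ?b\<^sup>2 - t * (1 - t) * (?a - ?b)\<^sup>2"
    by (simp add: power2_eq_square algebra_simps)
  also have "\<dots> \<le> (1 - t) * ?a\<^sup>2 + t * ?b\<^sup>2" using t by simp
  finally show "(N (x - ((1 - t) *\<^sub>R u + t *\<^sub>R v)))\<^sup>2 \<le> (1 - t) * ?a\<^sup>2 + t * ?b\<^sup>2" .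
qed (rule C_convex)

lemma Q_convex_on: "convex_on C (Q M w)"
proof (rule convex_onI)
  fix t u v assume t: "0 < (t::real)" "t < 1" and uv: "u \<in> C" "v \<in> C"
  have "(\<Sum>m\<in>{M..<2 * M}. (N ((T ^^ m) w - ((1 - t) *\<^sub>R u + t *\<^sub>R v)))\<^sup>2)
    \<le> (\<Sum>m\<in>{M..<2 * M}. (1 - t) * (N ((T ^^ m) w - u))\<^sup>2 + t * (N ((T ^^ m) w - v))\<^sup>2)"
    using convex_onD[OF square_convex, of t u v] t uv by (intro sum_mono) auto
  also have "\<dots> = (1 - t) * (\<Sum>m\<in>{M..<2 * M}. (N ((T ^^ m) w - u))\<^sup>2) + t * (\<Sum>m\<in>{M..<2 * M}. (N ((T ^^ m) w - v))\<^sup>2)"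
    by (simp add: sum.distrib sum_distrib_left)
  finally have "Q M w ((1 - t) *\<^sub>R u + t *\<^sub>R v) \<le> ((1 - t) * (\<Sum>m\<in>{M..<2 * M}. (N ((T ^^ m) w - u))\<^sup>2) + t * (\<Sum>m\<in>{M..<2 * M}. (N ((T ^^ m) w - v))\<^sup>2)) / M"
    unfolding Q_def by (rule divide_right_mono) simp
  then show "Q M w ((1 - t) *\<^sub>R u + t *\<^sub>R v) \<le> (1 - t) * Q M w u + t * Q M w v"
    unfolding Q_def by (simp add: add_divide_distrib)
qed (rule C_convex)

text \<open>A late orbit point is the image under the \<open>j\<close>-th power of the point
  \<open>j\<close> steps earlier, so distances grow by at most \<open>e\<close>. Shifting the window
  back brings in at most \<open>j\<close> new terms, each at most
  \<open>(2 * B)\<^sup>2\<close>.\<close>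

lemma Q_iter:
  assumes w: "w \<in> C" and y: "y \<in> C" and e: "0 < e" and j: "\<forall>x\<in>C. \<forall>y\<in>C. N ((T ^^ j) x - (T ^^ j) y) \<le> N (x - y) + e"
    and M: "j \<le> M" "0 < M"
  shows "Q M w ((T ^^ j) y) \<le> Q M w y + (4 * B * e + e\<^sup>2) + j * (2 * B)\<^sup>2 / M"
proof -
  let ?f = "\<lambda>m. (N ((T ^^ m) w - y))\<^sup>2"
  have f0: "0 \<le> ?f m" for m by simp
  have "(\<Sum>m\<in>{M..<2 * M}. (N ((T ^^ m) w - (T ^^ j) y))\<^sup>2) \<le> (\<Sum>m\<in>{M..<2 * M}. ?f (m - j) + (4 * B * e + e\<^sup>2))"
  proof (rule sum_mono)
    fix m assume m: "m \<in> {M..<2 * M}"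
    have "(T ^^ m) w = (T ^^ j) ((T ^^ (m - j)) w)"
      using m M funpow_add[of j "m - j" T] by simp
    then have "N ((T ^^ m) w - (T ^^ j) y) \<le> N ((T ^^ (m - j)) w - y) + e" using j iter_in[OF w] y by simp
    then have "(N ((T ^^ m) w - (T ^^ j) y))\<^sup>2 \<le> (N ((T ^^ (m - j)) w - y) + e)\<^sup>2" by (intro power_mono) auto
    also have "\<dots> = ?f (m - j) + 2 * N ((T ^^ (m - j)) w - y) * e + e\<^sup>2" by (simp add: power2_sum)
    also have "2 * N ((T ^^ (m - j)) w - y) * e \<le> 2 * (2 * B) * e"
      using N_diff[OF iter_in[OF w] y] e by (intro mult_right_mono mult_left_mono) auto
    finally show "(N ((T ^^ m) w - (T ^^ j) y))\<^sup>2 \<le> ?f (m - j) + (4 * B * e + e\<^sup>2)" by simp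
  qed
  also have "\<dots> = (\<Sum>m\<in>{M..<2 * M}. ?f (m - j)) + M * (4 * B * e + e\<^sup>2)" by (simp add: sum.distrib)
  also have "(\<Sum>m\<in>{M..<2 * M}. ?f (m - j)) = (\<Sum>m\<in>{M - j..<2 * M - j}. ?f m)"
    by (rule sum.reindex_bij_witness[of _ "\<lambda>m. m + j" "\<lambda>m. m - j"]) (use M in auto)
  also have "\<dots> \<le> (\<Sum>m\<in>{M - j..<M} \<union> {M..<2 * M}. ?f m)"
    by (rule sum_mono2) auto
  also have "\<dots> = (\<Sum>m\<in>{M - j..<M}. ?f m) + (\<Sum>m\<in>{M..<2 * M}. ?f m)"
    by (rule sum.union_disjoint) auto
  also have "(\<Sum>m\<in>{M - j..<M}. ?f m) \<le> (\<Sum>m\<in>{M - j..<M}. (2 * B)\<^sup>2)"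
    by (intro sum_mono N2_le iter_in w y)
  also have "\<dots> = j * (2 * B)\<^sup>2" using M by simp
  finally have "(\<Sum>m\<in>{M..<2 * M}. (N ((T ^^ m) w - (T ^^ j) y))\<^sup>2) / M
     \<le> (j * (2 * B)\<^sup>2 + (\<Sum>m\<in>{M..<2 * M}. ?f m) + M * (4 * B * e + e\<^sup>2)) / M"
    by (intro divide_right_mono) auto
  then show ?thesis using M(2) unfolding Q_def by (simp add: add_divide_distrib)
qed

lemma inv_funD_iter:
  assumes "inv_fun h" "y \<in> S h"
  shows "\<exists>n0. \<forall>n\<ge>n0. (T ^^ n) y \<in> S h"
proof -
  have "0 < - h y / 2" using assms by (simp add: S_def)
  then obtain n0 where "\<forall>n\<ge>n0. \<forall>y'\<in>C. h ((T ^^ n) y') \<le> h y' + - h y / 2"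
    using assms(1) unfolding inv_fun_def by blast
  then have "(T ^^ n) y \<in> S h" if "n \<ge> n0" for n
    using that assms(2) iter_in[of y n] unfolding S_def by fastforce
  then show ?thesis by blast
qed

text \<open>Passes to a smaller sublevel set all of whose points are approached by one family of
  orbits. The ultralimit \<open>g\<close> of the averages is convex and almost invariant, so the
  maximum of a raised \<open>h\<close> and \<open>g - R'\<close> is again admissible; it is negative
  at the point that \<open>att\<close> provides.\<close>

lemma type_step:
  assumes h: "inv_fun h" and A: "\<And>h. inv_fun h \<Longrightarrow> att h R" and R: "R < R'"
    and U: "ultra U" "U \<le> (sequentially :: nat filter)"
  shows "\<exists>w h' m0. inv_fun h' \<and> S h' \<subseteq> S h \<and> (\<forall>M::nat. w M \<in> C) \<and> (\<forall>M. \<forall>m\<ge>m0. (T ^^ m) (w M) \<in> S h) \<and>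
    (\<forall>y\<in>S h'. \<forall>\<^sub>F M in U. Q M (w M) y < R')"
proof -
  note hd = h[unfolded inv_fun_def]
  have nb: "U \<noteq> bot" using U(1) by (rule ultra_neq_bot)
  obtain y0 where y0: "y0 \<in> C" "h y0 < 0" using hd by blast
  \<comment> \<open>Half the margin at \<open>y0\<close>: the raised function is still negative
    somewhere, while its sublevel set lies so deep in \<open>S h\<close> that one \<open>m0\<close>
    serves all orbits started there.\<close>
  define s where "s = - h y0 / 2"
  have s: "0 < s" "h y0 + s < 0" using y0 by (auto simp: s_def)
  define h1 where "h1 y = h y + s" for y
  have h1: "inv_fun h1" unfolding inv_fun_def
  proof (intro conjI)
    show "convex_on C h1" unfolding h1_def using hd by (intro convex_on_add) (auto simp: convex_on_const C_convex)
    show "\<forall>e>0. \<exists>n0. \<forall>n\<ge>n0. \<forall>y\<in>C. h1 ((T ^^ n) y) \<le> h1 y + e" using hd by (simp add: h1_def)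
    show "\<exists>y\<in>C. h1 y < 0" using y0 s by (auto simp: h1_def)
  qed
  obtain z M0 where z: "z \<in> S h1" and M0: "\<And>M. M \<ge> M0 \<Longrightarrow> \<exists>w\<in>S h1. Q M w z < R"
    using A[OF h1] unfolding att_def by blast
  have "\<exists>w\<in>S h1. M \<ge> M0 \<longrightarrow> Q M w z < R" for M using M0[of M] z by blast
  then obtain w where w: "\<And>M. w M \<in> S h1" "\<And>M. M \<ge> M0 \<Longrightarrow> Q M (w M) z < R" by metis
  have wC: "w M \<in> C" for M using w(1) S_sub by blast
  have zC: "z \<in> C" using z S_sub by blast
  define g where "g y = Lim U (\<lambda>M. Q M (w M) y)" for y
  have g: "((\<lambda>M. Q M (w M) y) \<longlongrightarrow> g y) U" if "y \<in> C" for y unfolding g_def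
    by (rule ultra_tendsto_bounded[OF U(1), where B = "(2 * B)\<^sup>2"])
       (use Q_le[OF wC that] Q_nonneg in \<open>auto intro!: always_eventually simp: abs_of_nonneg\<close>)
  have gconv: "convex_on C g"
  proof (rule convex_onI)
    fix t u v assume t: "0 < (t::real)" "t < 1" and uv: "u \<in> C" "v \<in> C"
    have c: "(1 - t) *\<^sub>R u + t *\<^sub>R v \<in> C" using C_convex t uv by (simp add: convexD)
    show "g ((1 - t) *\<^sub>R u + t *\<^sub>R v) \<le> (1 - t) * g u + t * g v"
      by (rule tendsto_le[OF nb tendsto_add[OF tendsto_mult[OF tendsto_const g] tendsto_mult[OF tendsto_const g]] g])
         (use uv c t convex_onD[OF Q_convex_on] in auto)
  qed (rule C_convex)
  have ginv: "\<exists>n0. \<forall>n\<ge>n0. \<forall>y\<in>C. g ((T ^^ n) y) \<le> g y + e" if e: "0 < e" for e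
  proof -
    have "((\<lambda>d. 4 * B * d + d\<^sup>2) \<longlongrightarrow> 4 * B * 0 + 0\<^sup>2) (at_right 0)" by (intro tendsto_intros)
    then have "\<forall>\<^sub>F d in at_right 0. 4 * B * d + d\<^sup>2 < e" by (rule order_tendstoD(2)) (use e in simp)
    moreover have "\<forall>\<^sub>F d in at_right 0. (0::real) < d" by (rule eventually_at_right_less)
    ultimately have "\<forall>\<^sub>F d in at_right 0. 4 * B * d + d\<^sup>2 < e \<and> 0 < d" by (rule eventually_conj)
    then obtain d where d: "4 * B * d + d\<^sup>2 < e" "0 < d"
      using eventually_happens'[OF trivial_limit_at_right_real] by blast
    obtain n0 where n0: "\<And>n. n \<ge> n0 \<Longrightarrow> \<forall>x\<in>C. \<forall>y\<in>C. N ((T ^^ n) x - (T ^^ n) y) \<le> N (x - y) + d"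
      using asymp[OF d(2)] by blast
    have "g ((T ^^ n) y) \<le> g y + e" if n: "n \<ge> n0" and y: "y \<in> C" for n y
    proof -
      have "((\<lambda>M. n * (2 * B)\<^sup>2 / real M) \<longlongrightarrow> 0) U"
        by (rule tendsto_mono[OF U(2)]) (rule lim_const_over_n)
      then have "((\<lambda>M. Q M (w M) y + (4 * B * d + d\<^sup>2) + n * (2 * B)\<^sup>2 / M) \<longlongrightarrow> g y + (4 * B * d + d\<^sup>2) + 0) U"
        by (intro tendsto_add g y tendsto_const)
      then have "g ((T ^^ n) y) \<le> g y + (4 * B * d + d\<^sup>2) + 0"
      proof (rule tendsto_le[OF nb _ g[OF iter_in[OF y]]])
        have "\<forall>\<^sub>F M in U. max n 1 \<le> M" using U(2) eventually_ge_at_top by (rule filter_leD)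
        then show "\<forall>\<^sub>F M in U. Q M (w M) ((T ^^ n) y) \<le> Q M (w M) y + (4 * B * d + d\<^sup>2) + n * (2 * B)\<^sup>2 / M"
          by eventually_elim (rule Q_iter[OF wC y d(2) n0[OF n]]; simp)
      qed
      then show ?thesis using d by linarith
    qed
    then show ?thesis by blast
  qed
  have gz: "g z \<le> R"
    by (rule tendsto_upperbound[OF g[OF zC] _ nb])
       (use filter_leD[OF U(2) eventually_ge_at_top[of M0]] w(2) in \<open>auto elim!: eventually_mono intro: less_imp_le\<close>)
  define h' where "h' y = max (h1 y) (g y - R')" for y
  have "inv_fun h'" unfolding inv_fun_def
  proof (intro conjI allI impI)
    have h1c: "convex_on C h1" using h1 by (simp add: inv_fun_def)
    show "convex_on C h'"
    proof (rule convex_onI)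
      fix t u v assume t: "0 < (t::real)" "t < 1" and uv: "u \<in> C" "v \<in> C"
      have "h1 ((1 - t) *\<^sub>R u + t *\<^sub>R v) \<le> (1 - t) * h1 u + t * h1 v"
        "g ((1 - t) *\<^sub>R u + t *\<^sub>R v) \<le> (1 - t) * g u + t * g v"
        using convex_onD[OF h1c, of t u v] convex_onD[OF gconv, of t u v] t uv by auto
      moreover have "(1 - t) * h1 u + t * h1 v \<le> (1 - t) * h' u + t * h' v"
        using t by (intro add_mono mult_left_mono) (auto simp: h'_def)
      moreover have "(1 - t) * (g u - R') + t * (g v - R') \<le> (1 - t) * h' u + t * h' v"
        using t by (intro add_mono mult_left_mono) (auto simp: h'_def)
      moreover have "(1 - t) * (g u - R') + t * (g v - R') = (1 - t) * g u + t * g v - R'" by (simp add: algebra_simps)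
      ultimately show "h' ((1 - t) *\<^sub>R u + t *\<^sub>R v) \<le> (1 - t) * h' u + t * h' v"
        unfolding h'_def[of "(1 - t) *\<^sub>R u + t *\<^sub>R v"] by linarith
    qed (rule C_convex)
    fix e :: real assume e: "0 < e"
    obtain n1 where n1: "\<forall>n\<ge>n1. \<forall>y\<in>C. h1 ((T ^^ n) y) \<le> h1 y + e" using h1 e by (auto simp: inv_fun_def)
    obtain n2 where n2: "\<forall>n\<ge>n2. \<forall>y\<in>C. g ((T ^^ n) y) \<le> g y + e" using ginv[OF e] by blast
    show "\<exists>n0. \<forall>n\<ge>n0. \<forall>y\<in>C. h' ((T ^^ n) y) \<le> h' y + e"
    proof (intro exI[of _ "max n1 n2"] allI impI ballI)
      fix n y assume "max n1 n2 \<le> n" "y \<in> C"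
      then have "h1 ((T ^^ n) y) \<le> h1 y + e" "g ((T ^^ n) y) \<le> g y + e" using n1 n2 by auto
      then show "h' ((T ^^ n) y) \<le> h' y + e" by (auto simp: h'_def)
    qed
  next
    show "\<exists>y\<in>C. h' y < 0" using z gz R zC by (intro bexI[of _ z]) (auto simp: h'_def S_def)
  qed
  moreover have "S h' \<subseteq> S h" using s by (auto simp: S_def h'_def h1_def)
  moreover have "\<forall>y\<in>S h'. \<forall>\<^sub>F M in U. Q M (w M) y < R'"
  proof
    fix y assume "y \<in> S h'"
    then have "y \<in> C" "g y < R'" by (auto simp: S_def h'_def)
    then show "\<forall>\<^sub>F M in U. Q M (w M) y < R'" using order_tendstoD(2)[OF g] by blast
  qed
  moreover obtain m0 where m0: "\<And>n y. n \<ge> m0 \<Longrightarrow> y \<in> C \<Longrightarrow> h ((T ^^ n) y) \<le> h y + s" using hd s by blast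
  have "(T ^^ m) (w M) \<in> S h" if "m \<ge> m0" for M m
  proof -
    have "h (w M) + s < 0" using w(1)[of M] by (simp add: S_def h1_def)
    then show ?thesis using m0[OF that wC[of M]] iter_in[OF wC] by (simp add: S_def)
  qed
  then have "\<forall>M. \<forall>m\<ge>m0. (T ^^ m) (w M) \<in> S h" by blast
  ultimately show ?thesis using wC by (intro exI[of _ w] exI[of _ h'] exI[of _ m0]) blast
qed

definition pts :: "'v \<times> nat \<Rightarrow> 'v set" where
  "pts q = (\<lambda>m. (T ^^ m) (fst q)) ` {snd q..<2 * snd q}"

text \<open>Each orbit window is placed so late that it is on average almost at the critical
  distance from all points of the earlier windows.\<close>

definition chain :: "(('v \<times> nat) list \<Rightarrow> nat) \<Rightarrow> real \<Rightarrow> ('v \<Rightarrow> real) \<Rightarrow> 'v \<Rightarrow> ('v \<times> nat) list \<Rightarrow> bool" where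
  "chain \<Theta> R h z ps \<longleftrightarrow> (\<forall>i<length ps. fst (ps ! i) \<in> C \<and> 0 < snd (ps ! i) \<and> \<Theta> (take i ps) \<le> snd (ps ! i) \<and>
     pts (ps ! i) \<subseteq> S h \<and>
     Q (snd (ps ! i)) (fst (ps ! i)) z < R \<and> (\<forall>j<i. \<forall>y\<in>pts (ps ! j). Q (snd (ps ! i)) (fst (ps ! i)) y < R))"

text \<open>The induction peels off the last window. Its family of orbits is fixed first and
  approaches all of \<open>S h'\<close>; the earlier windows are then built inside
  \<open>S h'\<close>; and only at the end is the starting time \<open>M\<close> of the last window
  chosen, when the finitely many points it has to approach are known.\<close>

lemma chain_exists:
  assumes A: "\<And>h. inv_fun h \<Longrightarrow> att h R" and R: "R < R'"
  shows "inv_fun h \<Longrightarrow> \<exists>z\<in>S h. \<exists>ps. length ps = L \<and> chain \<Theta> R' h z ps"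
proof (induction L arbitrary: h)
  case 0
  then show ?case by (auto simp: inv_fun_def S_def chain_def)
next
  case (Suc L)
  obtain U where U: "ultra U" "U \<le> (sequentially :: nat filter)" using seq_ultra_exists by blast
  from type_step[OF Suc.prems A R U] obtain w h' m0 where
    h': "inv_fun h'" "S h' \<subseteq> S h" and w: "\<And>M::nat. w M \<in> C" "\<And>M m. m \<ge> m0 \<Longrightarrow> (T ^^ m) (w M) \<in> S h"
    and ev: "\<And>y. y \<in> S h' \<Longrightarrow> \<forall>\<^sub>F M in U. Q M (w M) y < R'" by blast
  from Suc.IH[OF h'(1)] obtain z ps where z: "z \<in> S h'" "length ps = L" "chain \<Theta> R' h' z ps" by blast
  define Y where "Y = insert z (\<Union>j<L. pts (ps ! j))"
  have "finite Y" by (auto simp: Y_def pts_def)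
  moreover have "Y \<subseteq> S h'" using z by (auto simp: Y_def chain_def)
  ultimately have "\<forall>\<^sub>F M in U. \<forall>y\<in>Y. Q M (w M) y < R'"
    using ev by (intro eventually_ball_finite) auto
  moreover have "\<forall>\<^sub>F M in U. max (max m0 1) (\<Theta> ps) \<le> M" using U(2) eventually_ge_at_top by (rule filter_leD)
  ultimately have "\<forall>\<^sub>F M in U. (\<forall>y\<in>Y. Q M (w M) y < R') \<and> max (max m0 1) (\<Theta> ps) \<le> M" by (rule eventually_conj)
  then obtain M where M: "\<And>y. y \<in> Y \<Longrightarrow> Q M (w M) y < R'" "m0 \<le> M" "1 \<le> M" "\<Theta> ps \<le> M"
    using eventually_happens'[OF ultra_neq_bot[OF U(1)]] by fastforce
  have "chain \<Theta> R' h z (ps @ [(w M, M)])"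
    unfolding chain_def
  proof (intro allI impI)
    fix i assume "i < length (ps @ [(w M, M)])"
    then consider "i < L" | "i = L" using z(2) by (auto simp: less_Suc_eq)
    then show "fst ((ps @ [(w M, M)]) ! i) \<in> C \<and> 0 < snd ((ps @ [(w M, M)]) ! i) \<and> \<Theta> (take i (ps @ [(w M, M)])) \<le> snd ((ps @ [(w M, M)]) ! i) \<and>
     pts ((ps @ [(w M, M)]) ! i) \<subseteq> S h \<and>
     Q (snd ((ps @ [(w M, M)]) ! i)) (fst ((ps @ [(w M, M)]) ! i)) z < R' \<and> (\<forall>j<i. \<forall>y\<in>pts ((ps @ [(w M, M)]) ! j). Q (snd ((ps @ [(w M, M)]) ! i)) (fst ((ps @ [(w M, M)]) ! i)) y < R')"
    proof cases
      case 1
      have c: "fst (ps ! i) \<in> C \<and> 0 < snd (ps ! i) \<and> \<Theta> (take i ps) \<le> snd (ps ! i) \<and> pts (ps ! i) \<subseteq> S h' \<and>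
          Q (snd (ps ! i)) (fst (ps ! i)) z < R' \<and> (\<forall>j<i. \<forall>y\<in>pts (ps ! j). Q (snd (ps ! i)) (fst (ps ! i)) y < R')"
        using z(2,3) 1 unfolding chain_def by blast
      then have "pts (ps ! i) \<subseteq> S h" using h'(2) by blast
      then show ?thesis using c 1 z(2) by (simp add: nth_append)
    next
      case 2
      have "pts (w M, M) \<subseteq> S h" using w(2) M(2) by (auto simp: pts_def)
      then show ?thesis using 2 z(2) w(1) M by (auto simp: nth_append Y_def)
    qed
  qed
  then show ?case using z h'(2) by (intro bexI[of _ z] exI[of _ "ps @ [(w M, M)]"]) auto
qed

lemma fixed_point:
  assumes A: "\<And>h r. inv_fun h \<Longrightarrow> 0 < r \<Longrightarrow> att h r"
    and complete: "\<And>y. (\<And>k. y k \<in> C) \<Longrightarrow> (\<And>e. 0 < e \<Longrightarrow> \<exists>k0. \<forall>j\<ge>k0. \<forall>k\<ge>k0. N (y j - y k) < e) \<Longrightarrow>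
       \<exists>x\<in>C. (\<lambda>k. N (y k - x)) \<longlonglongrightarrow> 0"
    and cont: "n_continuous_on N C T" and def: "\<And>x. x \<in> V \<Longrightarrow> N x = 0 \<Longrightarrow> x = 0"
  shows "\<exists>x\<in>C. T x = x"
proof -
  obtain U where U: "ultra U" "U \<le> (sequentially :: nat filter)" using seq_ultra_exists by blast
  have step: "\<exists>h'. inv_fun h' \<and> S h' \<subseteq> S h \<and> (\<forall>y\<in>S h'. \<forall>y'\<in>S h'. (N (y - y'))\<^sup>2 \<le> 4 * r)" if h: "inv_fun h" and r: "0 < r" for h r
  proof -
    have "r / 2 < r" using r by simp
    from type_step[OF h A this U] r obtain w h' where
      h': "inv_fun h'" "S h' \<subseteq> S h" and w: "\<And>M::nat. w M \<in> C"
      and ev: "\<And>y. y \<in> S h' \<Longrightarrow> \<forall>\<^sub>F M in U. Q M (w M) y < r" by force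
    have "(N (y - y'))\<^sup>2 \<le> 4 * r" if y: "y \<in> S h'" "y' \<in> S h'" for y y'
    proof -
      have "\<forall>\<^sub>F M in U. 1 \<le> M" using U(2) eventually_ge_at_top by (rule filter_leD)
      with ev[OF y(1)] ev[OF y(2)] have "\<forall>\<^sub>F M in U. Q M (w M) y < r \<and> Q M (w M) y' < r \<and> 1 \<le> M"
        by eventually_elim simp
      then obtain M where M: "Q M (w M) y < r" "Q M (w M) y' < r" "1 \<le> M"
        using eventually_happens'[OF ultra_neq_bot[OF U(1)]] by blast
      let ?d = "\<lambda>m y. (N ((T ^^ m) (w M) - y))\<^sup>2"
      have "(N (y - y'))\<^sup>2 \<le> 2 * ?d m y + 2 * ?d m y'" for m
      proof -
        have "N (y - y') \<le> N ((T ^^ m) (w M) - y) + N ((T ^^ m) (w M) - y')"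
          using N.triangle[of y y' "(T ^^ m) (w M)"] N.minus_commute[of y "(T ^^ m) (w M)"] by simp
        then have "(N (y - y'))\<^sup>2 \<le> (N ((T ^^ m) (w M) - y) + N ((T ^^ m) (w M) - y'))\<^sup>2" by (intro power_mono) auto
        also have "\<dots> \<le> 2 * ?d m y + 2 * ?d m y'"
          using zero_le_power2[of "N ((T ^^ m) (w M) - y) - N ((T ^^ m) (w M) - y')"] by (simp add: power2_sum power2_diff)
        finally show ?thesis .
      qed
      then have "(\<Sum>m\<in>{M..<2 * M}. (N (y - y'))\<^sup>2) \<le> (\<Sum>m\<in>{M..<2 * M}. 2 * ?d m y + 2 * ?d m y')" by (rule sum_mono)
      then have "M * (N (y - y'))\<^sup>2 \<le> 2 * (\<Sum>m\<in>{M..<2 * M}. ?d m y) + 2 * (\<Sum>m\<in>{M..<2 * M}. ?d m y')"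
        by (simp add: sum.distrib sum_distrib_left)
      also have "\<dots> = M * (2 * Q M (w M) y + 2 * Q M (w M) y')" using M(3) by (simp add: Q_def field_simps)
      finally have "(N (y - y'))\<^sup>2 \<le> 2 * Q M (w M) y + 2 * Q M (w M) y'" using M(3) by simp
      then show ?thesis using M by linarith
    qed
    then show ?thesis using h' by blast
  qed
  define small where "small h k \<longleftrightarrow> (\<forall>y\<in>S h. \<forall>y'\<in>S h. (N (y - y'))\<^sup>2 \<le> 4 * (1 / Suc k))" for h and k :: nat
  have start: "inv_fun (\<lambda>_. -1)"
    using C_ne C_convex by (auto simp: inv_fun_def convex_on_const)
  have "\<exists>f. \<forall>k. (inv_fun (f k) \<and> small (f k) k) \<and> S (f (Suc k)) \<subseteq> S (f k)"
  proof (rule dependent_nat_choice)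
    show "\<exists>h. inv_fun h \<and> small h 0" using step[OF start, of "1 / Suc 0"] by (auto simp: small_def)
    show "\<exists>h'. (inv_fun h' \<and> small h' (Suc k)) \<and> S h' \<subseteq> S h" if "inv_fun h \<and> small h k" for h k
      using step[of h "1 / Suc (Suc k)"] that by (auto simp: small_def)
  qed
  then obtain f where f: "\<And>k. inv_fun (f k)" "\<And>k. small (f k) k" "\<And>k. S (f (Suc k)) \<subseteq> S (f k)" by blast
  have mono: "S (f k) \<subseteq> S (f j)" if "j \<le> k" for j k using that f(3) by (rule lift_Suc_antimono_le[rotated])
  have "\<exists>y. y \<in> S (f k)" for k using f(1)[of k] by (auto simp: inv_fun_def S_def)
  then obtain y where y: "\<And>k. y k \<in> S (f k)" by metis
  have yC: "y k \<in> C" for k using y S_sub by blast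
  have diam: "\<exists>k. \<forall>u\<in>S (f k). \<forall>v\<in>S (f k). N (u - v) < e" if e: "0 < e" for e
  proof -
    obtain k where k: "4 / e\<^sup>2 < real (Suc k)" by (metis less_SucI reals_Archimedean2 of_nat_less_iff lessI less_trans)
    have "N (u - v) < e" if "u \<in> S (f k)" "v \<in> S (f k)" for u v
    proof -
      have "(N (u - v))\<^sup>2 \<le> 4 * (1 / Suc k)" using f(2)[of k] that by (simp add: small_def)
      also have "\<dots> < e\<^sup>2" using k e by (simp add: field_simps del: of_nat_Suc)
      finally show ?thesis by (rule power2_less_imp_less) (use e in simp)
    qed
    then show ?thesis by blast
  qed
  have "\<exists>x\<in>C. (\<lambda>k. N (y k - x)) \<longlonglongrightarrow> 0"
  proof (rule complete[OF yC])
    fix e :: real assume "0 < e"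
    from diam[OF this] obtain k where "\<forall>u\<in>S (f k). \<forall>v\<in>S (f k). N (u - v) < e" by blast
    then show "\<exists>k0. \<forall>j\<ge>k0. \<forall>k\<ge>k0. N (y j - y k) < e" using y mono by (intro exI[of _ k]) blast
  qed
  then obtain x where x: "x \<in> C" "(\<lambda>k. N (y k - x)) \<longlonglongrightarrow> 0" by blast
  \<comment> \<open>The limit \<open>x\<close> need not lie in any of the sublevel sets, so its
    orbit is compared with that of a nearby \<open>y k\<close>, which finally stays in a set of
    small diameter.\<close>
  have lim: "\<exists>n0. \<forall>n\<ge>n0. N ((T ^^ n) x - x) < e" if e: "0 < e" for e
  proof -
    obtain k1 where k1: "\<And>u v. u \<in> S (f k1) \<Longrightarrow> v \<in> S (f k1) \<Longrightarrow> N (u - v) < e / 4"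
      using diam[of "e / 4"] e by auto
    obtain k2 where k2: "\<And>k. k \<ge> k2 \<Longrightarrow> N (y k - x) < e / 4"
      using order_tendstoD(2)[OF x(2), of "e / 4"] e by (auto simp: eventually_sequentially)
    define k where "k = max k1 k2"
    have yk: "y k \<in> S (f k1)" "N (y k - x) < e / 4" using y[of k] mono[of k1 k] k2[of k] by (auto simp: k_def)
    obtain n1 where n1: "\<And>n. n \<ge> n1 \<Longrightarrow> (T ^^ n) (y k) \<in> S (f k1)" using inv_funD_iter[OF f(1) yk(1)] by blast
    obtain n2 where n2: "\<And>n. n \<ge> n2 \<Longrightarrow> \<forall>u\<in>C. \<forall>v\<in>C. N ((T ^^ n) u - (T ^^ n) v) \<le> N (u - v) + e / 4"
      using asymp[of "e / 4"] e by auto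
    have "N ((T ^^ n) x - x) < e" if "n \<ge> max n1 n2" for n
    proof -
      have "N ((T ^^ n) x - (T ^^ n) (y k)) \<le> N (x - y k) + e / 4" using n2 that x(1) yC by simp
      moreover have "N ((T ^^ n) (y k) - y k) < e / 4" using k1 n1 yk(1) that by simp
      ultimately show ?thesis
        using N.triangle[of "(T ^^ n) x" x "(T ^^ n) (y k)"] N.triangle[of "(T ^^ n) (y k)" x "y k"]
          N.minus_commute[of x "y k"] yk(2) by linarith
    qed
    then show ?thesis by blast
  qed
  \<comment> \<open>Continuity enters only here: the image under \<open>T\<close> of the
    \<open>n\<close>-th iterate tends to \<open>T x\<close> and, being the next iterate, also to
    \<open>x\<close>.\<close>
  have "N (T x - x) \<le> 0"
  proof (rule field_le_epsilon)
    fix e :: real assume e: "0 < e"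
    obtain d where d: "0 < d" "\<And>y. y \<in> C \<Longrightarrow> N (y - x) < d \<Longrightarrow> N (T y - T x) < e / 2"
      using cont x(1) e unfolding n_continuous_on_def by (metis half_gt_zero)
    obtain n1 where n1: "\<And>n. n \<ge> n1 \<Longrightarrow> N ((T ^^ n) x - x) < d" using lim[OF d(1)] by blast
    obtain n2 where n2: "\<And>n. n \<ge> n2 \<Longrightarrow> N ((T ^^ n) x - x) < e / 2" using lim[of "e / 2"] e by auto
    define n where "n = max n1 n2"
    have "N (T ((T ^^ n) x) - T x) < e / 2" using d(2)[OF iter_in[OF x(1)] n1[of n]] by (simp add: n_def)
    moreover have "N (T ((T ^^ n) x) - x) < e / 2" using n2[of "Suc n"] by (simp add: n_def)
    ultimately show "N (T x - x) \<le> 0 + e"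
      using N.triangle[of "T x" x "T ((T ^^ n) x)"] N.minus_commute[of "T x" "T ((T ^^ n) x)"] by linarith
  qed
  then have "N (T x - x) = 0" using N.nonneg[of "T x - x"] by linarith
  moreover have "T x - x \<in> V" using x(1) TC C_sub V by (auto intro: subspace_diff)
  ultimately have "T x - x = 0" using def by blast
  then show ?thesis using x(1) by auto
qed

end

section \<open>Weighted families of orbit windows\<close>

text \<open>This form also covers shifts longer than the window, where the added and the removed
  range overlap.\<close>

lemma window_shift:
  fixes g :: "nat \<Rightarrow> 'z::ab_group_add"
  shows "(\<Sum>m\<in>{M..<2 * M}. g (m + s)) - (\<Sum>m\<in>{M..<2 * M}. g m) = (\<Sum>m\<in>{2 * M..<2 * M + s}. g m) - (\<Sum>m\<in>{M..<M + s}. g m)"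
proof (induction s)
  case (Suc s)
  have "(\<Sum>m\<in>{M..<2 * M}. g (m + Suc s)) + g (M + s) = g (2 * M + s) + (\<Sum>m\<in>{M..<2 * M}. g (m + s))"
    using sum.atLeastLessThan_Suc[of M "2 * M" "\<lambda>m. g (m + s)"] sum.atLeast_Suc_lessThan[of M "Suc (2 * M)" "\<lambda>m. g (m + s)"]
      sum.shift_bounds_Suc_ivl[of "\<lambda>m. g (m + s)" M "2 * M"]
    by (simp add: add.commute)
  then have A: "(\<Sum>m\<in>{M..<2 * M}. g (m + Suc s)) = g (2 * M + s) + (\<Sum>m\<in>{M..<2 * M}. g (m + s)) - g (M + s)"
    by (simp only: eq_diff_eq)
  have "(\<Sum>m\<in>{M..<2 * M}. g (m + Suc s)) - (\<Sum>m\<in>{M..<2 * M}. g m)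
    = g (2 * M + s) - g (M + s) + ((\<Sum>m\<in>{M..<2 * M}. g (m + s)) - (\<Sum>m\<in>{M..<2 * M}. g m))"
    unfolding A by (simp add: algebra_simps)
  also have "\<dots> = (\<Sum>m\<in>{2 * M..<2 * M + Suc s}. g m) - (\<Sum>m\<in>{M..<M + Suc s}. g m)"
    unfolding Suc by (simp add: algebra_simps)
  finally show ?case .
qed simp

locale windows =
  fixes k L :: nat and c :: "nat \<Rightarrow> real" and M :: "nat \<Rightarrow> nat"
  assumes c_nonneg: "0 \<le> c i" and c_sum: "sum c {k..<L} = 1" and M_pos: "k \<le> i \<Longrightarrow> i < L \<Longrightarrow> 0 < M i"
begin

definition I :: "(nat \<times> nat) set" where "I = Sigma {k..<L} (\<lambda>i. {M i..<2 * M i})"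
definition w :: "nat \<times> nat \<Rightarrow> real" where "w q = c (fst q) / M (fst q)"

lemma sum_I: "(\<Sum>q\<in>I. w q *\<^sub>R F q) = (\<Sum>i\<in>{k..<L}. c i *\<^sub>R ((1 / M i) *\<^sub>R (\<Sum>m\<in>{M i..<2 * M i}. F (i, m) :: 'z::real_vector)))"
proof -
  have "(\<Sum>q\<in>I. w q *\<^sub>R F q) = (\<Sum>(i, m)\<in>Sigma {k..<L} (\<lambda>i. {M i..<2 * M i}). w (i, m) *\<^sub>R F (i, m))"
    unfolding I_def by (rule sum.cong) auto
  also have "\<dots> = (\<Sum>i\<in>{k..<L}. \<Sum>m\<in>{M i..<2 * M i}. w (i, m) *\<^sub>R F (i, m))"
    by (rule sum.Sigma[symmetric]) auto
  finally show ?thesis by (simp add: w_def scaleR_sum_right)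
qed

lemma sum_I_real: "(\<Sum>q\<in>I. w q * f q) = (\<Sum>i\<in>{k..<L}. c i * ((\<Sum>m\<in>{M i..<2 * M i}. f (i, m)) / M i))"
  using sum_I[of f] by simp

sublocale weights I w
proof
  show "finite I" by (simp add: I_def)
  show "0 \<le> w i" for i by (simp add: w_def c_nonneg)
  have "(\<Sum>q\<in>I. w q * 1) = (\<Sum>i\<in>{k..<L}. c i)"
    unfolding sum_I_real
  proof (rule sum.cong[OF refl])
    fix i assume "i \<in> {k..<L}"
    then have "0 < M i" using M_pos by simp
    then show "c i * ((\<Sum>m\<in>{M i..<2 * M i}. 1) / real (M i)) = c i" by simp
  qed
  then show "sum w I = 1" using c_sum by simp
qed

lemma E_window: "E f = (\<Sum>i\<in>{k..<L}. c i * ((\<Sum>m\<in>{M i..<2 * M i}. f (i, m)) / M i))"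
  unfolding E_def by (rule sum_I_real)

lemma E_window_mono:
  assumes "\<And>i. k \<le> i \<Longrightarrow> i < L \<Longrightarrow> (\<Sum>m\<in>{M i..<2 * M i}. f (i, m)) / M i \<le> d i"
  shows "E f \<le> (\<Sum>i\<in>{k..<L}. c i * d i)"
  unfolding E_window by (intro sum_mono mult_left_mono assms c_nonneg) auto

text \<open>The terms gained and the terms lost both have a sum between 0 and \<open>b * s\<close>,
  hence no factor two in the bound.\<close>

lemma E_shift:
  assumes f: "\<And>i m. k \<le> i \<Longrightarrow> i < L \<Longrightarrow> 0 \<le> f (i, m) \<and> f (i, m) \<le> b" and M0: "0 < M0" "\<And>i. k \<le> i \<Longrightarrow> i < L \<Longrightarrow> M0 \<le> M i"
  shows "\<bar>E (\<lambda>q. f (fst q, snd q + s)) - E f\<bar> \<le> b * s / M0"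
proof -
  have le: "\<bar>(\<Sum>m\<in>{M i..<2 * M i}. f (i, m + s)) / M i - (\<Sum>m\<in>{M i..<2 * M i}. f (i, m)) / M i\<bar> \<le> b * s / M0" if i: "k \<le> i" "i < L" for i
  proof -
    have bd: "0 \<le> (\<Sum>m\<in>{a..<a + s}. f (i, m))" "(\<Sum>m\<in>{a..<a + s}. f (i, m)) \<le> b * s" for a
      using sum_bounded_above[of "{a..<a + s}" "\<lambda>m. f (i, m)" b] f[OF i] by (auto intro: sum_nonneg simp: mult.commute)
    have b0: "0 \<le> b" using f[OF i, of 0] by linarith
    have "\<bar>(\<Sum>m\<in>{M i..<2 * M i}. f (i, m + s)) - (\<Sum>m\<in>{M i..<2 * M i}. f (i, m))\<bar> \<le> b * s"
      unfolding window_shift[of "\<lambda>m. f (i, m)"] using bd[of "2 * M i"] bd[of "M i"] by linarith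
    then have "\<bar>(\<Sum>m\<in>{M i..<2 * M i}. f (i, m + s)) - (\<Sum>m\<in>{M i..<2 * M i}. f (i, m))\<bar> / M i \<le> b * s / M i"
      by (rule divide_right_mono) simp
    also have "\<dots> \<le> b * s / M0" using M0(1) M0(2)[OF i] b0 by (intro divide_left_mono) auto
    finally show ?thesis by (simp add: abs_divide flip: diff_divide_distrib)
  qed
  have eq: "E (\<lambda>q. f (fst q, snd q + s)) - E f = (\<Sum>i\<in>{k..<L}. c i * ((\<Sum>m\<in>{M i..<2 * M i}. f (i, m + s)) / M i - (\<Sum>m\<in>{M i..<2 * M i}. f (i, m)) / M i))"
    unfolding E_window by (simp add: sum_subtractf right_diff_distrib)
  have "\<bar>E (\<lambda>q. f (fst q, snd q + s)) - E f\<bar> \<le> (\<Sum>i\<in>{k..<L}. \<bar>c i * ((\<Sum>m\<in>{M i..<2 * M i}. f (i, m + s)) / M i - (\<Sum>m\<in>{M i..<2 * M i}. f (i, m)) / M i)\<bar>)"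
    unfolding eq by (rule sum_abs)
  also have "\<dots> \<le> (\<Sum>i\<in>{k..<L}. c i * (b * s / M0))"
  proof (rule sum_mono)
    fix i assume i: "i \<in> {k..<L}"
    show "\<bar>c i * ((\<Sum>m\<in>{M i..<2 * M i}. f (i, m + s)) / M i - (\<Sum>m\<in>{M i..<2 * M i}. f (i, m)) / M i)\<bar> \<le> c i * (b * s / M0)"
    proof -
      have "\<bar>c i * x\<bar> = c i * \<bar>x\<bar>" for x using c_nonneg[of i] by (simp add: abs_mult)
      moreover note mult_left_mono[OF le c_nonneg[of i], of i]
      ultimately show ?thesis using i by simp
    qed
  qed
  also have "\<dots> = b * s / M0" unfolding sum_distrib_right[symmetric] c_sum by simp
  finally show ?thesis .
qed

lemma E_shift2:
  assumes f: "\<And>i m j m'. k \<le> i \<Longrightarrow> i < L \<Longrightarrow> k \<le> j \<Longrightarrow> j < L \<Longrightarrow> 0 \<le> f (i, m) (j, m') \<and> f (i, m) (j, m') \<le> b"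
    and M0: "0 < M0" "\<And>i. k \<le> i \<Longrightarrow> i < L \<Longrightarrow> M0 \<le> M i"
  shows "\<bar>E (\<lambda>q. E (\<lambda>q'. f (fst q, snd q + s) (fst q', snd q' + s))) - E (\<lambda>q. E (\<lambda>q'. f q q'))\<bar> \<le> 2 * (b * s / M0)"
proof -
  have I: "k \<le> fst q" "fst q < L" if "q \<in> I" for q using that by (auto simp: I_def)
  let ?g = "\<lambda>q. E (\<lambda>q'. f q q')"
  have "\<bar>E (\<lambda>q. E (\<lambda>q'. f (fst q, snd q + s) (fst q', snd q' + s))) - E (\<lambda>q. ?g (fst q, snd q + s))\<bar>
    \<le> E (\<lambda>q. \<bar>E (\<lambda>q'. f (fst q, snd q + s) (fst q', snd q' + s)) - ?g (fst q, snd q + s)\<bar>)"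
    unfolding E_diff[symmetric] by (rule E_abs)
  also have "\<dots> \<le> b * s / M0"
  proof (rule E_le)
    fix q assume q: "q \<in> I"
    show "\<bar>E (\<lambda>q'. f (fst q, snd q + s) (fst q', snd q' + s)) - ?g (fst q, snd q + s)\<bar> \<le> b * s / M0"
      by (rule E_shift[OF _ M0]) (use f[OF I[OF q]] in auto)
  qed
  finally have 1: "\<bar>E (\<lambda>q. E (\<lambda>q'. f (fst q, snd q + s) (fst q', snd q' + s))) - E (\<lambda>q. ?g (fst q, snd q + s))\<bar> \<le> b * s / M0" .
  have "\<bar>E (\<lambda>q. ?g (fst q, snd q + s)) - E ?g\<bar> \<le> b * s / M0"
  proof (rule E_shift[OF _ M0])
    fix i m assume i: "k \<le> i" "i < L"
    have "0 \<le> f (i, m) q'" "f (i, m) q' \<le> b" if "q' \<in> I" for q'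
      using f[OF i I[OF that], of m "snd q'"] by auto
    then show "0 \<le> ?g (i, m) \<and> ?g (i, m) \<le> b" by (auto intro: E_nonneg E_le)
  qed
  with 1 show ?thesis by linarith
qed

lemma E_fst: "E (\<lambda>q. g (fst q)) = (\<Sum>i\<in>{k..<L}. c i * g i)"
  unfolding E_window
proof (rule sum.cong[OF refl])
  fix i assume "i \<in> {k..<L}"
  then have "0 < M i" using M_pos by simp
  then show "c i * ((\<Sum>m\<in>{M i..<2 * M i}. g (fst (i, m))) / real (M i)) = c i * g i" by simp
qed

text \<open>For two different windows only the average over the later one is controlled, so by
  symmetry each unordered pair is counted from its earlier member. Inside one window only the crude
  bound \<open>d\<close> is known, and the cap \<open>\<gamma>\<close> on the weights makes such
  pairs negligible.\<close>

lemma E_pairs: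
  assumes sym: "\<And>q q'. f q q' = f q' q" and R: "0 \<le> R" and d: "0 \<le> d"
    and off: "\<And>q j. q \<in> I \<Longrightarrow> fst q < j \<Longrightarrow> j < L \<Longrightarrow> (\<Sum>m\<in>{M j..<2 * M j}. f q (j, m)) / M j \<le> R"
    and diag: "\<And>q q'. q \<in> I \<Longrightarrow> q' \<in> I \<Longrightarrow> f q q' \<le> d" and \<gamma>: "\<And>i. c i \<le> \<gamma>"
  shows "E (\<lambda>q. E (\<lambda>q'. f q q')) \<le> R + \<gamma> * d"
proof -
  define u where "u q q' = (if fst q < fst q' then f q q' else 0)" for q q'
  define g where "g q q' = (if fst q = fst q' then f q q' else 0)" for q q'
  define tail where "tail i = (\<Sum>j\<in>{k..<L}. if i < j then c j else 0)" for i
  have split: "f q q' = u q q' + u q' q + g q q'" for q q'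
    using sym[of q q'] by (auto simp: u_def g_def)
  have I: "k \<le> fst q" "fst q < L" if "q \<in> I" for q using that by (auto simp: I_def)
  have inI: "(i, m) \<in> I" if "k \<le> i" "i < L" "m \<in> {M i..<2 * M i}" for i m using that by (auto simp: I_def)
  have Eu: "E (u q) \<le> R * tail (fst q)" if q: "q \<in> I" for q
  proof -
    have "E (u q) \<le> (\<Sum>j\<in>{k..<L}. c j * (if fst q < j then R else 0))"
    proof (rule E_window_mono)
      fix j assume "k \<le> j" "j < L"
      then show "(\<Sum>m\<in>{M j..<2 * M j}. u q (j, m)) / M j \<le> (if fst q < j then R else 0)"
        using off[OF q, of j] by (simp add: u_def)
    qed
    also have "\<dots> = R * tail (fst q)" unfolding tail_def sum_distrib_left by (rule sum.cong) auto
    finally show ?thesis .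
  qed
  have "E (\<lambda>q. E (u q)) \<le> E (\<lambda>q. R * tail (fst q))" by (rule E_mono) (rule Eu)
  also have "\<dots> = R * (\<Sum>i\<in>{k..<L}. c i * tail i)" by (simp add: E_cmult E_fst)
  finally have u1: "E (\<lambda>q. E (u q)) \<le> R * (\<Sum>i\<in>{k..<L}. c i * tail i)" .
  \<comment> \<open>Ordered pairs with \<open>i < j\<close> have at most half of the total mass, so
    the two orders together give \<open>R\<close> and not \<open>2 * R\<close>.\<close>
  have half: "2 * (\<Sum>i\<in>{k..<L}. c i * tail i) \<le> 1"
  proof -
    have a: "(\<Sum>i\<in>{k..<L}. c i * tail i) = (\<Sum>i\<in>{k..<L}. \<Sum>j\<in>{k..<L}. if i < j then c i * c j else 0)"
      unfolding tail_def sum_distrib_left by (intro sum.cong) auto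
    also have "\<dots> = (\<Sum>i\<in>{k..<L}. \<Sum>j\<in>{k..<L}. if j < i then c i * c j else 0)"
      by (subst sum.swap) (intro sum.cong, auto)
    finally have "2 * (\<Sum>i\<in>{k..<L}. c i * tail i)
      = (\<Sum>i\<in>{k..<L}. \<Sum>j\<in>{k..<L}. (if i < j then c i * c j else 0) + (if j < i then c i * c j else 0))"
      using a by (simp add: sum.distrib)
    also have "\<dots> \<le> (\<Sum>i\<in>{k..<L}. \<Sum>j\<in>{k..<L}. c i * c j)"
      by (intro sum_mono) (use c_nonneg in auto)
    also have "\<dots> = 1" by (simp add: c_sum flip: sum_distrib_left sum_distrib_right)
    finally show ?thesis .
  qed
  have Eg: "E (g q) \<le> \<gamma> * d" if q: "q \<in> I" for q
  proof -
    have "E (g q) \<le> (\<Sum>j\<in>{k..<L}. c j * (if j = fst q then d else 0))"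
    proof (rule E_window_mono)
      fix j assume j: "k \<le> j" "j < L"
      have "(\<Sum>m\<in>{M j..<2 * M j}. g q (j, m)) \<le> (\<Sum>m\<in>{M j..<2 * M j}. if j = fst q then d else 0)"
        by (rule sum_mono) (use diag[OF q inI[OF j]] in \<open>auto simp: g_def\<close>)
      then show "(\<Sum>m\<in>{M j..<2 * M j}. g q (j, m)) / M j \<le> (if j = fst q then d else 0)"
        using M_pos[OF j] by (simp add: field_simps split: if_splits)
    qed
    also have "\<dots> = (\<Sum>j\<in>{k..<L}. if j = fst q then c j * d else 0)" by (rule sum.cong) auto
    also have "\<dots> = c (fst q) * d" using I[OF q] by simp
    also have "\<dots> \<le> \<gamma> * d" by (intro mult_right_mono \<gamma> d)
    finally show ?thesis .
  qed
  have "E (\<lambda>q. E (\<lambda>q'. f q q')) = E (\<lambda>q. E (u q)) + E (\<lambda>q. E (\<lambda>q'. u q' q)) + E (\<lambda>q. E (g q))"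
    by (subst split) (simp add: E_add)
  also have "E (\<lambda>q. E (\<lambda>q'. u q' q)) = E (\<lambda>q. E (u q))" by (rule E_swap)
  also have "E (\<lambda>q. E (g q)) \<le> \<gamma> * d" by (rule E_le) (rule Eg)
  finally have "E (\<lambda>q. E (\<lambda>q'. f q q')) \<le> R * (2 * (\<Sum>i\<in>{k..<L}. c i * tail i)) + \<gamma> * d" using u1 by simp
  then show ?thesis using mult_left_mono[OF half R] by simp
qed

end

text \<open>Pigeonhole: the forbidden values each exclude at most one point of an equidistant grid.\<close>

lemma avoid_finite:
  fixes Y :: "'b::finite \<Rightarrow> real"
  assumes \<rho>: "0 < \<rho>" and \<epsilon>: "\<epsilon> = \<rho> / (16 * real CARD('b))"
  shows "\<exists>t. 1 / 4 \<le> t \<and> t \<le> 3 / 4 \<and> (\<forall>A. 2 * \<epsilon> < \<bar>t * \<rho> - Y A\<bar>)"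
proof (rule ccontr)
  assume neg: "\<not> ?thesis"
  let ?K = "CARD('b)"
  define t where "t j = 1 / 4 + real j / (2 * real ?K)" for j :: nat
  have t: "1 / 4 \<le> t j" "t j \<le> 3 / 4" if "j \<le> ?K" for j using that by (auto simp: t_def field_simps)
  have "\<exists>A. \<bar>t j * \<rho> - Y A\<bar> \<le> 2 * \<epsilon>" if "j \<le> ?K" for j using neg t[OF that] by (meson not_less)
  then obtain A where A: "\<And>j. j \<le> ?K \<Longrightarrow> \<bar>t j * \<rho> - Y (A j)\<bar> \<le> 2 * \<epsilon>" by metis
  have "inj_on A {..?K}"
  proof (rule inj_onI, rule ccontr)
    fix i j assume ij: "i \<in> {..?K}" "j \<in> {..?K}" "A i = A j" "i \<noteq> j"
    have "\<bar>t i * \<rho> - t j * \<rho>\<bar> \<le> 4 * \<epsilon>" using A[of i] A[of j] ij by auto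
    moreover have "\<bar>t i * \<rho> - t j * \<rho>\<bar> = \<bar>real i - real j\<bar> * (\<rho> / (2 * real ?K))"
    proof -
      have "t i * \<rho> - t j * \<rho> = (real i - real j) * (\<rho> / (2 * real ?K))" by (simp add: t_def field_simps)
      then show ?thesis using \<rho> by (simp add: abs_mult)
    qed
    moreover have "1 * (\<rho> / (2 * real ?K)) \<le> \<bar>real i - real j\<bar> * (\<rho> / (2 * real ?K))"
      using ij(4) \<rho> by (intro mult_right_mono) auto
    ultimately have "\<rho> / (2 * real ?K) \<le> 4 * \<epsilon>" by linarith
    then show False using \<rho> unfolding \<epsilon> by (simp add: field_simps)
  qed
  then have "card {..?K} \<le> card (UNIV :: 'b set)" by (intro card_inj_on_le) auto
  then show False by simp
qed

text \<open>Minkowski's inequality against a constant. It turns pointwise estimates for a power of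
  the map into the quadratic hypotheses of \<open>spectral_gap\<close>.\<close>

lemma (in weights) E_affine_square:
  assumes f: "\<And>i. i \<in> I \<Longrightarrow> 0 \<le> f i" and c: "E (\<lambda>i. (f i)\<^sup>2) \<le> c\<^sup>2" "0 \<le> c" and t: "0 \<le> t" and e: "0 \<le> e"
    and g: "\<And>i. i \<in> I \<Longrightarrow> 0 \<le> g i" "\<And>i. i \<in> I \<Longrightarrow> g i \<le> t * f i + e"
  shows "E (\<lambda>i. (g i)\<^sup>2) \<le> (t * c + e)\<^sup>2"
proof -
  have "E (\<lambda>i. (g i)\<^sup>2) \<le> E (\<lambda>i. (t * f i + e)\<^sup>2)" by (intro E_mono power_mono g)
  also have "\<dots> = E (\<lambda>i. t\<^sup>2 * (f i)\<^sup>2 + 2 * t * e * f i + e\<^sup>2)"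
    by (simp add: power2_sum power_mult_distrib algebra_simps)
  also have "\<dots> = t\<^sup>2 * E (\<lambda>i. (f i)\<^sup>2) + 2 * t * e * E f + e\<^sup>2" by (simp only: E_add E_cmult E_const)
  also have "\<dots> \<le> t\<^sup>2 * c\<^sup>2 + 2 * t * e * c + e\<^sup>2"
    using E_le_bound[OF c] c t e by (intro add_mono mult_left_mono) auto
  also have "\<dots> = (t * c + e)\<^sup>2" by (simp add: power2_sum power_mult_distrib mult_ac)
  finally show ?thesis .
qed

text \<open>Minkowski twice, first within the rows and then for their quadratic means
  \<open>F\<close> and \<open>G\<close>.\<close>

lemma (in weights) E2_affine_square:
  assumes f: "\<And>i j. i \<in> I \<Longrightarrow> j \<in> I \<Longrightarrow> 0 \<le> f i j" and c: "E (\<lambda>i. E (\<lambda>j. (f i j)\<^sup>2)) \<le> c\<^sup>2" "0 \<le> c" and t: "0 \<le> t" and e: "0 \<le> e"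
    and g: "\<And>i j. i \<in> I \<Longrightarrow> j \<in> I \<Longrightarrow> 0 \<le> g i j" "\<And>i j. i \<in> I \<Longrightarrow> j \<in> I \<Longrightarrow> g i j \<le> t * f i j + e"
  shows "E (\<lambda>i. E (\<lambda>j. (g i j)\<^sup>2)) \<le> (t * c + e)\<^sup>2"
proof -
  define F where "F i = sqrt (E (\<lambda>j. (f i j)\<^sup>2))" for i
  have F: "0 \<le> F i" "(F i)\<^sup>2 = E (\<lambda>j. (f i j)\<^sup>2)" for i by (auto simp: F_def intro!: E_nonneg)
  define G where "G i = sqrt (E (\<lambda>j. (g i j)\<^sup>2))" for i
  have G: "0 \<le> G i" "(G i)\<^sup>2 = E (\<lambda>j. (g i j)\<^sup>2)" for i by (auto simp: G_def intro!: E_nonneg)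
  have "E (\<lambda>i. (G i)\<^sup>2) \<le> (t * c + e)\<^sup>2"
  proof (rule E_affine_square[where f = F])
    fix i assume i: "i \<in> I"
    have "(G i)\<^sup>2 \<le> (t * F i + e)\<^sup>2" unfolding G
      by (rule E_affine_square[where f = "f i"]) (use f g i t e F in auto)
    then show "G i \<le> t * F i + e" by (rule power2_le_imp_le) (use t e F in auto)
  qed (use F G c t e in auto)
  then show ?thesis by (simp add: G)
qed

section \<open>Excluding a positive critical level\<close>

locale flat_map = asymp_map \<psi> V p \<kappa> C T B + flat_space \<psi> V p \<kappa>
  for \<psi> :: "real^'n::finite \<Rightarrow> real" and V :: "'v::real_vector set" and p \<kappa> C T B
begin

definition bary :: "'v \<times> nat \<Rightarrow> 'v" where
  "bary q = (1 / real (snd q)) *\<^sub>R (\<Sum>m\<in>{snd q..<2 * snd q}. (T ^^ m) (fst q))"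

lemma bary_in:
  assumes "convex K" "0 < snd q" "pts q \<subseteq> K"
  shows "bary q \<in> K"
proof -
  have "bary q = (\<Sum>m\<in>{snd q..<2 * snd q}. (1 / real (snd q)) *\<^sub>R (T ^^ m) (fst q))"
    by (simp add: bary_def scaleR_sum_right)
  also have "\<dots> \<in> K" by (rule convex_sum) (use assms in \<open>auto simp: pts_def\<close>)
  finally show ?thesis .
qed

lemma Q_lipschitz:
  assumes wC: "w \<in> C" and zC: "z \<in> C" and d: "N (y - z) \<le> d" and M: "0 < M"
  shows "Q M w y \<le> Q M w z + (4 * B * d + d\<^sup>2)"
proof -
  have d0: "0 \<le> d" using d N.nonneg[of "y - z"] by linarith
  have "(\<Sum>m\<in>{M..<2 * M}. (N ((T ^^ m) w - y))\<^sup>2) \<le> (\<Sum>m\<in>{M..<2 * M}. (N ((T ^^ m) w - z))\<^sup>2 + (4 * B * d + d\<^sup>2))"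
  proof (rule sum_mono)
    fix m
    let ?f = "N ((T ^^ m) w - z)"
    have "N ((T ^^ m) w - y) \<le> ?f + d" using N.triangle[of "(T ^^ m) w" y z] d N.minus_commute[of y z] by simp
    then have "(N ((T ^^ m) w - y))\<^sup>2 \<le> (?f + d)\<^sup>2" by (intro power_mono) auto
    also have "\<dots> = ?f\<^sup>2 + 2 * ?f * d + d\<^sup>2" by (simp add: power2_sum)
    also have "2 * ?f * d \<le> 2 * (2 * B) * d"
      using N_diff[OF iter_in[OF wC] zC] d0 by (intro mult_right_mono mult_left_mono) auto
    finally show "(N ((T ^^ m) w - y))\<^sup>2 \<le> ?f\<^sup>2 + (4 * B * d + d\<^sup>2)" by simp
  qed
  also have "\<dots> = (\<Sum>m\<in>{M..<2 * M}. (N ((T ^^ m) w - z))\<^sup>2) + M * (4 * B * d + d\<^sup>2)" by (simp add: sum.distrib)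
  finally have "(\<Sum>m\<in>{M..<2 * M}. (N ((T ^^ m) w - y))\<^sup>2) / M \<le> ((\<Sum>m\<in>{M..<2 * M}. (N ((T ^^ m) w - z))\<^sup>2) + M * (4 * B * d + d\<^sup>2)) / M"
    by (rule divide_right_mono) simp
  then show ?thesis using M unfolding Q_def by (simp add: add_divide_distrib)
qed

text \<open>Failure of \<open>att\<close> gives every point of the hull a late window on which all
  orbits from \<open>S h\<close> stay away from it. Compactness of the hull bounds the position of
  that window, at the loss of another \<open>\<sigma>\<close>, so \<open>K\<close> can be used
  before the point is known.\<close>

lemma hull_lower_bound:
  assumes h: "inv_fun h" and na: "\<not> att h (r - \<sigma>)" and \<sigma>: "0 < \<sigma>" and F: "finite F" "F \<subseteq> S h"
  shows "\<exists>K. \<forall>z\<in>convex hull F. \<exists>M. n0 \<le> M \<and> 0 < M \<and> M \<le> K \<and> (\<forall>w\<in>S h. r - 2 * \<sigma> \<le> Q M w z)"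
proof (rule ccontr)
  assume "\<not> ?thesis"
  then have "\<forall>K. \<exists>z. z \<in> convex hull F \<and> (\<forall>M. n0 \<le> M \<and> 0 < M \<and> M \<le> K \<longrightarrow> (\<exists>w\<in>S h. Q M w z < r - 2 * \<sigma>))"
    by (meson not_le)
  from choice[OF this] obtain z where z: "\<And>K. z K \<in> convex hull F"
    "\<And>K M. n0 \<le> M \<Longrightarrow> 0 < M \<Longrightarrow> M \<le> K \<Longrightarrow> \<exists>w\<in>S h. Q M w (z K) < r - 2 * \<sigma>" by blast
  obtain U where U: "ultra U" "U \<le> (sequentially :: nat filter)" using seq_ultra_exists by blast
  from convex_hull_ultralimit[of U F z, OF U(1) F(1) z(1)] seminorm_N obtain y where
    y: "y \<in> convex hull F" "((\<lambda>k. N (y - z k)) \<longlongrightarrow> 0) U" by blast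
  have hullS: "convex hull F \<subseteq> S h" using F convex_S[OF h] by (simp add: hull_minimal)
  then have "y \<in> S h" using y by blast
  then obtain M where M: "max n0 1 \<le> M" "\<And>w. w \<in> S h \<Longrightarrow> r - \<sigma> \<le> Q M w y"
    using na unfolding att_def by (meson not_le)
  have "((\<lambda>k. 4 * B * N (y - z k) + (N (y - z k))\<^sup>2) \<longlongrightarrow> 4 * B * 0 + 0\<^sup>2) U"
    by (intro tendsto_intros y)
  then have "\<forall>\<^sub>F k in U. 4 * B * N (y - z k) + (N (y - z k))\<^sup>2 < \<sigma>"
    by (rule order_tendstoD(2)) (use \<sigma> in simp)
  moreover have "\<forall>\<^sub>F k in U. M \<le> k" using U(2) eventually_ge_at_top by (rule filter_leD)
  ultimately have "\<forall>\<^sub>F k in U. 4 * B * N (y - z k) + (N (y - z k))\<^sup>2 < \<sigma> \<and> M \<le> k" by (rule eventually_conj)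
  then obtain K where K: "4 * B * N (y - z K) + (N (y - z K))\<^sup>2 < \<sigma>" "M \<le> K"
    using eventually_happens'[OF ultra_neq_bot[OF U(1)]] by blast
  obtain w where w: "w \<in> S h" "Q M w (z K) < r - 2 * \<sigma>" using z(2)[OF _ _ K(2)] M(1) by auto
  have "Q M w y \<le> Q M w (z K) + (4 * B * N (y - z K) + (N (y - z K))\<^sup>2)"
    by (rule Q_lipschitz) (use w(1) z(1) hullS S_sub M(1) in auto)
  then show False using M(2)[OF w(1)] w(2) K(1) by linarith
qed

lemma N_le_sum: "N x \<le> (\<Sum>l\<in>UNIV. p l x)"
  using psi_le_sum[of "pv x"] by (simp add: N_def)

lemma att_mono: "att h r \<Longrightarrow> r \<le> r' \<Longrightarrow> att h r'"
  unfolding att_def by (meson less_le_trans)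

lemma att_large: "inv_fun h \<Longrightarrow> (2 * B)\<^sup>2 < r \<Longrightarrow> att h r"
proof -
  assume h: "inv_fun h" and r: "(2 * B)\<^sup>2 < r"
  then obtain z where z: "z \<in> S h" by (auto simp: inv_fun_def S_def)
  then have "Q M z z < r" for M using Q_le[of z z M] S_sub r by fastforce
  then show ?thesis using z unfolding att_def by blast
qed

end

context flat_map
begin

lemma iter_shift: "(T ^^ (m + s)) u = (T ^^ s) ((T ^^ m) u)"
  using funpow_add[of s m T] by (simp add: add.commute)

lemma bary_shift:
  assumes u: "fst q \<in> C" and M: "0 < snd q"
  shows "N (bary q - (1 / real (snd q)) *\<^sub>R (\<Sum>m\<in>{snd q..<2 * snd q}. (T ^^ (m + s)) (fst q))) \<le> 2 * s * B / real (snd q)"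
proof -
  let ?g = "\<lambda>m. (T ^^ m) (fst q)" and ?M = "snd q"
  have le: "N (\<Sum>m\<in>{a..<a + s}. ?g m) \<le> s * B" for a
  proof -
    have "N (\<Sum>m\<in>{a..<a + s}. ?g m) \<le> (\<Sum>m\<in>{a..<a + s}. N (?g m))" by (rule N.sum_le)
    also have "\<dots> \<le> (\<Sum>m\<in>{a..<a + s}. B)" by (intro sum_mono C_bound iter_in u)
    finally show ?thesis by simp
  qed
  have e: "(1 / real ?M) *\<^sub>R (\<Sum>m\<in>{?M..<2 * ?M}. ?g (m + s)) - bary q
    = (1 / real ?M) *\<^sub>R ((\<Sum>m\<in>{2 * ?M..<2 * ?M + s}. ?g m) - (\<Sum>m\<in>{?M..<?M + s}. ?g m))"
    unfolding bary_def scaleR_diff_right[symmetric] by (simp only: window_shift[where g = ?g and M = ?M and s = s])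
  have "N (bary q - (1 / real ?M) *\<^sub>R (\<Sum>m\<in>{?M..<2 * ?M}. ?g (m + s)))
    = (1 / real ?M) * N ((\<Sum>m\<in>{2 * ?M..<2 * ?M + s}. ?g m) - (\<Sum>m\<in>{?M..<?M + s}. ?g m))"
    by (subst N.minus_commute) (simp add: e N.scale)
  also have "\<dots> \<le> (1 / real ?M) * (s * B + s * B)"
    by (intro mult_left_mono order_trans[OF N.diff_le add_mono] le) auto
  finally show ?thesis by (simp add: field_simps)
qed

text \<open>The order of choices is essential. The constants and the length \<open>L\<close> come
  first, then the chain, whose thresholds anticipate every split; only afterwards does James'
  argument provide \<open>k\<close> and \<open>z\<close>, and \<open>t\<close> and the exponent
  \<open>s\<close> come last.\<close>

lemma no_critical_level:
  assumes \<rho>: "0 < \<rho>" and above: "\<And>h e. inv_fun h \<Longrightarrow> 0 < e \<Longrightarrow> att h (\<rho>\<^sup>2 + e)"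
    and below: "\<And>e. 0 < e \<Longrightarrow> \<exists>h. inv_fun h \<and> \<not> att h (\<rho>\<^sup>2 - e)"
  shows False
proof -
  define \<epsilon> where "\<epsilon> = \<rho> / (16 * real CARD('n set))"
  have \<epsilon>: "0 < \<epsilon>" using \<rho> by (simp add: \<epsilon>_def)
  define D where "D = 2 * B + 1"
  have D: "0 < D" using B_nonneg by (simp add: D_def)
  from spectral_gap[OF \<epsilon> \<rho> D] obtain \<eta> where \<eta>: "0 < \<eta>" "\<eta> < \<rho>" and gap:
    "\<And>(I :: (nat \<times> nat) set) w W X t. config \<psi> V p \<kappa> I w W X D \<Longrightarrow> 1 / 4 \<le> t \<Longrightarrow> t \<le> 3 / 4 \<Longrightarrow>
    weights.E I w (\<lambda>n. weights.E I w (\<lambda>m. (N (W n - W m))\<^sup>2)) \<le> (t * \<rho> + \<eta>)\<^sup>2 \<Longrightarrow>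
    weights.E I w (\<lambda>n. (N (W n - X n))\<^sup>2) \<le> ((1 - t) * \<rho> + \<eta>)\<^sup>2 \<Longrightarrow>
    (\<rho> - \<eta>)\<^sup>2 \<le> weights.E I w (\<lambda>n. (N (W n - (\<Sum>i\<in>I. w i *\<^sub>R X i)))\<^sup>2) \<Longrightarrow>
    \<exists>A. \<bar>t * \<rho> - weights.E I w (\<lambda>n. weights.E I w (\<lambda>m. \<psi> (\<chi> l. if l \<in> A then p l (X n - X m) else 0)))\<bar> \<le> \<epsilon>"
    by blast
  \<comment> \<open>The bound \<open>R + \<sigma>\<close> for all pairs, including those inside one
    window, must stay below \<open>cc\<^sup>2\<close> with \<open>cc\<close> only
    \<open>\<eta> / 2\<close> above \<open>\<rho>\<close>. The other half of \<open>\<eta>\<close>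
    pays for the error of the power of the map.\<close>
  define \<sigma> where "\<sigma> = \<rho> * \<eta> / 4"
  have \<sigma>: "0 < \<sigma>" using \<rho> \<eta> by (simp add: \<sigma>_def)
  define R where "R = \<rho>\<^sup>2 + 2 * \<sigma>"
  have R0: "0 \<le> R" using \<sigma> by (simp add: R_def)
  define cc where "cc = \<rho> + \<eta> / 2"
  have cc: "0 \<le> cc" "R + \<sigma> \<le> cc\<^sup>2" using \<rho> \<eta> by (auto simp: cc_def R_def \<sigma>_def power2_sum)
  obtain h where h: "inv_fun h" "\<not> att h (\<rho>\<^sup>2 - \<sigma>)" using below[OF \<sigma>] by blast
  have "0 < \<eta> / 2" using \<eta> by simp
  from asymp[OF this] obtain n0 where n0: "\<And>n x y. n0 \<le> n \<Longrightarrow> x \<in> C \<Longrightarrow> y \<in> C \<Longrightarrow> N ((T ^^ n) x - (T ^^ n) y) \<le> N (x - y) + \<eta> / 2"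
    by blast
  \<comment> \<open>Pairs inside one window have weight at most \<open>1 / Qn\<close> and squared
    distance at most \<open>(2 * B)\<^sup>2\<close>, so they contribute at most
    \<open>\<sigma>\<close>.\<close>
  obtain Qn :: nat where Qn: "(2 * B)\<^sup>2 / \<sigma> < real Qn" using reals_Archimedean2 by blast
  have Qn0: "0 < Qn" using Qn \<sigma> by (metis divide_nonneg_pos not_less_iff_gr_or_eq of_nat_0 less_le_trans not_less zero_le_power2 gr_zeroI)
  have Qn1: "1 / real Qn * (2 * B)\<^sup>2 \<le> \<sigma>" using Qn \<sigma> Qn0 by (simp add: field_simps)
  define r where "r = real CARD('n)"
  have r: "0 < r" by (simp add: r_def)
  \<comment> \<open>\<open>N\<close> is at most the sum of \<open>r\<close> seminorms, so James'
    argument leaves an error of \<open>\<eta> / 4\<close>; shifting the barycentres uses another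
    quarter.\<close>
  define \<delta> where "\<delta> = \<eta> / (4 * r)"
  have \<delta>: "0 < \<delta>" using \<eta> r by (simp add: \<delta>_def)
  from finite_james_spread[of V p \<kappa> \<delta> B Qn, OF V sp ns \<delta> B_nonneg Qn0] obtain L where
    L: "\<And>b::nat \<Rightarrow> 'v. (\<forall>i<L. b i \<in> V \<and> (\<forall>l. p l (b i) \<le> B)) \<Longrightarrow>
    (\<exists>k\<le>L. \<exists>z\<in>convex hull (b ` {..<k}). \<exists>w. (\<forall>i. 0 \<le> w i \<and> w i \<le> 1 / real Qn) \<and> (\<forall>i<k. w i = 0) \<and>
       sum w {..<L} = 1 \<and> (\<forall>l. p l (z - (\<Sum>i<L. w i *\<^sub>R b i)) < \<delta>))" by blast
  \<comment> \<open>The later windows will be at least \<open>Kc\<close> times as long as the window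
    at \<open>Ms\<close> that keeps orbits away from \<open>z\<close>. Since
    \<open>s < 2 * Ms\<close>, a shift by \<open>s\<close> costs at most \<open>4 * B / Kc\<close>
    for barycentres and \<open>8 * B / Kc\<close> for averages over pairs.\<close>
  obtain Kc :: nat where Kc: "16 * B / \<eta> + 8 * B / \<epsilon> < real Kc" using reals_Archimedean2 by blast
  have Kc0: "0 < real Kc" "16 * B / \<eta> \<le> real Kc" "8 * B / \<epsilon> \<le> real Kc"
    using Kc B_nonneg \<eta> \<epsilon> by (smt (verit) divide_nonneg_pos)+
  define good where "good F K \<longleftrightarrow> (\<forall>z\<in>convex hull F. \<exists>M. n0 \<le> M \<and> 0 < M \<and> M \<le> K \<and> (\<forall>w\<in>S h. \<rho>\<^sup>2 - 2 * \<sigma> \<le> Q M w z))" for F K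
  define KK where "KK F = (SOME K. good F K)" for F
  have KK: "good F (KK F)" if "finite F" "F \<subseteq> S h" for F
    unfolding KK_def by (rule someI_ex) (use hull_lower_bound[OF h \<sigma> that] in \<open>simp add: good_def\<close>)
  \<comment> \<open>The split point \<open>k\<close> is unknown while the windows are placed, so the
    sum provides for every prefix of the chain at once.\<close>
  define \<Theta> where "\<Theta> ps = Kc * (\<Sum>j\<le>length ps. KK (bary ` set (take j ps)))" for ps
  have A: "att g (\<rho>\<^sup>2 + \<sigma>)" if "inv_fun g" for g by (rule above[OF that \<sigma>])
  have "\<rho>\<^sup>2 + \<sigma> < R" using \<sigma> by (simp add: R_def)
  from chain_exists[OF A this h(1), of L \<Theta>] obtain z0 ps where z0: "z0 \<in> S h" and ps: "length ps = L" "chain \<Theta> R h z0 ps"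
    by blast
  define M where "M i = snd (ps ! i)" for i
  define v where "v i = fst (ps ! i)" for i
  define b where "b i = bary (ps ! i)" for i
  have vC: "v i \<in> C" and M0: "0 < M i" and M\<Theta>: "\<Theta> (take i ps) \<le> M i" and pS: "pts (ps ! i) \<subseteq> S h"
    and Qz: "Q (M i) (v i) z0 < R" and Qj: "\<And>j y. j < i \<Longrightarrow> y \<in> pts (ps ! j) \<Longrightarrow> Q (M i) (v i) y < R"
    if "i < L" for i
    using ps that unfolding chain_def M_def v_def by blast+
  have bS: "b i \<in> S h" if "i < L" for i
    unfolding b_def by (rule bary_in[OF convex_S[OF h(1)] _ pS[OF that]]) (use M0[OF that] in \<open>simp add: M_def\<close>)
  have "\<forall>i<L. b i \<in> V \<and> (\<forall>l. p l (b i) \<le> B)"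
  proof (intro allI impI)
    fix i assume "i < L"
    then have "b i \<in> C" using bS S_sub by blast
    then show "b i \<in> V \<and> (\<forall>l. p l (b i) \<le> B)" using C_sub C_bound p_le_N order_trans by blast
  qed
  from L[OF this] obtain k z c where k: "k \<le> L" and z: "z \<in> convex hull (b ` {..<k})"
    and c: "\<And>i. 0 \<le> c i" "\<And>i. c i \<le> 1 / real Qn" "\<And>i. i < k \<Longrightarrow> c i = 0" "sum c {..<L} = 1"
    and zc: "\<And>l. p l (z - (\<Sum>i<L. c i *\<^sub>R b i)) < \<delta>" by blast
  have kL: "sum c {k..<L} = 1"
  proof -
    have "sum c {k..<L} = sum c {..<L}" by (rule sum.mono_neutral_left) (use c(3) in auto)
    then show ?thesis using c(4) by simp
  qed
  have set_take: "bary ` set (take k ps) = b ` {..<k}"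
  proof -
    have "set (take k ps) = (\<lambda>i. ps ! i) ` {..<k}"
      using nth_image[of k ps] k ps(1) by (simp add: atLeast0LessThan)
    then show ?thesis by (auto simp: b_def)
  qed
  have "good (b ` {..<k}) (KK (b ` {..<k}))" by (rule KK) (use bS k in auto)
  then obtain Ms where Ms: "n0 \<le> Ms" "0 < Ms" "Ms \<le> KK (b ` {..<k})" "\<And>w. w \<in> S h \<Longrightarrow> \<rho>\<^sup>2 - 2 * \<sigma> \<le> Q Ms w z"
    using z unfolding good_def by blast
  have Mbig: "Kc * Ms \<le> M i" if i: "k \<le> i" "i < L" for i
  proof -
    have "KK (bary ` set (take k (take i ps))) \<le> (\<Sum>j\<le>length (take i ps). KK (bary ` set (take j (take i ps))))"
      by (rule member_le_sum) (use i ps(1) in auto)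
    moreover have "take k (take i ps) = take k ps" using i by (simp add: min_def)
    ultimately have "Ms \<le> (\<Sum>j\<le>length (take i ps). KK (bary ` set (take j (take i ps))))"
      using Ms(3) set_take by simp
    then have "Kc * Ms \<le> \<Theta> (take i ps)" unfolding \<Theta>_def by (rule mult_le_mono2)
    then show ?thesis using M\<Theta>[OF i(2)] by linarith
  qed
  have KM: "0 < Kc * Ms" using Kc0 Ms by simp
  interpret w: windows k L c M
    by unfold_locales (use c kL M0 in auto)
  define x where "x q = (T ^^ snd q) (v (fst q))" for q :: "nat \<times> nat"
  have I: "k \<le> fst q" "fst q < L" "x q \<in> pts (ps ! fst q)" if "q \<in> w.I" for q
    using that by (auto simp: w.I_def x_def pts_def M_def v_def)
  have xS: "x q \<in> S h" if "q \<in> w.I" for q using I[OF that] pS by blast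
  have xC: "x (i, m) \<in> C" if "i < L" for i m using iter_in[OF vC[OF that]] by (simp add: x_def)
  have SC: "y \<in> C" if "y \<in> S h" for y using that S_sub by blast
  have CV: "y \<in> V" if "y \<in> C" for y using that C_sub by blast
  have win: "(\<Sum>m\<in>{M i..<2 * M i}. (N (y - x (i, m)))\<^sup>2) / M i = Q (M i) (v i) y" for y i
    unfolding Q_def x_def by (simp add: N.minus_commute[of y])
  have P2: "w.E (\<lambda>q. w.E (\<lambda>q'. (N (x q - x q'))\<^sup>2)) \<le> cc\<^sup>2"
  proof -
    have "w.E (\<lambda>q. w.E (\<lambda>q'. (N (x q - x q'))\<^sup>2)) \<le> R + 1 / real Qn * (2 * B)\<^sup>2"
    proof (rule w.E_pairs)
      show "(N (x q - x q'))\<^sup>2 = (N (x q' - x q))\<^sup>2" for q q' by (simp add: N.minus_commute[of "x q"])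
      show "(N (x q - x q'))\<^sup>2 \<le> (2 * B)\<^sup>2" if "q \<in> w.I" "q' \<in> w.I" for q q'
        using that xS SC by (intro N2_le) auto
      show "(\<Sum>m\<in>{M j..<2 * M j}. (N (x q - x (j, m)))\<^sup>2) / M j \<le> R" if "q \<in> w.I" "fst q < j" "j < L" for q j
        unfolding win using Qj[OF that(3,2) I(3)[OF that(1)]] by simp
    qed (use R0 c in auto)
    then show ?thesis using Qn1 cc by linarith
  qed
  have P1: "w.E (\<lambda>q. (N (z0 - x q))\<^sup>2) \<le> cc\<^sup>2"
  proof -
    have "w.E (\<lambda>q. (N (z0 - x q))\<^sup>2) \<le> (\<Sum>i\<in>{k..<L}. c i * R)"
      by (rule w.E_window_mono) (use Qz in \<open>simp add: win less_imp_le\<close>)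
    also have "\<dots> = R" using kL by (simp flip: sum_distrib_right)
    finally show ?thesis using cc \<sigma> by linarith
  qed
  define \<Psi> where "\<Psi> A = w.E (\<lambda>q. w.E (\<lambda>q'. \<psi> (\<chi> l. if l \<in> A then p l (x q - x q') else 0)))" for A
  (* The finitely many values \<Psi> A do not depend on t, which is chosen away from all of them. *)
  obtain t where t: "1 / 4 \<le> t" "t \<le> 3 / 4" "\<And>A. 2 * \<epsilon> < \<bar>t * \<rho> - \<Psi> A\<bar>"
    using avoid_finite[OF \<rho> \<epsilon>_def, of \<Psi>] by blast
  define y where "y q = (1 - t) *\<^sub>R z0 + t *\<^sub>R x q" for q
  have yS: "y q \<in> S h" if "q \<in> w.I" for q
    unfolding y_def using convex_S[OF h(1)] z0 xS[OF that] t by (intro convexD) auto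
  \<comment> \<open>The lower bound at \<open>z\<close> holds on average over the window at
    \<open>Ms\<close> for every starting point \<open>y q\<close>. Averaging over \<open>q\<close>
    as well leaves one exponent that is common to all of them.\<close>
  have "\<exists>s\<in>{Ms..<2 * Ms}. \<rho>\<^sup>2 - 2 * \<sigma> \<le> w.E (\<lambda>q. (N ((T ^^ s) (y q) - z))\<^sup>2)"
  proof (rule ccontr)
    assume "\<not> ?thesis"
    then have "(\<Sum>s\<in>{Ms..<2 * Ms}. w.E (\<lambda>q. (N ((T ^^ s) (y q) - z))\<^sup>2)) < (\<Sum>s\<in>{Ms..<2 * Ms}. \<rho>\<^sup>2 - 2 * \<sigma>)"
      using Ms(2) by (intro sum_strict_mono) (auto simp: not_le)
    also have "\<dots> = Ms * (\<rho>\<^sup>2 - 2 * \<sigma>)" by simp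
    also have "\<dots> \<le> Ms * w.E (\<lambda>q. Q Ms (y q) z)"
    proof (rule mult_left_mono)
      have "w.E (\<lambda>q. \<rho>\<^sup>2 - 2 * \<sigma>) \<le> w.E (\<lambda>q. Q Ms (y q) z)" by (rule w.E_mono) (rule Ms(4)[OF yS])
      then show "\<rho>\<^sup>2 - 2 * \<sigma> \<le> w.E (\<lambda>q. Q Ms (y q) z)" by (simp only: w.E_const)
    qed simp
    also have "\<dots> = (\<Sum>s\<in>{Ms..<2 * Ms}. w.E (\<lambda>q. (N ((T ^^ s) (y q) - z))\<^sup>2))"
      unfolding w.E_sum[symmetric] w.E_cmult[symmetric] Q_def using Ms(2) by simp
    finally show False by simp
  qed
  then obtain s where s: "Ms \<le> s" "s < 2 * Ms" "\<rho>\<^sup>2 - 2 * \<sigma> \<le> w.E (\<lambda>q. (N ((T ^^ s) (y q) - z))\<^sup>2)" by auto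
  have sn0: "n0 \<le> s" using s(1) Ms(1) by linarith
  (* Applying T^s does not enlarge the distances to (1 - t) \<rho> and t \<rho>, but W stays far from z,
     which is close to the mean of X. *)
  define W where "W q = (T ^^ s) (y q)" for q
  define X where "X q = (T ^^ s) (x q)" for q
  have X_shift: "X q = x (fst q, snd q + s)" for q by (simp add: X_def x_def iter_shift)
  have WC: "W q \<in> C" and XC: "X q \<in> C" if "q \<in> w.I" for q
    unfolding W_def X_def using yS[OF that] xS[OF that] SC by (auto intro: iter_in)
  have cfg: "config \<psi> V p \<kappa> w.I w.w W X D"
  proof (unfold_locales)
    fix n m assume nm: "n \<in> w.I" "m \<in> w.I"
    show "N (W n - W m) \<le> D" "N (W n - X m) \<le> D"
      using N_diff[OF WC[OF nm(1)] WC[OF nm(2)]] N_diff[OF WC[OF nm(1)] XC[OF nm(2)]] by (auto simp: D_def)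
  qed (use WC XC CV in auto)
  have E1: "w.E (\<lambda>n. w.E (\<lambda>m. (N (W n - W m))\<^sup>2)) \<le> (t * \<rho> + \<eta>)\<^sup>2"
  proof -
    have "w.E (\<lambda>n. w.E (\<lambda>m. (N (W n - W m))\<^sup>2)) \<le> (t * cc + \<eta> / 2)\<^sup>2"
    proof (rule w.E2_affine_square[OF _ P2 cc(1)])
      fix n m assume nm: "n \<in> w.I" "m \<in> w.I"
      have "N (W n - W m) \<le> N (y n - y m) + \<eta> / 2"
        unfolding W_def by (rule n0[OF sn0]) (use nm yS SC in auto)
      also have "y n - y m = t *\<^sub>R (x n - x m)" by (simp add: y_def scaleR_diff_right)
      finally show "N (W n - W m) \<le> t * N (x n - x m) + \<eta> / 2" using t by (simp add: N.scale)
    qed (use t \<eta> in auto)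
    also have "\<dots> \<le> (t * \<rho> + \<eta>)\<^sup>2"
    proof (rule power_mono)
      have "t * \<eta> \<le> 1 * \<eta>" using t \<eta> by (intro mult_right_mono) auto
      then show "t * cc + \<eta> / 2 \<le> t * \<rho> + \<eta>" by (simp add: cc_def distrib_left)
    qed (use t cc \<eta> in auto)
    finally show ?thesis .
  qed
  have E2: "w.E (\<lambda>n. (N (W n - X n))\<^sup>2) \<le> ((1 - t) * \<rho> + \<eta>)\<^sup>2"
  proof -
    have "w.E (\<lambda>n. (N (W n - X n))\<^sup>2) \<le> ((1 - t) * cc + \<eta> / 2)\<^sup>2"
    proof (rule w.E_affine_square[OF _ P1 cc(1)])
      fix n assume n: "n \<in> w.I"
      have "N (W n - X n) \<le> N (y n - x n) + \<eta> / 2"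
        unfolding W_def X_def by (rule n0[OF sn0]) (use n yS xS SC in auto)
      also have "y n - x n = (1 - t) *\<^sub>R (z0 - x n)" by (simp add: y_def algebra_simps)
      finally show "N (W n - X n) \<le> (1 - t) * N (z0 - x n) + \<eta> / 2" using t by (simp add: N.scale)
    qed (use t \<eta> in auto)
    also have "\<dots> \<le> ((1 - t) * \<rho> + \<eta>)\<^sup>2"
    proof (rule power_mono)
      have "(1 - t) * \<eta> \<le> 1 * \<eta>" using t \<eta> by (intro mult_right_mono) auto
      then show "(1 - t) * cc + \<eta> / 2 \<le> (1 - t) * \<rho> + \<eta>" by (simp add: cc_def distrib_left)
    qed (use t cc \<eta> in auto)
    finally show ?thesis .
  qed
  define Xb where "Xb = (\<Sum>i\<in>w.I. w.w i *\<^sub>R X i)"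
  \<comment> \<open>The point \<open>z\<close> is near a combination of barycentres, and
    \<open>Xb\<close> is the same combination of the windows shifted by \<open>s\<close>.\<close>
  have zX: "N (z - Xb) \<le> \<eta> / 2"
  proof -
    let ?z = "\<Sum>i<L. c i *\<^sub>R b i"
    let ?a = "\<lambda>i. (1 / real (M i)) *\<^sub>R (\<Sum>m\<in>{M i..<2 * M i}. (T ^^ (m + s)) (v i))"
    have "N (z - ?z) \<le> (\<Sum>l\<in>(UNIV::'n set). \<delta>)"
      by (rule order_trans[OF N_le_sum]) (intro sum_mono less_imp_le zc)
    then have 1: "N (z - ?z) \<le> \<eta> / 4" using r by (simp add: \<delta>_def r_def)
    have z': "?z = (\<Sum>i\<in>{k..<L}. c i *\<^sub>R b i)"
      by (rule sum.mono_neutral_right) (use c(3) in auto)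
    have Xb: "Xb = (\<Sum>i\<in>{k..<L}. c i *\<^sub>R ?a i)"
      unfolding Xb_def w.sum_I by (simp add: X_shift x_def)
    have "N (?z - Xb) = N (\<Sum>i\<in>{k..<L}. c i *\<^sub>R (b i - ?a i))"
      unfolding z' Xb by (simp add: scaleR_diff_right sum_subtractf)
    also have "\<dots> \<le> (\<Sum>i\<in>{k..<L}. N (c i *\<^sub>R (b i - ?a i)))" by (rule N.sum_le)
    also have "\<dots> \<le> (\<Sum>i\<in>{k..<L}. c i * (\<eta> / 4))"
    proof (rule sum_mono)
      fix i assume i: "i \<in> {k..<L}"
      have "N (b i - ?a i) \<le> 2 * s * B / M i"
        using bary_shift[of "ps ! i" s] vC[of i] M0[of i] i by (simp add: b_def M_def v_def)
      also have "\<dots> \<le> 2 * s * B / (Kc * Ms)"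
        using Mbig[of i] M0[of i] i KM B_nonneg by (intro divide_left_mono) (auto simp flip: of_nat_mult)
      also have "\<dots> \<le> 2 * (2 * Ms) * B / (Kc * Ms)"
        using s(2) B_nonneg KM by (intro divide_right_mono mult_right_mono) auto
      also have "\<dots> = 4 * B / Kc" using Ms(2) by simp
      also have "\<dots> \<le> \<eta> / 4" using Kc0 \<eta> by (simp add: field_simps)
      finally have "N (b i - ?a i) \<le> \<eta> / 4" .
      then show "N (c i *\<^sub>R (b i - ?a i)) \<le> c i * (\<eta> / 4)"
        using mult_left_mono[OF _ c(1)[of i]] c(1)[of i] by (simp only: N.scale abs_of_nonneg)
    qed
    also have "\<dots> = \<eta> / 4" unfolding sum_distrib_right[symmetric] kL by simp
    finally have "N (?z - Xb) \<le> \<eta> / 4" .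
    then show ?thesis using 1 N.triangle[of z Xb ?z] by linarith
  qed
  have E3: "(\<rho> - \<eta>)\<^sup>2 \<le> w.E (\<lambda>n. (N (W n - Xb))\<^sup>2)"
  proof (rule ccontr)
    assume "\<not> ?thesis"
    then have lt: "w.E (\<lambda>n. (N (W n - Xb))\<^sup>2) \<le> (\<rho> - \<eta>)\<^sup>2" by simp
    have le: "N (W n - z) \<le> 1 * N (W n - Xb) + \<eta> / 2" for n
      using N.triangle[of "W n" z Xb] zX N.minus_commute[of z Xb] by simp
    have "w.E (\<lambda>n. (N (W n - z))\<^sup>2) \<le> (1 * (\<rho> - \<eta>) + \<eta> / 2)\<^sup>2"
      by (rule w.E_affine_square[OF _ lt]) (use le \<eta> in auto)
    also have "1 * (\<rho> - \<eta>) + \<eta> / 2 = \<rho> - \<eta> / 2" by simp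
    finally have "\<rho>\<^sup>2 - 2 * \<sigma> \<le> (\<rho> - \<eta> / 2)\<^sup>2" using s(3) unfolding W_def by linarith
    then have "\<rho> * \<eta> / 2 \<le> \<eta> * \<eta> / 4" by (simp add: \<sigma>_def power2_eq_square algebra_simps)
    moreover have "\<eta> * \<eta> \<le> \<rho> * \<eta>" using \<eta> by (intro mult_right_mono) auto
    moreover have "0 < \<rho> * \<eta>" using \<rho> \<eta> by simp
    ultimately show False by linarith
  qed
  from gap[OF cfg t(1,2) E1 E2 E3[unfolded Xb_def]] obtain A where
    A: "\<bar>t * \<rho> - w.E (\<lambda>n. w.E (\<lambda>m. \<psi> (\<chi> l. if l \<in> A then p l (X n - X m) else 0)))\<bar> \<le> \<epsilon>" by blast
  (* X is x shifted by s, which is negligible against the lengths of the windows. *)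
  define f where "f q q' = \<psi> (\<chi> l. if l \<in> A then p l (x q - x q') else 0)" for q q'
  have fb: "0 \<le> f q q' \<and> f q q' \<le> 2 * B" if "fst q < L" "fst q' < L" for q q'
  proof
    show "0 \<le> f q q'" by (simp add: f_def)
    have "f q q' \<le> N (x q - x q')" unfolding f_def N_def by (rule psi_mono) auto
    also have "\<dots> \<le> 2 * B" using xC[OF that(1), of "snd q"] xC[OF that(2), of "snd q'"] by (intro N_diff) auto
    finally show "f q q' \<le> 2 * B" .
  qed
  have "\<bar>w.E (\<lambda>q. w.E (\<lambda>q'. f (fst q, snd q + s) (fst q', snd q' + s))) - w.E (\<lambda>q. w.E (\<lambda>q'. f q q'))\<bar> \<le> 2 * (2 * B * s / (Kc * Ms))"
    unfolding of_nat_mult[symmetric]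
    by (rule w.E_shift2[where b = "2 * B", OF _ KM Mbig]) (use fb in auto)
  also have "\<dots> \<le> 2 * (2 * B * (2 * Ms) / (Kc * Ms))"
    using s(2) B_nonneg KM by (intro mult_left_mono divide_right_mono) auto
  also have "\<dots> = 8 * B / Kc" using Ms(2) by simp
  also have "\<dots> \<le> \<epsilon>" using Kc0 \<epsilon> by (simp add: field_simps)
  finally have "\<bar>w.E (\<lambda>n. w.E (\<lambda>m. \<psi> (\<chi> l. if l \<in> A then p l (X n - X m) else 0))) - \<Psi> A\<bar> \<le> \<epsilon>"
    unfolding f_def \<Psi>_def X_shift[symmetric] .
  then show False using A t(3)[of A] by linarith
qed

text \<open>The levels that hold for all admissible functions are closed upwards, and a positive
  infimum would be critical in the sense of \<open>no_critical_level\<close>. A square root is taken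
  because levels are squared distances.\<close>

lemma att_all:
  assumes h: "inv_fun h" and r: "0 < r"
  shows "att h r"
proof (rule ccontr)
  assume na: "\<not> att h r"
  define P where "P = {r. \<forall>h. inv_fun h \<longrightarrow> att h r}"
  have mono: "r2 \<in> P" if "r1 \<in> P" "r1 \<le> r2" for r1 r2 using that att_mono unfolding P_def by blast
  have ne: "(2 * B)\<^sup>2 + 1 \<in> P" unfolding P_def by (auto intro: att_large)
  have lb: "r \<le> x" if "x \<in> P" for x
  proof (rule ccontr)
    assume "\<not> r \<le> x"
    then have "r \<in> P" using mono[OF that] by simp
    then show False using na h by (simp add: P_def)
  qed
  then have bdd: "bdd_below P" by (rule bdd_belowI)
  define \<rho> where "\<rho> = sqrt (Inf P)"
  have "r \<le> Inf P" using ne lb by (intro cInf_greatest) auto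
  then have \<rho>: "0 < \<rho>" "\<rho>\<^sup>2 = Inf P" using r by (auto simp: \<rho>_def)
  show False
  proof (rule no_critical_level[OF \<rho>(1)])
    fix g and e :: real assume g: "inv_fun g" and e: "0 < e"
    then have "Inf P < \<rho>\<^sup>2 + e" using \<rho>(2) by simp
    then obtain x where "x \<in> P" "x < \<rho>\<^sup>2 + e" using cInf_lessD[of P] ne by blast
    then have "\<rho>\<^sup>2 + e \<in> P" using mono by simp
    then show "att g (\<rho>\<^sup>2 + e)" using g by (simp add: P_def)
  next
    fix e :: real assume e: "0 < e"
    have "\<rho>\<^sup>2 - e \<notin> P"
    proof
      assume "\<rho>\<^sup>2 - e \<in> P"
      then have "Inf P \<le> \<rho>\<^sup>2 - e" using bdd by (rule cInf_lower)
      then show False using \<rho>(2) e by simp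
    qed
    then show "\<exists>h. inv_fun h \<and> \<not> att h (\<rho>\<^sup>2 - e)" by (auto simp: P_def)
  qed
qed

end

section \<open>Direct sums and finite representability\<close>


context absnorm
begin

lemma rigid_strict:
  assumes "strictly_monotone_norm \<psi>" and uv: "\<And>l. 0 \<le> u $ l" "\<And>l. u $ l \<le> v $ l" and eq: "\<psi> u = \<psi> v"
  shows "u = v"
proof (rule ccontr)
  assume "u \<noteq> v"
  then obtain l where "u $ l \<noteq> v $ l" by (auto simp: vec_eq_iff)
  then have l: "u $ l < v $ l" using uv(2)[of l] by linarith
  have le: "\<bar>u $ i\<bar> \<le> \<bar>v $ i\<bar>" for i using uv(1)[of i] uv(2)[of i] by linarith
  have "\<bar>u $ l\<bar> < \<bar>v $ l\<bar>" using uv(1)[of l] l by linarith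
  then have "\<psi> u < \<psi> v" using assms(1) le unfolding strictly_monotone_norm_def by blast
  then show False using eq by simp
qed

text \<open>In dimension two a flat piece of the unit sphere is parallel to an axis and lies at height one:
  convexity of the norm along the axis propagates the equality down to the other axis.\<close>

lemma rigid_two:
  assumes two: "CARD('n) = 2" and uv: "\<And>l. 0 \<le> u $ l" "\<And>l. u $ l \<le> v $ l" and eq: "\<psi> u = \<psi> v" and ne: "u \<noteq> v"
  shows "\<exists>l. u $ l = \<psi> v \<and> v $ l = \<psi> v"
proof -
  obtain i where i: "u $ i < v $ i" using ne uv(2) by (auto simp: vec_eq_iff less_le)
  have "card (UNIV - {i}) = 1" using two by simp
  then obtain j where j: "UNIV - {i} = {j}" by (rule card_1_singletonE)
  then have ij: "j \<noteq> i" "\<And>l. l = i \<or> l = j" by blast+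
  define f where "f s = \<psi> (\<chi> l. if l = i then s else u $ j)" for s
  have u: "u = (\<chi> l. if l = i then u $ i else u $ j)" using ij(2) by (auto simp: vec_eq_iff)
  have fu: "f (u $ i) = \<psi> u" unfolding f_def by (rule arg_cong[OF u[symmetric]])
  have "f (v $ i) \<le> \<psi> v" unfolding f_def
  proof (rule psi_mono)
    show "0 \<le> (\<chi> l. if l = i then v $ i else u $ j) $ l" for l
      using uv(1)[of j] uv(1)[of i] uv(2)[of i] by auto
    show "(\<chi> l. if l = i then v $ i else u $ j) $ l \<le> v $ l" for l using ij(2)[of l] uv(2) by auto
  qed
  have vi: "0 < v $ i" using i uv(1)[of i] by linarith
  define \<theta> where "\<theta> = u $ i / v $ i"
  have \<theta>: "0 \<le> \<theta>" "\<theta> < 1" "u $ i = \<theta> * v $ i" using i uv(1)[of i] vi by (auto simp: \<theta>_def)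
  have "(\<chi> l. if l = i then u $ i else u $ j) = \<theta> *\<^sub>R (\<chi> l. if l = i then v $ i else u $ j) + (1 - \<theta>) *\<^sub>R (\<chi> l. if l = i then 0 else u $ j)"
    by (auto simp: vec_eq_iff \<theta>(3) algebra_simps)
  then have "f (u $ i) \<le> \<theta> * f (v $ i) + (1 - \<theta>) * f 0"
    unfolding f_def using psi_triangle[of "\<theta> *\<^sub>R (\<chi> l. if l = i then v $ i else u $ j)" "(1 - \<theta>) *\<^sub>R (\<chi> l. if l = i then 0 else u $ j)"] \<theta>
    by (simp add: psi_scale)
  also have "\<dots> \<le> \<theta> * \<psi> v + (1 - \<theta>) * f 0" using \<open>f (v $ i) \<le> \<psi> v\<close> \<theta> by (intro add_mono mult_left_mono) auto
  finally have "(1 - \<theta>) * \<psi> v \<le> (1 - \<theta>) * f 0" using fu eq by (simp add: algebra_simps)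
  then have "\<psi> v \<le> f 0" using \<theta>(2) by simp
  also have "f 0 = u $ j"
  proof -
    have "(\<chi> l. if l = i then 0 else u $ j) = (u $ j) *\<^sub>R axis j 1"
      using ij by (auto simp: vec_eq_iff axis_def)
    then show ?thesis using uv(1)[of j] by (simp add: f_def psi_scale psi_axis)
  qed
  finally have "\<psi> v \<le> u $ j" .
  moreover have "v $ j \<le> \<psi> v" using psi_ge_component[of v j] by linarith
  ultimately show ?thesis using uv(2)[of j] by (intro exI[of _ j]) linarith
qed

text \<open>Compactness: on the set \<open>S\<close> of violating pairs the two norms differ by
  rigidity, hence by at least a positive minimum.\<close>

lemma flat_modulus:
  assumes "strictly_monotone_norm \<psi> \<or> CARD('n) = 2" and \<epsilon>: "0 < \<epsilon>"
  shows "\<exists>\<eta>>0. \<forall>u v. (\<forall>l. 0 \<le> u $ l \<and> u $ l \<le> v $ l) \<and> \<psi> v \<le> B \<and> \<psi> v - \<psi> u \<le> \<eta> \<longrightarrow>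
    (\<forall>l. v $ l - u $ l \<le> \<epsilon>) \<or> (\<exists>l. v $ l - u $ l \<le> \<epsilon> \<and> \<psi> v - \<epsilon> \<le> u $ l)"
proof -
  \<comment> \<open>The negated conclusion is relaxed to non-strict inequalities, which makes
    \<open>S\<close> closed; equality of the norms is still impossible on it because
    \<open>\<epsilon>\<close> is positive.\<close>
  define S where "S = {z :: (real^'n) \<times> (real^'n). (\<forall>l. 0 \<le> fst z $ l \<and> fst z $ l \<le> snd z $ l) \<and> \<psi> (snd z) \<le> B \<and>
    (\<exists>l. \<epsilon> \<le> snd z $ l - fst z $ l) \<and> (\<forall>l. \<epsilon> \<le> snd z $ l - fst z $ l \<or> fst z $ l \<le> \<psi> (snd z) - \<epsilon>)}"
  have c: "continuous_on UNIV (\<lambda>z :: (real^'n) \<times> (real^'n). \<psi> (snd z))" "continuous_on UNIV (\<lambda>z :: (real^'n) \<times> (real^'n). \<psi> (fst z))"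
    by (rule continuous_on_compose2[OF psi_continuous[of UNIV]]; auto intro: continuous_intros)+
  have ex: "closed {z :: (real^'n) \<times> (real^'n). \<exists>l. \<epsilon> \<le> snd z $ l - fst z $ l}"
  proof -
    have "{z :: (real^'n) \<times> (real^'n). \<exists>l. \<epsilon> \<le> snd z $ l - fst z $ l} = (\<Union>l\<in>UNIV. {z. \<epsilon> \<le> snd z $ l - fst z $ l})" by auto
    also have "closed \<dots>" by (intro closed_UN finite ballI closed_Collect_le continuous_intros)
    finally show ?thesis .
  qed
  have "closed S" unfolding S_def
    by (intro closed_Collect_conj closed_Collect_all closed_Collect_disj closed_Collect_le ex continuous_intros c)
  moreover have "bounded S"
  proof (rule boundedI)
    fix z assume z: "z \<in> S"
    have v: "\<bar>snd z $ l\<bar> \<le> B" and u: "\<bar>fst z $ l\<bar> \<le> B" for l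
    proof -
      have "0 \<le> fst z $ l" "fst z $ l \<le> snd z $ l" "\<psi> (snd z) \<le> B" using z by (auto simp: S_def)
      then show "\<bar>snd z $ l\<bar> \<le> B" "\<bar>fst z $ l\<bar> \<le> B" using psi_ge_component[of "snd z" l] by linarith+
    qed
    have "norm z \<le> norm (fst z) + norm (snd z)" by (metis norm_Pair_le prod.collapse)
    also have "\<dots> \<le> (\<Sum>l\<in>UNIV. \<bar>fst z $ l\<bar>) + (\<Sum>l\<in>UNIV. \<bar>snd z $ l\<bar>)" by (intro add_mono norm_le_l1_cart)
    also have "\<dots> \<le> (\<Sum>l\<in>(UNIV::'n set). B) + (\<Sum>l\<in>(UNIV::'n set). B)" by (intro add_mono sum_mono u v)
    finally show "norm z \<le> (\<Sum>l\<in>(UNIV::'n set). B) + (\<Sum>l\<in>(UNIV::'n set). B)" .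
  qed
  ultimately have "compact S" by (simp add: compact_eq_bounded_closed)
  have "\<exists>\<eta>>0. \<forall>z\<in>S. \<eta> < \<psi> (snd z) - \<psi> (fst z)"
  proof (cases "S = {}")
    case False
    have "continuous_on S (\<lambda>z. \<psi> (snd z) - \<psi> (fst z))"
      by (intro continuous_on_diff continuous_on_subset[OF c(1)] continuous_on_subset[OF c(2)]) auto
    then obtain z where z: "z \<in> S" "\<And>y. y \<in> S \<Longrightarrow> \<psi> (snd z) - \<psi> (fst z) \<le> \<psi> (snd y) - \<psi> (fst y)"
      using continuous_attains_inf[OF \<open>compact S\<close> False] by blast
    have zS: "\<And>l. 0 \<le> fst z $ l" "\<And>l. fst z $ l \<le> snd z $ l" "\<exists>l. \<epsilon> \<le> snd z $ l - fst z $ l"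
      "\<And>l. \<epsilon> \<le> snd z $ l - fst z $ l \<or> fst z $ l \<le> \<psi> (snd z) - \<epsilon>" using z(1) by (auto simp: S_def)
    have "\<psi> (fst z) \<noteq> \<psi> (snd z)"
    proof
      assume eq: "\<psi> (fst z) = \<psi> (snd z)"
      have ne: "fst z \<noteq> snd z" using zS(3) \<epsilon> by auto
      with rigid_strict[OF _ zS(1,2) eq] assms(1) have "CARD('n) = 2" by blast
      from rigid_two[OF this zS(1,2) eq ne] obtain l where "fst z $ l = \<psi> (snd z)" "snd z $ l = \<psi> (snd z)" by blast
      then show False using zS(4)[of l] \<epsilon> by auto
    qed
    moreover have "\<psi> (fst z) \<le> \<psi> (snd z)" by (rule psi_mono) (rule zS)+
    ultimately have pos: "0 < \<psi> (snd z) - \<psi> (fst z)" by simp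
    then show ?thesis using z(2) by (intro exI[of _ "(\<psi> (snd z) - \<psi> (fst z)) / 2"]) force
  qed (auto intro: exI[of _ 1])
  then obtain \<eta> where \<eta>: "0 < \<eta>" "\<And>z. z \<in> S \<Longrightarrow> \<eta> < \<psi> (snd z) - \<psi> (fst z)" by blast
  show ?thesis
  proof (intro exI[of _ \<eta>] conjI \<eta>(1) allI impI, elim conjE)
    fix u v :: "real^'n"
    assume a: "\<forall>l. 0 \<le> u $ l \<and> u $ l \<le> v $ l" "\<psi> v \<le> B" "\<psi> v - \<psi> u \<le> \<eta>"
    have "(u, v) \<notin> S" using \<eta>(2)[of "(u, v)"] a(3) by auto
    then show "(\<forall>l. v $ l - u $ l \<le> \<epsilon>) \<or> (\<exists>l. v $ l - u $ l \<le> \<epsilon> \<and> \<psi> v - \<epsilon> \<le> u $ l)"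
      using a(1,2) unfolding S_def by (auto simp: not_le) (meson less_imp_le not_le)+
  qed
qed

end

context flat_space
begin

lemma fpp:
  assumes complete: "\<And>y. (\<And>k::nat. y k \<in> V) \<Longrightarrow> (\<And>e. 0 < e \<Longrightarrow> \<exists>k0. \<forall>j\<ge>k0. \<forall>k\<ge>k0. N (y j - y k) < e) \<Longrightarrow>
       \<exists>x\<in>V. (\<lambda>k. N (y k - x)) \<longlonglongrightarrow> 0"
    and def: "\<And>x. x \<in> V \<Longrightarrow> N x = 0 \<Longrightarrow> x = 0"
  shows "fpp_ani V N"
  unfolding fpp_ani_def
proof (intro allI impI)
  fix C :: "'v set" and T :: "'v \<Rightarrow> 'v"
  assume C: "C \<noteq> {} \<and> C \<subseteq> V \<and> n_bounded N C \<and> n_closed_in V N C \<and> convex C"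
    and T: "T ` C \<subseteq> C \<and> asympt_nonexp_intermediate N C T"
  obtain B where B: "\<And>x. x \<in> C \<Longrightarrow> N x \<le> B" using C by (auto simp: n_bounded_def)
  have as: "\<exists>n0. \<forall>n\<ge>n0. \<forall>x\<in>C. \<forall>y\<in>C. N ((T ^^ n) x - (T ^^ n) y) \<le> N (x - y) + e" if "0 < e" for e
    using T that unfolding asympt_nonexp_intermediate_def by (simp add: algebra_simps)
  interpret flat_map \<psi> V p \<kappa> C T B
    by unfold_locales (use C T B as in auto)
  show "\<exists>x\<in>C. T x = x"
  proof (rule fixed_point[OF att_all _ _ def])
    fix y :: "nat \<Rightarrow> 'v"
    assume y: "\<And>k. y k \<in> C" and ca: "\<And>e. 0 < e \<Longrightarrow> \<exists>k0. \<forall>j\<ge>k0. \<forall>k\<ge>k0. N (y j - y k) < e"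
    have "\<exists>x\<in>V. (\<lambda>k. N (y k - x)) \<longlonglongrightarrow> 0" by (rule complete[OF _ ca]) (use y C in blast)
    then show "\<exists>x\<in>C. (\<lambda>k. N (y k - x)) \<longlonglongrightarrow> 0" using y C unfolding n_closed_in_def by blast
  next
    show "n_continuous_on N C T" using T by (simp add: asympt_nonexp_intermediate_def)
  qed
qed

end

lemma nonsquare_on_mono: "nonsquare_on V \<kappa> p \<Longrightarrow> 0 < \<kappa>' \<Longrightarrow> \<kappa>' \<le> \<kappa> \<Longrightarrow> (\<And>x. 0 \<le> p x) \<Longrightarrow> nonsquare_on V \<kappa>' p"
  unfolding nonsquare_on_def
  by (meson diff_left_mono min.boundedI mult_right_mono order_trans)

text \<open>If \<open>norm y \<le> norm x\<close>, then \<open>x\<close> is \<open>norm y\<close>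
  times its unit vector plus a multiple of \<open>x\<close> of norm \<open>norm x - norm y\<close>.
  The condition on the sphere applies to the two unit vectors, and the triangle inequality adds the
  excess.\<close>

lemma uniformly_nonsquare_imp:
  assumes S: "subspace S" and u: "uniformly_nonsquare S"
  shows "\<exists>\<kappa>. nonsquare_on S \<kappa> norm"
proof -
  obtain d where d: "d < 2" "\<And>x y. x \<in> S \<Longrightarrow> y \<in> S \<Longrightarrow> norm x = 1 \<Longrightarrow> norm y = 1 \<Longrightarrow> min (norm (x + y)) (norm (x - y)) \<le> d"
    using u unfolding uniformly_nonsquare_def by blast
  define \<kappa> where "\<kappa> = min 1 (2 - d)"
  have \<kappa>: "0 < \<kappa>" "\<kappa> \<le> 1" "\<kappa> \<le> 2 - d" using d by (auto simp: \<kappa>_def)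
  have le: "min (norm (x + y)) (norm (x - y)) \<le> norm x + norm y - \<kappa> * min (norm x) (norm y)"
    if xy: "x \<in> S" "y \<in> S" "norm y \<le> norm x" for x y
  proof (cases "y = 0")
    case False
    then have y0: "0 < norm y" by simp
    then have x0: "0 < norm x" using xy by linarith
    let ?a = "(1 / norm x) *\<^sub>R x" and ?b = "(1 / norm y) *\<^sub>R y"
    have m: "min (norm (?a + ?b)) (norm (?a - ?b)) \<le> d"
      by (rule d(2)) (use xy S x0 y0 in \<open>auto intro: subspace_scale\<close>)
    have eq: "x + y = norm y *\<^sub>R (?a + ?b) + (1 - norm y / norm x) *\<^sub>R x"
      "x - y = norm y *\<^sub>R (?a - ?b) + (1 - norm y / norm x) *\<^sub>R x"
      using x0 y0 by (simp_all add: algebra_simps)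
    have n: "norm ((1 - norm y / norm x) *\<^sub>R x) = norm x - norm y"
      using x0 xy(3) by (simp add: field_simps)
    have "norm (x + y) \<le> norm y * norm (?a + ?b) + (norm x - norm y)"
      "norm (x - y) \<le> norm y * norm (?a - ?b) + (norm x - norm y)"
      using norm_triangle_ineq[of "norm y *\<^sub>R (?a + ?b)" "(1 - norm y / norm x) *\<^sub>R x"]
        norm_triangle_ineq[of "norm y *\<^sub>R (?a - ?b)" "(1 - norm y / norm x) *\<^sub>R x"]
      unfolding eq[symmetric] n by simp_all
    moreover have "norm y * min (norm (?a + ?b)) (norm (?a - ?b)) \<le> norm y * (2 - \<kappa>)"
      using m \<kappa> y0 by (intro mult_left_mono) auto
    moreover have "norm y * (2 - \<kappa>) + (norm x - norm y) = norm x + norm y - \<kappa> * norm y" by (simp add: algebra_simps)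
    moreover have "min (norm x) (norm y) = norm y" using xy(3) by simp
    ultimately show ?thesis by (cases "norm (?a + ?b) \<le> norm (?a - ?b)") (simp_all add: min_def)
  qed simp
  have "min (norm (x + y)) (norm (x - y)) \<le> norm x + norm y - \<kappa> * min (norm x) (norm y)" if "x \<in> S" "y \<in> S" for x y
  proof (cases "norm y \<le> norm x")
    case True
    then show ?thesis using le that by blast
  next
    case False
    then have "min (norm (y + x)) (norm (y - x)) \<le> norm y + norm x - \<kappa> * min (norm y) (norm x)" using le that by simp
    then show ?thesis by (simp add: add.commute norm_minus_commute min.commute)
  qed
  then show ?thesis using \<kappa> by (auto simp: nonsquare_on_def)
qed

locale nonsquare_sum = absnorm \<psi> for \<psi> :: "real^'n::finite \<Rightarrow> real" +
  fixes X :: "'n \<Rightarrow> 'a::banach set" and \<kappa> :: real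
  assumes X: "subspace (X i)" "closed (X i)" and X_ns: "nonsquare_on (X i) \<kappa> norm"
    and mono: "strictly_monotone_norm \<psi> \<or> CARD('n) = 2"
begin

lemma subspace_psi_sum: "subspace (psi_sum X)"
  using X(1) by (auto simp: psi_sum_def subspace_def)

lemma seminorm_component: "seminorm (\<lambda>x :: 'a^'n. norm (x $ l))"
  by unfold_locales (simp_all add: norm_triangle_ineq)

sublocale S: flat_space \<psi> "psi_sum X" "\<lambda>l x. norm (x $ l)" \<kappa>
proof (intro flat_space.intro sum_space.intro sum_space_axioms.intro flat_space_axioms.intro)
  show "nonsquare_on (psi_sum X) \<kappa> (\<lambda>x. norm (x $ l))" for l
    using X_ns[of l] unfolding nonsquare_on_def psi_sum_def by auto
qed (rule absnorm_axioms subspace_psi_sum seminorm_component flat_modulus[OF mono]; assumption?)+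

lemma psi_norm_eq: "S.N = psi_norm \<psi>"
  by (rule ext) (simp add: S.N_def S.pv_def psi_norm_def)

lemma fpp_psi_sum: "fpp_ani (psi_sum X) (psi_norm \<psi>)"
  unfolding psi_norm_eq[symmetric]
proof (rule S.fpp)
  fix y :: "nat \<Rightarrow> 'a^'n"
  assume y: "\<And>k. y k \<in> psi_sum X" and ca: "\<And>e. 0 < e \<Longrightarrow> \<exists>k0. \<forall>j\<ge>k0. \<forall>k\<ge>k0. S.N (y j - y k) < e"
  have "\<exists>a\<in>X l. (\<lambda>k. y k $ l) \<longlonglongrightarrow> a" for l
  proof -
    have "Cauchy (\<lambda>k. y k $ l)"
    proof (rule metric_CauchyI)
      fix e :: real assume "0 < e"
      then obtain k0 where k0: "\<And>j k. j \<ge> k0 \<Longrightarrow> k \<ge> k0 \<Longrightarrow> S.N (y j - y k) < e" using ca by blast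
      have "dist (y j $ l) (y k $ l) < e" if "j \<ge> k0" "k \<ge> k0" for j k
        using k0[OF that] S.p_le_N[of "y j - y k" l] by (simp add: dist_norm)
      then show "\<exists>M. \<forall>m\<ge>M. \<forall>n\<ge>M. dist (y m $ l) (y n $ l) < e" by blast
    qed
    then obtain a where a: "(\<lambda>k. y k $ l) \<longlonglongrightarrow> a" using Cauchy_convergent_iff convergent_def by blast
    moreover have "a \<in> X l" by (rule closed_sequentially[OF X(2) _ a]) (use y in \<open>auto simp: psi_sum_def\<close>)
    ultimately show ?thesis by blast
  qed
  then obtain a where a: "\<And>l. a l \<in> X l" "\<And>l. (\<lambda>k. y k $ l) \<longlonglongrightarrow> a l" by metis
  let ?x = "\<chi> l. a l"
  have "(\<lambda>k. \<Sum>l\<in>UNIV. norm (y k $ l - a l)) \<longlonglongrightarrow> (\<Sum>l\<in>UNIV. norm (a l - a l))"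
    by (intro tendsto_intros a)
  then have "(\<lambda>k. \<Sum>l\<in>UNIV. norm (y k $ l - a l)) \<longlonglongrightarrow> 0" by simp
  note lim = this
  have "\<forall>\<^sub>F k in sequentially. S.N (y k - ?x) \<le> (\<Sum>l\<in>UNIV. norm (y k $ l - a l))"
  proof (rule always_eventually, rule allI)
    show "S.N (y k - ?x) \<le> (\<Sum>l\<in>UNIV. norm (y k $ l - a l))" for k
      using psi_le_sum[of "S.pv (y k - ?x)"] by (simp add: S.N_def)
  qed
  from tendsto_sandwich[OF _ this tendsto_const lim] have "(\<lambda>k. S.N (y k - ?x)) \<longlonglongrightarrow> 0"
    by (simp add: seminorm.nonneg[OF S.seminorm_N])
  then show "\<exists>x\<in>psi_sum X. (\<lambda>k. S.N (y k - x)) \<longlonglongrightarrow> 0"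
    using a(1) by (intro bexI[of _ ?x]) (auto simp: psi_sum_def)
next
  fix x :: "'a^'n" assume "S.N x = 0"
  then have "norm (x $ l) \<le> 0" for l using S.p_le_N[of x l] by simp
  then show "x = 0" by (simp add: vec_eq_iff)
qed

text \<open>The norm of \<open>'b\<close> is recovered as \<open>\<psi>\<close> of ultralimits of
  the component norms of almost isometries \<open>T i\<close>. The index combines a finite set, on
  whose span the estimate holds, with an integer that makes the distortion tend to one; every vector
  eventually lies in the span.\<close>

lemma fpp_finitely_representable:
  assumes rep: "finitely_representable_in TYPE('b::banach) (psi_sum X) (psi_norm \<psi>)"
  shows "fpp_ani (UNIV :: 'b set) norm"
proof -
  define F where "F = finite_subsets_at_top (UNIV :: 'b set) \<times>\<^sub>F (sequentially :: nat filter)"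
  have "F \<noteq> bot" by (simp add: F_def prod_filter_eq_bot)
  then obtain U where U: "U \<le> F" "ultra U" using ultra_exists by blast
  have nb: "U \<noteq> bot" using U(2) by (rule ultra_neq_bot)
  define good where "good i T a \<longleftrightarrow> linear T \<and> T ` span (fst i) \<subseteq> psi_sum X \<and> 0 < a \<and>
     (\<forall>x\<in>span (fst i). a * norm x \<le> psi_norm \<psi> (T x) \<and> psi_norm \<psi> (T x) \<le> (1 + 1 / real (Suc (snd i))) * a * norm x)"
    for i :: "'b set \<times> nat" and T :: "'b \<Rightarrow> 'a^'n" and a :: real
  have "\<exists>T a. good i T a" if fin: "finite (fst i)" for i
  proof -
    have "\<exists>T::'b \<Rightarrow> 'a^'n. linear T \<and> T ` span (fst i) \<subseteq> psi_sum X \<and>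
           (\<exists>a b. 0 < a \<and> b \<le> (1 + 1 / real (Suc (snd i))) * a \<and>
              (\<forall>x\<in>span (fst i). a * norm x \<le> psi_norm \<psi> (T x) \<and> psi_norm \<psi> (T x) \<le> b * norm x))"
      using rep fin unfolding finitely_representable_in_def by (metis subspace_span zero_less_divide_1_iff of_nat_0_less_iff zero_less_Suc)
    then obtain T a b where "linear T" "T ` span (fst i) \<subseteq> psi_sum X" "0 < a" and b: "b \<le> (1 + 1 / real (Suc (snd i))) * a"
      and *: "\<And>x. x \<in> span (fst i) \<Longrightarrow> a * norm x \<le> psi_norm \<psi> (T x)" "\<And>x. x \<in> span (fst i) \<Longrightarrow> psi_norm \<psi> (T x) \<le> b * norm x"
      by blast
    moreover have "psi_norm \<psi> (T x) \<le> (1 + 1 / real (Suc (snd i))) * a * norm x" if "x \<in> span (fst i)" for x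
      using *(2)[OF that] mult_right_mono[OF b norm_ge_zero[of x]] by linarith
    ultimately show ?thesis unfolding good_def by blast
  qed
  \<comment> \<open>Finite representability provides maps for finite sets only, and along
    \<open>U\<close> the first component of the index is eventually finite.\<close>
  then have "\<forall>i. \<exists>T a. finite (fst i) \<longrightarrow> good i T a" by blast
  then obtain T a where Ta: "\<And>i. finite (fst i) \<Longrightarrow> good i (T i) (a i)" by metis
  have ev: "\<forall>\<^sub>F i in U. finite (fst i) \<and> y \<in> fst i" for y
  proof (rule filter_leD[OF U(1)])
    have "\<forall>\<^sub>F Y in finite_subsets_at_top UNIV. finite Y \<and> y \<in> Y"
      unfolding eventually_finite_subsets_at_top by (intro exI[of _ "{y}"]) auto
    then show "\<forall>\<^sub>F i in F. finite (fst i) \<and> y \<in> fst i"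
      unfolding F_def using filterlim_fst unfolding filterlim_iff by blast
  qed
  have evs: "\<forall>\<^sub>F i in U. good i (T i) (a i) \<and> y \<in> span (fst i)" for y
    using ev[of y] by eventually_elim (use Ta span_base in blast)
  \<comment> \<open>Only the ratio of the two constants is controlled; dividing by
    \<open>a i\<close> normalises the lower one to 1.\<close>
  define q where "q l i y = norm (T i y $ l) / a i" for l i y
  define P where "P l y = Lim U (\<lambda>i. q l i y)" for l y
  have a0: "\<forall>\<^sub>F i in U. 0 < a i" using evs[of 0] by eventually_elim (simp add: good_def)
  have lim: "((\<lambda>i. q l i y) \<longlongrightarrow> P l y) U" for l y
    unfolding P_def
  proof (rule ultra_tendsto_bounded[OF U(2), where B = "2 * norm y"])
    show "\<forall>\<^sub>F i in U. \<bar>q l i y\<bar> \<le> 2 * norm y" using evs[of y]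
    proof eventually_elim
      case (elim i)
      have "norm (T i y $ l) \<le> psi_norm \<psi> (T i y)" using S.p_le_N[of "T i y" l] by (simp add: psi_norm_eq)
      also have "\<dots> \<le> (1 + 1 / real (Suc (snd i))) * a i * norm y" using elim by (simp add: good_def)
      also have "\<dots> \<le> 2 * a i * norm y"
        using elim by (intro mult_right_mono) (auto simp: good_def)
      finally show ?case using elim by (simp add: q_def good_def field_simps)
    qed
  qed
  have spP: "seminorm (P l)" for l
  proof
    fix x y :: 'b and c :: real
    show "P l (x + y) \<le> P l x + P l y"
    proof (rule tendsto_le[OF nb tendsto_add[OF lim lim] lim])
      show "\<forall>\<^sub>F i in U. q l i (x + y) \<le> q l i x + q l i y" using evs[of x]
        by eventually_elim
           (simp add: q_def good_def linear_add divide_right_mono norm_triangle_ineq flip: add_divide_distrib)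
    qed
    have "\<forall>\<^sub>F i in U. \<bar>c\<bar> * q l i x = q l i (c *\<^sub>R x)" using evs[of x]
      by eventually_elim (simp add: q_def good_def linear_scale)
    then have "((\<lambda>i. q l i (c *\<^sub>R x)) \<longlongrightarrow> \<bar>c\<bar> * P l x) U"
      by (rule Lim_transform_eventually[OF tendsto_mult[OF tendsto_const lim]])
    then show "P l (c *\<^sub>R x) = \<bar>c\<bar> * P l x" by (rule tendsto_unique[OF nb lim])
  qed
  have nsP: "nonsquare_on UNIV \<kappa> (P l)" for l
    unfolding nonsquare_on_def
  proof (intro conjI ballI)
    show "0 < \<kappa>" "\<kappa> \<le> 1" using X_ns[of l] by (auto simp: nonsquare_on_def)
    fix x y :: 'b
    show "min (P l (x + y)) (P l (x - y)) \<le> P l x + P l y - \<kappa> * min (P l x) (P l y)"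
    proof (rule tendsto_le[OF nb tendsto_diff[OF tendsto_add[OF lim lim] tendsto_mult[OF tendsto_const tendsto_min[OF lim lim]]]
          tendsto_min[OF lim lim]])
      show "\<forall>\<^sub>F i in U. min (q l i (x + y)) (q l i (x - y)) \<le> q l i x + q l i y - \<kappa> * min (q l i x) (q l i y)"
        using evs[of x] evs[of y]
      proof eventually_elim
        case (elim i)
        then have g: "linear (T i)" "0 < a i" "T i x \<in> psi_sum X" "T i y \<in> psi_sum X" by (auto simp: good_def)
        let ?u = "T i x $ l" and ?v = "T i y $ l"
        have "?u \<in> X l" "?v \<in> X l" using g by (auto simp: psi_sum_def)
        then have "min (norm (?u + ?v)) (norm (?u - ?v)) \<le> norm ?u + norm ?v - \<kappa> * min (norm ?u) (norm ?v)"
          using X_ns[of l] by (simp add: nonsquare_on_def)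
        from divide_right_mono[OF this less_imp_le[OF g(2)]]
        have "min (norm (?u + ?v) / a i) (norm (?u - ?v) / a i) \<le> norm ?u / a i + norm ?v / a i - \<kappa> * min (norm ?u) (norm ?v) / a i"
          using g(2) by (simp add: min_divide_distrib_right add_divide_distrib diff_divide_distrib)
        also have "\<kappa> * min (norm ?u) (norm ?v) / a i = \<kappa> * min (norm ?u / a i) (norm ?v / a i)"
          using g(2) by (simp only: times_divide_eq_right[symmetric] min_divide_distrib_right less_imp_le if_True)
        finally show ?case by (simp add: q_def linear_add[OF g(1)] linear_diff[OF g(1)])
      qed
    qed
  qed
  interpret R: flat_space \<psi> "UNIV :: 'b set" P \<kappa>
    by (intro flat_space.intro sum_space.intro sum_space_axioms.intro flat_space_axioms.intro)
      (rule absnorm_axioms subspace_UNIV spP nsP flat_modulus[OF mono]; assumption?)+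
  have RN: "R.N y = norm y" for y
  proof -
    have "((\<lambda>i. \<chi> l. q l i y) \<longlongrightarrow> R.pv y) U" unfolding R.pv_def by (intro tendsto_vec_lambda lim)
    then have "((\<lambda>i. \<psi> (\<chi> l. q l i y)) \<longlongrightarrow> R.N y) U"
      unfolding R.N_def by (rule continuous_on_tendsto_compose[OF psi_continuous[of UNIV]]) auto
    moreover have "((\<lambda>i. \<psi> (\<chi> l. q l i y)) \<longlongrightarrow> norm y) U"
    proof (rule tendsto_sandwich)
      have eq: "\<psi> (\<chi> l. q l i y) = psi_norm \<psi> (T i y) / a i" if "0 < a i" for i
      proof -
        have "(\<chi> l. q l i y) = (1 / a i) *\<^sub>R (\<chi> l. norm (T i y $ l))" by (simp add: vec_eq_iff q_def)
        then show ?thesis using that by (simp add: psi_scale psi_norm_def)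
      qed
      show "\<forall>\<^sub>F i in U. norm y \<le> \<psi> (\<chi> l. q l i y)" using evs[of y]
        by eventually_elim (simp add: good_def eq field_simps)
      show "\<forall>\<^sub>F i in U. \<psi> (\<chi> l. q l i y) \<le> (1 + 1 / real (Suc (snd i))) * norm y" using evs[of y]
      proof eventually_elim
        case (elim i)
        then have "0 < a i" "psi_norm \<psi> (T i y) \<le> (1 + 1 / real (Suc (snd i))) * a i * norm y" by (auto simp: good_def)
        from divide_right_mono[OF this(2) less_imp_le[OF this(1)]] this(1) show ?case by (simp add: eq)
      qed
      have "filterlim snd sequentially F" unfolding F_def by (rule filterlim_snd)
      then have "filterlim snd sequentially U" by (rule filterlim_mono[OF _ order_refl U(1)])
      then have "((\<lambda>i. 1 / real (Suc (snd i))) \<longlongrightarrow> 0) U"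
        using filterlim_compose[OF LIMSEQ_inverse_real_of_nat] by (simp add: inverse_eq_divide)
      then have "((\<lambda>i. (1 + 1 / real (Suc (snd i))) * norm y) \<longlongrightarrow> (1 + 0) * norm y) U" by (intro tendsto_intros)
      then show "((\<lambda>i. (1 + 1 / real (Suc (snd i))) * norm y) \<longlongrightarrow> norm y) U" by simp
    qed simp
    ultimately show ?thesis by (rule tendsto_unique[OF nb])
  qed
  then have "R.N = norm" by (rule ext)
  have "fpp_ani UNIV R.N"
  proof (rule R.fpp)
    fix y :: "nat \<Rightarrow> 'b" assume "\<And>e. 0 < e \<Longrightarrow> \<exists>k0. \<forall>j\<ge>k0. \<forall>k\<ge>k0. R.N (y j - y k) < e"
    then have "Cauchy y" by (intro metric_CauchyI) (simp add: RN dist_norm)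
    then obtain x where "y \<longlonglongrightarrow> x" using Cauchy_convergent_iff convergent_def by blast
    then show "\<exists>x\<in>UNIV. (\<lambda>k. R.N (y k - x)) \<longlonglongrightarrow> 0" unfolding RN by (auto simp: tendsto_norm_zero_iff LIM_zero_iff)
  qed (simp add: RN)
  then show ?thesis by (simp add: \<open>R.N = norm\<close>)
qed

end

text \<open>Nonsquareness persists for smaller constants, so the minimum over the finitely many
  summands serves all of them.\<close>

lemma nonsquare_sum_exists:
  fixes X :: "'n::finite \<Rightarrow> 'a::banach set" and \<psi> :: "real^'n \<Rightarrow> real"
  assumes X: "\<forall>i. subspace (X i) \<and> closed (X i)" "\<forall>i. uniformly_nonsquare (X i)"
    and \<psi>: "absolute_normalized_norm \<psi>" "strictly_monotone_norm \<psi> \<or> CARD('n) = 2"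
  shows "\<exists>\<kappa>. nonsquare_sum \<psi> X \<kappa>"
proof -
  have "\<forall>i. \<exists>\<kappa>. nonsquare_on (X i) \<kappa> norm" using X uniformly_nonsquare_imp by blast
  then obtain k where k: "\<And>i. nonsquare_on (X i) (k i) norm" by metis
  have "0 < k i" for i using k[of i] by (simp add: nonsquare_on_def)
  then have pos: "0 < Min (range k)" by simp
  have "nonsquare_on (X i) (Min (range k)) norm" for i
    by (rule nonsquare_on_mono[OF k pos]) auto
  then show ?thesis using X \<psi> by (intro exI[of _ "Min (range k)"]) (unfold_locales, auto)
qed

theorem theorem3p8:
  fixes X :: "'n::finite \<Rightarrow> 'a::banach set"
    and \<psi> :: "real^'n \<Rightarrow> real"
  assumes "\<forall>i. subspace (X i) \<and> closed (X i)"
    and "\<forall>i. uniformly_nonsquare (X i)"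
    and "absolute_normalized_norm \<psi>"
    and "strictly_monotone_norm \<psi> \<or> CARD('n) = 2"
  shows "fpp_ani (psi_sum X) (psi_norm \<psi>) \<and>
         (finitely_representable_in TYPE('b::banach) (psi_sum X) (psi_norm \<psi>) \<longrightarrow>
            fpp_ani (UNIV :: 'b set) norm)"
proof -
  from nonsquare_sum_exists[OF assms] obtain \<kappa> where "nonsquare_sum \<psi> X \<kappa>" ..
  then interpret nonsquare_sum \<psi> X \<kappa> .
  show ?thesis using fpp_psi_sum fpp_finitely_representable by blast
qed

end
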